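(* Let $r_1,r_2$ be positive integers, $r=r_1+r_2$, $q,Q$ indeterminates, $z=\frac{q^r(1-q)}{1-q^{r}}$ and $y=\frac{(q^{r_2}Q+1)(1-q^{r_1})}{1-q^r}-1$. Let $tr:H_\infty(q,Q)\to\mathbb{C}(q,Q)$ be a Markov trace with parameter $z$ such that $tr(t'_0t'_1\cdots t'_{k-1})=y^k$ for all $k\ge1$. Then for every $n\ge1$ and every $x\in H_n(q,Q)$, $$tr(x)=\sum_{(\alpha,\beta)\vdash n}W_{(\alpha,\beta)}(q,Q)\,\chi^{(\alpha,\beta)}(x),$$ i.e. the weights of $tr$ (its values at minimal idempotents of the simple component indexed by $(\alpha,\beta)$) are $W_{(\alpha,\beta)}(q,Q)$.
   Context: $H_n(q,Q)$ is the Hecke algebra of type $B_n$ over $\mathbb{C}(q,Q)$ with generators $t,g_1,\dots,g_{n-1}$ and relations $g_ig_{i+1}g_i=g_{i+1}g_ig_{i+1}$, $g_ig_j=g_jg_i$ ($|i-j|\ge2$), $g_i^2=(q-1)g_i+q$, $t^2=(Q-1)t+Q$, $tg_1tg_1=g_1tg_1t$, $tg_i=g_it$ ($i\ge2$); $H_\infty(q,Q)=\bigcup_n H_n(q,Q)$ via the natural inclusions. Set $t'_0=t$ and $t'_i=g_i\cdots g_1\,t\,g_1^{-1}\cdots g_i^{-1}$. A Markov trace with parameter $z$ is a $\mathbb{C}(q,Q)$-linear map $tr$ on $H_\infty(q,Q)$ with $tr(hh')=tr(h'h)$, $tr(1)=1$, and $tr(hg_n)=z\,tr(h)$ for all $n\ge1$,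 $h\in H_n(q,Q)$. $H_n(q,Q)$ is semisimple with irreducible representations indexed by double partitions $(\alpha,\beta)\vdash n$ ($|\alpha|+|\beta|=n$); $\chi^{(\alpha,\beta)}$ is the corresponding character. With $s_\alpha(x_1,\dots,x_k)$ the Schur polynomial (zero if $\ell(\alpha)>k$) and $\alpha_i,\beta_j=0$ beyond their lengths, $$W_{(\alpha,\beta)}(q,Q)=q^{r_1|\beta|}\frac{s_\alpha(1,q,\dots,q^{r_1-1})\,s_\beta(1,q,\dots,q^{r_2-1})}{\left(\frac{1-q^{r}}{1-q}\right)^{|\alpha|+|\beta|}}\prod_{i=1}^{r_1}\prod_{j=1}^{r_2}\frac{1+Qq^{\alpha_i-\beta_j+j-i}}{1+Qq^{j-i}}.$$ *)

theory Defs
  imports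
    "HOL-Library.Poly_Mapping"
    "HOL-Computational_Algebra.Fraction_Field"
    "HOL-Computational_Algebra.Polynomial"
    "Jordan_Normal_Form.Determinant"
begin

section \<open>The ground field\<close>

text \<open>The field of rational functions in \<open>q\<close> and \<open>Q\<close> over the complex numbers, as the fraction
  field of \<open>\<complex>[q][Q]\<close>.\<close>

type_synonym ratfun = "complex poly poly fract"

definition qvar :: ratfun where
  "qvar = Fract [:[:0, 1:]:] 1"

definition Qvar :: ratfun where
  "Qvar = Fract [:0, 1:] 1"


section \<open>The Hecke algebras of type B\<close>

text \<open>Lists form the free monoid under concatenation, so that the finitely supported functions
  on \<open>nat list\<close>, with the convolution product of \<open>Poly_Mapping\<close>, form the free associative algebra
  on generators indexed by \<open>nat\<close>. Index \<open>0\<close> stands for \<open>t\<close> and index \<open>i \<ge> 1\<close> for \<open>g\<^sub>i\<close>.\<close>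

instantiation list :: (type) monoid_add
begin

definition zero_list :: "'a list" where "zero_list = []"

definition plus_list :: "'a list \<Rightarrow> 'a list \<Rightarrow> 'a list" where "plus_list = (@)"

instance
  by standard (simp_all add: zero_list_def plus_list_def)

end

type_synonym free_alg = "nat list \<Rightarrow>\<^sub>0 ratfun"

definition fconst :: "ratfun \<Rightarrow> free_alg" where
  "fconst c = Poly_Mapping.single [] c"

definition fgen :: "nat \<Rightarrow> free_alg" where
  "fgen i = Poly_Mapping.single [i] 1"

inductive_set hecke_relators :: "free_alg set" where
  quad_t: "fgen 0 * fgen 0 - (fconst (Qvar - 1) * fgen 0 + fconst Qvar) \<in> hecke_relators"
| quad_g: "i \<ge> 1 \<Longrightarrow>
    fgen i * fgen i - (fconst (qvar - 1) * fgen i + fconst qvar) \<in> hecke_relators"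
| braid_t: "fgen 0 * fgen 1 * fgen 0 * fgen 1 - fgen 1 * fgen 0 * fgen 1 * fgen 0
    \<in> hecke_relators"
| braid_g: "i \<ge> 1 \<Longrightarrow>
    fgen i * fgen (i + 1) * fgen i - fgen (i + 1) * fgen i * fgen (i + 1) \<in> hecke_relators"
| comm: "i + 2 \<le> j \<Longrightarrow> fgen i * fgen j - fgen j * fgen i \<in> hecke_relators"

inductive_set hecke_ideal :: "free_alg set" where
  zero: "0 \<in> hecke_ideal"
| relator: "r \<in> hecke_relators \<Longrightarrow> a * r * b \<in> hecke_ideal"
| add: "x \<in> hecke_ideal \<Longrightarrow> y \<in> hecke_ideal \<Longrightarrow> x + y \<in> hecke_ideal"

lemma hecke_ideal_mult_left: "x \<in> hecke_ideal \<Longrightarrow> a * x \<in> hecke_ideal"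
proof (induction rule: hecke_ideal.induct)
  case (relator r b c)
  then show ?case using hecke_ideal.relator[of r "a * b" c] by (simp add: mult.assoc)
qed (auto simp: distrib_left intro: hecke_ideal.intros)

lemma hecke_ideal_mult_right: "x \<in> hecke_ideal \<Longrightarrow> x * a \<in> hecke_ideal"
proof (induction rule: hecke_ideal.induct)
  case (relator r b c)
  then show ?case using hecke_ideal.relator[of r b "c * a"] by (simp add: mult.assoc)
qed (auto simp: distrib_right intro: hecke_ideal.intros)

lemma hecke_ideal_uminus: "x \<in> hecke_ideal \<Longrightarrow> - x \<in> hecke_ideal"
  using hecke_ideal_mult_left[of x "- 1"] by simp

lemma hecke_ideal_diff: "x \<in> hecke_ideal \<Longrightarrow> y \<in> hecke_ideal \<Longrightarrow> x - y \<in> hecke_ideal"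
  using hecke_ideal.add[OF _ hecke_ideal_uminus, of x y] by simp

definition hecke_cong :: "free_alg \<Rightarrow> free_alg \<Rightarrow> bool" where
  "hecke_cong x y \<longleftrightarrow> x - y \<in> hecke_ideal"

lemma equivp_hecke_cong: "equivp hecke_cong"
proof (rule equivpI)
  show "reflp hecke_cong"
    by (auto simp: reflp_def hecke_cong_def intro: hecke_ideal.zero)
  show "symp hecke_cong"
    using hecke_ideal_uminus by (fastforce simp: symp_def hecke_cong_def)
  show "transp hecke_cong"
  proof (rule transpI)
    fix x y z :: free_alg
    assume "hecke_cong x y" "hecke_cong y z"
    then have "(x - y) + (y - z) \<in> hecke_ideal"
      unfolding hecke_cong_def by (rule hecke_ideal.add)
    then show "hecke_cong x z"
      by (simp add: hecke_cong_def)
  qed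
qed

text \<open>The algebra \<open>H\<^sub>\<infinity>(q,Q)\<close>.\<close>

quotient_type hecke = "nat list \<Rightarrow>\<^sub>0 ratfun" / hecke_cong
  by (rule equivp_hecke_cong)

text \<open>The character with \<open>t \<mapsto> -1\<close> and \<open>g\<^sub>i \<mapsto> -1\<close> shows that the quotient is not the zero ring.\<close>

lemma free_alg_induct [case_names single add]:
  assumes single: "\<And>w c. P (Poly_Mapping.single w c)"
    and add: "\<And>f g. P f \<Longrightarrow> P g \<Longrightarrow> P (f + g)"
  shows "P (f :: free_alg)"
proof (induction f rule: update_induct)
  case const
  show ?case using single[of undefined 0] by simp
next
  case (update f w c)
  have "Poly_Mapping.update w c f = f + Poly_Mapping.single w c"
    using update(1) by (intro poly_mapping_eqI)
      (auto simp: lookup_update lookup_add lookup_single in_keys_iff when_def)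
  then show ?case using add[OF update(3) single] by simp
qed

definition sign_char :: "free_alg \<Rightarrow> ratfun" where
  "sign_char f = (\<Sum>w\<in>Poly_Mapping.keys f. Poly_Mapping.lookup f w * (- 1) ^ length w)"

lemma sign_char_superset:
  assumes "finite A" "Poly_Mapping.keys f \<subseteq> A"
  shows "sign_char f = (\<Sum>w\<in>A. Poly_Mapping.lookup f w * (- 1) ^ length w)"
  unfolding sign_char_def using assms
  by (intro sum.mono_neutral_left) (auto simp: in_keys_iff)

lemma sign_char_add: "sign_char (f + g) = sign_char f + sign_char g"
proof -
  let ?A = "Poly_Mapping.keys f \<union> Poly_Mapping.keys g"
  have "Poly_Mapping.keys (f + g) \<subseteq> ?A"
    by (rule Poly_Mapping.keys_add)
  then show ?thesis
    by (simp add: sign_char_superset[of ?A] lookup_add distrib_right sum.distrib)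
qed

lemma sign_char_single: "sign_char (Poly_Mapping.single w c) = c * (- 1) ^ length w"
  by (simp add: sign_char_superset[of "{w}"])

lemma sign_char_mult: "sign_char (f * g) = sign_char f * sign_char g"
proof (induction f rule: free_alg_induct)
  case (single u a)
  show ?case
  proof (induction g rule: free_alg_induct)
    case (single v b)
    then show ?case
      by (simp add: mult_single sign_char_single plus_list_def power_add)
  qed (simp add: distrib_left sign_char_add)
qed (simp add: distrib_right sign_char_add)

lemma sign_char_diff: "sign_char (f - g) = sign_char f - sign_char g"
  using sign_char_add[of "f - g" g] by simp

lemma sign_char_ideal: "x \<in> hecke_ideal \<Longrightarrow> sign_char x = 0"
proof (induction rule: hecke_ideal.induct)
  case (relator r a b)
  then have "sign_char r = 0"
    by cases (simp_all add: sign_char_diff sign_char_add sign_char_mult sign_char_single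
        fgen_def fconst_def)
  then show ?case by (simp add: sign_char_mult)
next
  case zero
  show ?case by (simp add: sign_char_def)
qed (simp add: sign_char_add)

instantiation hecke :: ring_1
begin

lift_definition zero_hecke :: hecke is 0 .

lift_definition one_hecke :: hecke is 1 .

lift_definition plus_hecke :: "hecke \<Rightarrow> hecke \<Rightarrow> hecke" is "(+)"
proof -
  fix a b c d :: free_alg
  assume "hecke_cong a b" "hecke_cong c d"
  moreover have "(a + c) - (b + d) = (a - b) + (c - d)"
    by (simp add: algebra_simps)
  ultimately show "hecke_cong (a + c) (b + d)"
    unfolding hecke_cong_def by (simp only: hecke_ideal.add)
qed

lift_definition minus_hecke :: "hecke \<Rightarrow> hecke \<Rightarrow> hecke" is "(-)"
proof -
  fix a b c d :: free_alg
  assume "hecke_cong a b" "hecke_cong c d"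
  moreover have "(a - c) - (b - d) = (a - b) - (c - d)"
    by (simp add: algebra_simps)
  ultimately show "hecke_cong (a - c) (b - d)"
    unfolding hecke_cong_def by (simp only: hecke_ideal_diff)
qed

lift_definition uminus_hecke :: "hecke \<Rightarrow> hecke" is uminus
proof -
  fix a b :: free_alg
  assume "hecke_cong a b"
  moreover have "- a - - b = - (a - b)"
    by simp
  ultimately show "hecke_cong (- a) (- b)"
    unfolding hecke_cong_def by (simp only: hecke_ideal_uminus)
qed

lift_definition times_hecke :: "hecke \<Rightarrow> hecke \<Rightarrow> hecke" is "(*)"
proof -
  fix a b c d :: free_alg
  assume "hecke_cong a b" "hecke_cong c d"
  moreover have "a * c - b * d = (a - b) * c + b * (c - d)"
    by (simp add: algebra_simps)
  ultimately show "hecke_cong (a * c) (b * d)"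
    by (simp add: hecke_cong_def hecke_ideal.add hecke_ideal_mult_left hecke_ideal_mult_right)
qed

instance
proof
  have "sign_char 1 = 1"
    using sign_char_single[of "0 :: nat list" 1] by (simp only: single_one) (simp add: zero_list_def)
  then have "\<not> hecke_cong 0 1"
    using sign_char_ideal[of "0 - 1"] sign_char_diff[of 0 1] sign_char_ideal[OF hecke_ideal.zero]
    by (auto simp: hecke_cong_def)
  then show "(0 :: hecke) \<noteq> 1"
    by transfer
qed (transfer; simp add: algebra_simps hecke_cong_def hecke_ideal.zero)+

end


definition hecke_scale :: "ratfun \<Rightarrow> hecke \<Rightarrow> hecke" where
  "hecke_scale c x = abs_hecke (fconst c) * x"

lemma fconst_central: "fconst c * f = f * fconst c"
proof (induction f rule: free_alg_induct)
  case (single u a)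
  then show ?case by (simp add: fconst_def mult_single plus_list_def mult.commute)
qed (simp add: distrib_left distrib_right)

lemma abs_fconst_central: "abs_hecke (fconst c) * x = x * abs_hecke (fconst c)"
  by (induction x) (simp add: times_hecke.abs_eq fconst_central)

interpretation hecke: vector_space hecke_scale
proof
  show "hecke_scale 1 x = x" for x
  proof -
    have "fconst 1 = 1"
      by (simp add: fconst_def flip: zero_list_def)
    then show ?thesis by (simp add: hecke_scale_def flip: one_hecke.abs_eq)
  qed
  show "hecke_scale (a + b) x = hecke_scale a x + hecke_scale b x" for a b x
    by (simp add: hecke_scale_def fconst_def single_add distrib_right flip: plus_hecke.abs_eq)
  show "hecke_scale a (hecke_scale b x) = hecke_scale (a * b) x" for a b x
    by (simp add: hecke_scale_def fconst_def mult_single plus_list_def times_hecke.abs_eq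
        flip: mult.assoc)
qed (simp add: hecke_scale_def distrib_left)

definition hecke_gen :: "nat \<Rightarrow> hecke" where
  "hecke_gen i = abs_hecke (fgen i)"

text \<open>The free algebra on \<open>t, g\<^sub>1, \<dots>, g\<^bsub>n-1\<^esub>\<close>, and \<open>H\<^sub>n(q,Q)\<close> as the subalgebra of \<open>H\<^sub>\<infinity>(q,Q)\<close>
  that these elements generate. The natural map to \<open>H\<^sub>\<infinity>(q,Q)\<close> from the algebra with \<open>n\<close>
  generators and the relations among them is injective, so this is its image.\<close>

definition free_alg_upto :: "nat \<Rightarrow> free_alg set" where
  "free_alg_upto n = {f. Poly_Mapping.keys f \<subseteq> lists {..<n}}"

definition H :: "nat \<Rightarrow> hecke set" where
  "H n = abs_hecke ` free_alg_upto n"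

text \<open>The inverse of \<open>g\<^sub>i\<close>, from \<open>g\<^sub>i\<^sup>2 = (q-1)g\<^sub>i + q\<close>.\<close>

definition hecke_gen_inv :: "nat \<Rightarrow> hecke" where
  "hecke_gen_inv i =
    hecke_scale (inverse qvar) (hecke_gen i - hecke_scale (qvar - 1) 1)"

lemma qvar_nonzero: "qvar \<noteq> 0"
  by (simp add: qvar_def Zero_fract_def eq_fract)

lemma hecke_gen_quad:
  assumes "i \<ge> 1"
  shows "hecke_gen i * hecke_gen i = hecke_scale (qvar - 1) (hecke_gen i) + hecke_scale qvar 1"
proof -
  have "hecke_cong (fgen i * fgen i) (fconst (qvar - 1) * fgen i + fconst qvar * 1)"
    using hecke_ideal.relator[OF hecke_relators.quad_g[OF assms], of 1 1]
    by (simp add: hecke_cong_def)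
  then show ?thesis
    by (simp add: hecke_gen_def hecke_scale_def times_hecke.abs_eq plus_hecke.abs_eq
        one_hecke.abs_eq hecke.abs_eq_iff)
qed

lemma hecke_scale_mult_left: "hecke_scale c x * y = hecke_scale c (x * y)"
  by (simp add: hecke_scale_def mult.assoc)

lemma hecke_scale_mult_right: "x * hecke_scale c y = hecke_scale c (x * y)"
  by (metis hecke_scale_def mult.assoc abs_fconst_central)

lemma hecke_gen_inv:
  assumes "i \<ge> 1"
  shows "hecke_gen i * hecke_gen_inv i = 1" "hecke_gen_inv i * hecke_gen i = 1"
  using qvar_nonzero
  by (simp_all add: hecke_gen_inv_def hecke_scale_mult_left hecke_scale_mult_right
      right_diff_distrib left_diff_distrib hecke_gen_quad[OF assms])

fun tprime :: "nat \<Rightarrow> hecke" where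
  "tprime 0 = hecke_gen 0"
| "tprime (Suc i) = hecke_gen (Suc i) * tprime i * hecke_gen_inv (Suc i)"

definition markov_trace :: "ratfun \<Rightarrow> (hecke \<Rightarrow> ratfun) \<Rightarrow> bool" where
  "markov_trace z tr \<longleftrightarrow>
     Vector_Spaces.linear hecke_scale (*) tr \<and>
     (\<forall>x y. tr (x * y) = tr (y * x)) \<and>
     tr 1 = 1 \<and>
     (\<forall>n\<ge>1. \<forall>h\<in>H n. tr (h * hecke_gen n) = z * tr h)"


section \<open>Double partitions and standard double tableaux\<close>

definition is_partition :: "nat list \<Rightarrow> bool" where
  "is_partition \<alpha> \<longleftrightarrow> sorted_wrt (\<ge>) \<alpha> \<and> 0 \<notin> set \<alpha>"

text \<open>\<open>part \<alpha> i\<close> is \<open>\<alpha>\<^bsub>i+1\<^esub>\<close>: rows and columns are numbered from 0 throughout.\<close>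

definition part :: "nat list \<Rightarrow> nat \<Rightarrow> nat" where
  "part \<alpha> i = (if i < length \<alpha> then \<alpha> ! i else 0)"

type_synonym double_partition = "nat list \<times> nat list"

definition double_partitions :: "nat \<Rightarrow> double_partition set" where
  "double_partitions n =
     {(\<alpha>, \<beta>). is_partition \<alpha> \<and> is_partition \<beta> \<and> sum_list \<alpha> + sum_list \<beta> = n}"

lemma finite_double_partitions: "finite (double_partitions n)"
proof -
  have len: "length \<alpha> \<le> sum_list \<alpha>" if "0 \<notin> set \<alpha>" for \<alpha> :: "nat list"
    using that
  proof (induction \<alpha>)
    case (Cons a \<alpha>)
    then have "a \<ge> 1" "length \<alpha> \<le> sum_list \<alpha>" by auto
    then show ?case by simp
  qed simp
  have elem: "set \<alpha> \<subseteq> {..sum_list \<alpha>}" for \<alpha> :: "nat list"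
    by (auto intro: member_le_sum_list)
  let ?L = "{\<alpha>. set \<alpha> \<subseteq> {..n} \<and> length \<alpha> \<le> n}"
  have "double_partitions n \<subseteq> ?L \<times> ?L"
  proof (clarify, intro conjI)
    fix \<alpha> \<beta> assume "(\<alpha>, \<beta>) \<in> double_partitions n"
    then have *: "0 \<notin> set \<alpha>" "0 \<notin> set \<beta>" "sum_list \<alpha> \<le> n" "sum_list \<beta> \<le> n"
      by (auto simp: double_partitions_def is_partition_def)
    show "\<alpha> \<in> ?L" "\<beta> \<in> ?L"
      using len[OF *(1)] len[OF *(2)] elem[of \<alpha>] elem[of \<beta>] *(3,4) by auto
  qed
  moreover have "finite ?L"
    by (rule finite_lists_length_le) simp
  ultimately show ?thesis
    by (meson finite_SigmaI finite_subset)
qed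

datatype component = First | Second

text \<open>A box is given by the diagram it belongs to, its row and its column.\<close>

type_synonym box = "component \<times> nat \<times> nat"

definition boxes :: "double_partition \<Rightarrow> box set" where
  "boxes = (\<lambda>(\<alpha>, \<beta>).
     {(First, i, j) | i j. j < part \<alpha> i} \<union> {(Second, i, j) | i j. j < part \<beta> i})"

text \<open>A standard double tableau is the list of its boxes in the order of their entries, so that
  the box with entry \<open>k\<close> is \<open>\<tau> ! (k - 1)\<close>. Standardness says that no box comes after one that
  lies weakly below and weakly to the right of it in the same diagram.\<close>

definition standard_tableaux :: "double_partition \<Rightarrow> box list set" where
  "standard_tableaux \<mu> =
     {\<tau>. distinct \<tau> \<and> set \<tau> = boxes \<mu> \<and>
        (\<forall>c i j i' j' k l. k < length \<tau> \<and> l < length \<tau> \<and> \<tau> ! k = (c, i, j) \<and> \<tau> ! l = (c, i', j') \<and>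
           i \<le> i' \<and> j \<le> j' \<longrightarrow> k \<le> l)}"


section \<open>Hoefsmit's irreducible representations and their characters\<close>

text \<open>The simple module \<open>V\<^bsub>(\<alpha>,\<beta>)\<^esub>\<close> has the standard double tableaux of shape \<open>(\<alpha>,\<beta>)\<close> as a
  basis. If \<open>b, b'\<close> are the boxes of \<open>\<tau>\<close> with entries \<open>i, i+1\<close>, and \<open>c\<close> is the weighted content,
  then \<open>g\<^sub>i \<tau> = a \<tau> + (1 + a) s\<^sub>i\<tau>\<close> where \<open>a = (q - 1) / (1 - c(b) / c(b'))\<close>, with \<open>s\<^sub>i\<tau>\<close> read as 0 if
  it is not standard; and \<open>t \<tau> = Q \<tau>\<close> or \<open>t \<tau> = - \<tau>\<close> according to whether the entry 1 is in
  the first or the second diagram. In these conventions \<open>((n),\<emptyset>)\<close> is the character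
  \<open>t \<mapsto> Q, g\<^sub>i \<mapsto> q\<close>.\<close>

fun wcontent :: "box \<Rightarrow> ratfun" where
  "wcontent (First, i, j) = Qvar * qvar powi (int j - int i)"
| "wcontent (Second, i, j) = - (qvar powi (int j - int i))"

definition swap_entries :: "nat \<Rightarrow> box list \<Rightarrow> box list" where
  "swap_entries i \<tau> = \<tau>[i - 1 := \<tau> ! i, i := \<tau> ! (i - 1)]"

text \<open>All matrices below are indexed by standard tableaux; entry \<open>(\<sigma>, \<tau>)\<close> is the coefficient of
  \<open>\<sigma>\<close> in the image of \<open>\<tau>\<close>.\<close>

definition rep_gen :: "nat \<Rightarrow> box list \<Rightarrow> box list \<Rightarrow> ratfun" where
  "rep_gen i \<sigma> \<tau> =
     (if i = 0 then
        (if \<sigma> = \<tau> then (if fst (\<tau> ! 0) = First then Qvar else - 1) else 0)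
      else
        (let a = (qvar - 1) / (1 - wcontent (\<tau> ! (i - 1)) / wcontent (\<tau> ! i))
         in if \<sigma> = \<tau> then a else if \<sigma> = swap_entries i \<tau> then 1 + a else 0))"

fun rep_word :: "double_partition \<Rightarrow> nat list \<Rightarrow> box list \<Rightarrow> box list \<Rightarrow> ratfun" where
  "rep_word \<mu> [] \<sigma> \<tau> = (if \<sigma> = \<tau> then 1 else 0)"
| "rep_word \<mu> (i # w) \<sigma> \<tau> =
     (\<Sum>\<rho>\<in>standard_tableaux \<mu>. rep_gen i \<sigma> \<rho> * rep_word \<mu> w \<rho> \<tau>)"

definition rep_free :: "double_partition \<Rightarrow> free_alg \<Rightarrow> box list \<Rightarrow> box list \<Rightarrow> ratfun" where
  "rep_free \<mu> f \<sigma> \<tau> =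
     (\<Sum>w\<in>Poly_Mapping.keys f. Poly_Mapping.lookup f w * rep_word \<mu> w \<sigma> \<tau>)"

text \<open>For \<open>|\<alpha>| + |\<beta>| = n\<close> the generators act on \<open>V\<^bsub>(\<alpha>,\<beta>)\<^esub>\<close> only for indices below \<open>n\<close>, and an
  element \<open>x\<close> of \<open>H\<^sub>n\<close> acts through an expression of \<open>x\<close> in these generators. The matrix does not
  depend on the expression, because Hoefsmit's matrices satisfy the defining relations of \<open>H\<^sub>n\<close>
  and \<open>H\<^sub>n\<close> embeds into \<open>H\<^sub>\<infinity>\<close>; it is meaningless for \<open>x\<close> outside \<open>H\<^sub>n\<close>.\<close>

definition rep :: "double_partition \<Rightarrow> hecke \<Rightarrow> box list \<Rightarrow> box list \<Rightarrow> ratfun" where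
  "rep = (\<lambda>(\<alpha>, \<beta>) x.
     rep_free (\<alpha>, \<beta>) (SOME f. f \<in> free_alg_upto (sum_list \<alpha> + sum_list \<beta>) \<and> abs_hecke f = x))"

definition irr_char :: "double_partition \<Rightarrow> hecke \<Rightarrow> ratfun" where
  "irr_char \<mu> x = (\<Sum>\<tau>\<in>standard_tableaux \<mu>. rep \<mu> x \<tau> \<tau>)"

text \<open>A minimal idempotent \<open>p\<close> of the semisimple algebra \<open>H\<^sub>n\<close> lies in exactly one simple component;
  this is the one indexed by \<open>\<mu>\<close> if and only if \<open>p\<close> does not annihilate \<open>V\<^sub>\<mu>\<close>.\<close>

definition minimal_idempotent :: "nat \<Rightarrow> hecke \<Rightarrow> bool" where
  "minimal_idempotent n p \<longleftrightarrow>
     p \<in> H n \<and> p \<noteq> 0 \<and> p * p = p \<and> (\<forall>x\<in>H n. \<exists>c. p * x * p = hecke_scale c p)"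

definition minimal_idempotents_at :: "nat \<Rightarrow> double_partition \<Rightarrow> hecke set" where
  "minimal_idempotents_at n \<mu> =
     {p. minimal_idempotent n p \<and>
         (\<exists>\<sigma>\<in>standard_tableaux \<mu>. \<exists>\<tau>\<in>standard_tableaux \<mu>. rep \<mu> p \<sigma> \<tau> \<noteq> 0)}"


section \<open>The weights\<close>

text \<open>The value of the Schur polynomial \<open>s\<^sub>\<alpha>\<close> at \<open>x\<^sub>0, \<dots>, x\<^bsub>k-1\<^esub>\<close>, as a quotient of alternants. The
  division takes place in the field, so this is the right value only for pairwise distinct
  \<open>x\<^sub>i\<close>.\<close>

definition schur :: "nat \<Rightarrow> nat list \<Rightarrow> (nat \<Rightarrow> ratfun) \<Rightarrow> ratfun" where
  "schur k \<alpha> x =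
     (if length \<alpha> > k then 0
      else det (mat k k (\<lambda>(i, j). x i ^ (part \<alpha> j + (k - 1 - j)))) /
           det (mat k k (\<lambda>(i, j). x i ^ (k - 1 - j))))"

definition weight :: "nat \<Rightarrow> nat \<Rightarrow> double_partition \<Rightarrow> ratfun" where
  "weight r1 r2 = (\<lambda>(\<alpha>, \<beta>).
     qvar ^ (r1 * sum_list \<beta>) *
     (schur r1 \<alpha> (\<lambda>i. qvar ^ i) * schur r2 \<beta> (\<lambda>i. qvar ^ i) /
       ((1 - qvar ^ (r1 + r2)) / (1 - qvar)) ^ (sum_list \<alpha> + sum_list \<beta>)) *
     (\<Prod>i<r1. \<Prod>j<r2.
       (1 + Qvar * qvar powi (int (part \<alpha> i) - int (part \<beta> j) + int j - int i)) /
       (1 + Qvar * qvar powi (int j - int i))))"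

end

theory Submission
  imports Defs
begin

text \<open>For a double diagram \<open>\<mu>\<close> let \<open>Z\<^sub>k\<close> be the content of the first free box in row \<open>k\<close>, for the
  \<open>r = r\<^sub>1 + r\<^sub>2\<close> rows allowed by the weights. Then
  \<open>W\<^bsub>\<mu>+k\<^esub> / W\<^sub>\<mu> = (1 - q) / (1 - q\<^sup>r) * (\<Prod>l\<noteq>k. (q Z\<^sub>k - Z\<^sub>l) / (Z\<^sub>k - Z\<^sub>l))\<close>,
  which vanishes if row \<open>k\<close> has no addable box. Lagrange interpolation at the nodes \<open>Z\<^sub>k\<close> shows that
  these ratios add up to 1, so that the weighted sum of characters does not depend on \<open>n\<close>, and that the
  conditional expectations of \<open>g\<^sub>n\<close> and \<open>t'\<^sub>n\<close> onto \<open>H\<^sub>n\<close> are the scalars \<open>z\<close> and \<open>y\<close>. Hence the weighted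
  sum of characters is a Markov trace with the given parameters. It is the only one, because \<open>H\<^bsub>n+1\<^esub>\<close>
  is spanned by the elements \<open>a\<close>, \<open>a g\<^sub>n b\<close> and \<open>a t'\<^sub>n\<close> with \<open>a, b\<close> in \<open>H\<^sub>n\<close>. Its value at a minimal
  idempotent is computed with matrix units, which are built from Jucys-Murphy elements.\<close>

section \<open>Contents\<close>

text \<open>Only the values on the full products \<open>t'_0 ... t'_(k-1)\<close> are prescribed,
  not a rule for \<open>tr(h t'_n)\<close>. Uniqueness therefore has to treat mixed elements
  \<open>h t'_m ... t'_n\<close> with \<open>h\<close> in \<open>H m\<close>: expanding
  \<open>h\<close> over cosets trades the size of \<open>h\<close> against the length of the
  product, until \<open>h\<close> is a scalar. The expectations are scalar because of cancellations
  in the sum over the new last box. A removable box of content \<open>b\<close> in row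
  \<open>m\<close> satisfies \<open>Z_m = q b\<close>, so the factor \<open>q Z_k - Z_m\<close>
  cancels the pole of Hoefsmit's coefficient at \<open>Z_k = b\<close>. What remains is a polynomial
  in \<open>Z_k\<close>, and its degree decides the sum: \<open>q^r\<close> for \<open>g_n\<close>,
  hence \<open>z\<close>, and 0 for the entries of \<open>t'_n\<close> between paths with different
  last boxes. If the last boxes agree, one pole survives; its contribution, together with the
  remaining rows, is the same sum for the diagram without that box. This reduces \<open>t'_n\<close>
  to \<open>t'_(n-1)\<close> and finally to \<open>t\<close> at the empty diagram, where
  \<open>y\<close> is computed.\<close>

lemma qvar_power: "qvar ^ n = Fract [:[:0, 1:] ^ n:] 1"
  by (induction n) (simp_all add: One_fract_def one_pCons qvar_def)

lemma qvar_power_eq_1_iff: "qvar ^ n = 1 \<longleftrightarrow> n = 0"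
proof
  assume "qvar ^ n = 1"
  then have "[:0, 1:] ^ n = (1 :: complex poly)"
    by (simp add: qvar_power One_fract_def eq_fract one_pCons)
  then have "degree ([:0, 1:] ^ n :: complex poly) = 0"
    by simp
  then show "n = 0"
    by (simp add: degree_power_eq)
qed simp

lemma qvar_powi_eq_1_iff: "qvar powi m = 1 \<longleftrightarrow> m = 0"
proof -
  have "inverse qvar ^ k = inverse (qvar ^ k)" for k
    by (simp add: power_inverse)
  then show ?thesis
    by (auto simp: power_int_def qvar_power_eq_1_iff)
qed

lemma qvar_powi_eq_iff: "qvar powi m = qvar powi n \<longleftrightarrow> m = n"
proof -
  have "qvar powi m = qvar powi n \<longleftrightarrow> qvar powi (m - n) = 1"
    by (simp add: power_int_diff qvar_nonzero)
  then show ?thesis by (simp add: qvar_powi_eq_1_iff)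
qed

lemma qvar_power_eq_iff: "qvar ^ m = qvar ^ n \<longleftrightarrow> m = n"
  using qvar_powi_eq_iff[of "int m" "int n"] by simp

lemma Qvar_qvar_power_add_nonzero: "Qvar * qvar ^ m + qvar ^ n \<noteq> 0"
  by (simp add: qvar_power Qvar_def eq_fract Zero_fract_def)

lemma Qvar_nonzero: "Qvar \<noteq> 0"
  by (simp add: Qvar_def Zero_fract_def eq_fract)

lemma Qvar_qvar_powi_add_nonzero: "Qvar * qvar powi m + qvar powi n \<noteq> 0"
proof -
  \<comment> \<open>Multiplication by this power of \<open>q\<close> makes both exponents
    nonnegative.\<close>
  have "(Qvar * qvar powi m + qvar powi n) * qvar powi (- min m n) =
      Qvar * qvar powi (m - min m n) + qvar powi (n - min m n)"
    by (simp add: algebra_simps qvar_nonzero flip: power_int_add)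
  also have "\<dots> \<noteq> 0"
    using Qvar_qvar_power_add_nonzero[of "nat (m - min m n)" "nat (n - min m n)"]
    by (simp add: power_int_def)
  finally show ?thesis by auto
qed

lemma wcontent_nonzero: "wcontent b \<noteq> 0"
  by (cases b rule: wcontent.cases) (simp_all add: qvar_nonzero Qvar_nonzero)

text \<open>The cases \<open>m = 0\<close> and \<open>m = 1\<close> decide equality of contents and
  neighbouring diagonals. Contents from different components never match up to a power of
  \<open>q\<close>, since \<open>Q q^k + q^l\<close> is nonzero.\<close>

lemma wcontent_shift: "wcontent (c, i, j) * qvar powi m = wcontent (c', i', j') \<longleftrightarrow>
    c = c' \<and> int j - int i + m = int j' - int i'"
proof -
  have *: "Qvar * qvar powi k \<noteq> - (qvar powi l)" for k l
    using Qvar_qvar_powi_add_nonzero[of k l] by (metis add.left_inverse)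
  show ?thesis
    using *[of "int j' - int i'" "int j - int i + m"] *[of "int j - int i + m" "int j' - int i'"]
    by (cases c; cases c')
      (auto simp: qvar_powi_eq_iff Qvar_nonzero mult.assoc qvar_nonzero
        simp flip: power_int_add)
qed

lemma wcontent_eq_iff: "wcontent (c, i, j) = wcontent (c', i', j') \<longleftrightarrow>
    c = c' \<and> int j - int i = int j' - int i'"
  using wcontent_shift[of c i j 0] by simp

lemma wcontent_eq_mult_qvar_iff: "wcontent (c', i', j') = qvar * wcontent (c, i, j) \<longleftrightarrow>
    c = c' \<and> int j' - int i' = int j - int i + 1"
  using wcontent_shift[of c i j 1 c' i' j'] by (auto simp: mult.commute)

section \<open>Paths of Young diagrams\<close>

definition down_closed :: "box set \<Rightarrow> bool" where
  "down_closed S \<longleftrightarrow> (\<forall>c i j i' j'. (c, i', j') \<in> S \<and> i \<le> i' \<and> j \<le> j' \<longrightarrow> (c, i, j) \<in> S)"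

lemma down_closedD: "down_closed S \<Longrightarrow> (c, i', j') \<in> S \<Longrightarrow> i \<le> i' \<Longrightarrow> j \<le> j' \<Longrightarrow> (c, i, j) \<in> S"
  unfolding down_closed_def by blast

lemma down_closed_empty [simp]: "down_closed {}"
  by (simp add: down_closed_def)

lemma down_closed_Int: "down_closed S \<Longrightarrow> down_closed T \<Longrightarrow> down_closed (S \<inter> T)"
  unfolding down_closed_def by blast

text \<open>Paths are standard double tableaux of all shapes of size \<open>n\<close>, encoded by their boxes in the order
  of the entries.\<close>

definition paths :: "nat \<Rightarrow> box list set" where
  "paths n = {\<tau>. length \<tau> = n \<and> distinct \<tau> \<and> (\<forall>k. down_closed (set (take k \<tau>)))}"

definition addable :: "box set \<Rightarrow> box set" where
  "addable S = {b. b \<notin> S \<and> down_closed (insert b S)}"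

lemma paths_length: "\<tau> \<in> paths n \<Longrightarrow> length \<tau> = n"
  and paths_distinct: "\<tau> \<in> paths n \<Longrightarrow> distinct \<tau>"
  and paths_take_down_closed: "\<tau> \<in> paths n \<Longrightarrow> down_closed (set (take k \<tau>))"
  by (simp_all add: paths_def)

lemma paths_down_closed: "\<tau> \<in> paths n \<Longrightarrow> down_closed (set \<tau>)"
  using paths_take_down_closed[of \<tau> n n] by (simp add: paths_length)

lemma paths_card: "\<tau> \<in> paths n \<Longrightarrow> card (set \<tau>) = n"
  by (simp add: paths_def distinct_card)

lemma paths_0 [simp]: "paths 0 = {[]}"
  by (auto simp: paths_def)

lemma paths_snoc: "\<tau> @ [b] \<in> paths (Suc n) \<longleftrightarrow> \<tau> \<in> paths n \<and> b \<in> addable (set \<tau>)"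
proof
  assume *: "\<tau> @ [b] \<in> paths (Suc n)"
  have "down_closed (set (take k \<tau>))" for k
    using paths_take_down_closed[OF *, of "min k (length \<tau>)"] by (cases "k \<le> length \<tau>") simp_all
  moreover have "down_closed (insert b (set \<tau>))"
    using paths_down_closed[OF *] by simp
  ultimately show "\<tau> \<in> paths n \<and> b \<in> addable (set \<tau>)"
    using * by (auto simp: paths_def addable_def)
next
  assume *: "\<tau> \<in> paths n \<and> b \<in> addable (set \<tau>)"
  then have "down_closed (set (take k (\<tau> @ [b])))" for k
    by (cases "k \<le> n") (auto simp: paths_def addable_def)
  then show "\<tau> @ [b] \<in> paths (Suc n)"
    using * by (auto simp: paths_def addable_def)
qed

lemma paths_Suc: "paths (Suc n) = {\<tau> @ [b] | \<tau> b. \<tau> \<in> paths n \<and> b \<in> addable (set \<tau>)}"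
proof -
  have "\<sigma> \<in> paths (Suc n) \<longleftrightarrow> (\<exists>\<tau> b. \<sigma> = \<tau> @ [b] \<and> \<tau> \<in> paths n \<and> b \<in> addable (set \<tau>))" for \<sigma>
    by (cases \<sigma> rule: rev_cases) (auto simp: paths_snoc, simp add: paths_def)
  then show ?thesis by blast
qed

lemma paths_SucE:
  assumes "\<sigma> \<in> paths (Suc n)"
  obtains \<tau> b where "\<sigma> = \<tau> @ [b]" "\<tau> \<in> paths n" "b \<in> addable (set \<tau>)"
  using assms by (auto simp: paths_Suc)

lemma paths_take: "\<tau> \<in> paths n \<Longrightarrow> k \<le> n \<Longrightarrow> take k \<tau> \<in> paths k"
  by (auto simp: paths_def)

lemma nth_addable: "\<tau> \<in> paths n \<Longrightarrow> k < n \<Longrightarrow> \<tau> ! k \<in> addable (set (take k \<tau>))"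
  using paths_take[of \<tau> n "Suc k"] by (simp add: take_Suc_conv_app_nth paths_length paths_snoc)

text \<open>The first row of the first diagram can always be lengthened: finiteness provides a free
  column, and the box in the least free column is addable.\<close>

lemma ex_addable:
  assumes "finite S" "down_closed S"
  shows "\<exists>b. b \<in> addable S"
proof -
  let ?P = "\<lambda>j. (First, 0, j) \<notin> S"
  have "finite ((\<lambda>j. (First, 0, j)) -` S)"
    using assms(1) by (intro finite_vimageI) (auto simp: inj_on_def)
  then obtain j :: nat where "j \<notin> (\<lambda>j. (First, 0, j)) -` S"
    by (rule ex_new_if_finite[OF infinite_UNIV_nat, THEN exE])
  then have "?P j" by simp
  then have 1: "?P (LEAST j. ?P j)"
    by (rule LeastI)
  have 2: "(First, 0, k) \<in> S" if "k < (LEAST j. ?P j)" for k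
    using not_less_Least[OF that] by simp
  have "(c, i, k) \<in> insert (First, 0, LEAST j. ?P j) S"
    if "(c, i', k') \<in> insert (First, 0, LEAST j. ?P j) S" "i \<le> i'" "k \<le> k'" for c i k i' k'
    using that 2[of k] down_closedD[OF assms(2), of c i' k' i k] by (cases "k = k'") auto
  then have "(First, 0, LEAST j. ?P j) \<in> addable S"
    using 1 unfolding addable_def down_closed_def by blast
  then show ?thesis by blast
qed

lemma paths_extend:
  assumes "\<tau> \<in> paths n" "n \<le> m"
  shows "\<exists>e. \<tau> @ e \<in> paths m"
  using assms(2)
proof (induction m rule: dec_induct)
  case base
  then show ?case using assms(1) by (intro exI[of _ "[]"]) simp
next
  case (step m)
  then obtain e where e: "\<tau> @ e \<in> paths m" by blast
  then obtain b where "b \<in> addable (set (\<tau> @ e))"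
    using ex_addable paths_down_closed by blast
  then show ?case
    using e paths_snoc[of "\<tau> @ e" b m] by (intro exI[of _ "e @ [b]"]) simp
qed

text \<open>Equal content means the same diagonal of the same component. Of two distinct boxes
  there, one is weakly above and to the left of the other and would already belong to
  \<open>S\<close>. Hence the content of the last box determines how a path was extended.\<close>

lemma addable_wcontent_inj:
  assumes "b \<in> addable S" "b' \<in> addable S" "wcontent b = wcontent b'"
  shows "b = b'"
proof -
  obtain c i j c' i' j' where [simp]: "b = (c, i, j)" "b' = (c', i', j')"
    by (cases b; cases b')
  have *: "c' = c" "int j - int i = int j' - int i'"
    using assms(3) by (auto simp: wcontent_eq_iff)
  have b: "(c, i, j) \<notin> S" "down_closed (insert (c, i, j) S)"
    and b': "(c, i', j') \<notin> S" "down_closed (insert (c, i', j') S)"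
    using assms(1,2) * by (auto simp: addable_def)
  show ?thesis
    using * down_closedD[OF b(2), of c i j i' j'] down_closedD[OF b'(2), of c i' j' i j] b(1) b'(1)
    by (cases "i \<le> i'") auto
qed

text \<open>Before the next box on the diagonal of \<open>x\<close> can be added, both the box to
  the right of \<open>x\<close> and the box below \<open>x\<close> have to be present. Neither lies
  in \<open>S\<close>, so at least two other boxes come in between. This keeps the denominators of
  Hoefsmit's coefficients nonzero, also in the braid relation.\<close>

lemma wcontent_two_steps:
  assumes "down_closed S" "x \<in> addable S" "y \<in> addable (insert x S)" "z \<in> addable (insert y (insert x S))"
  shows "wcontent x \<noteq> wcontent y" "wcontent x \<noteq> wcontent z"
proof -
  obtain c i j where x: "x = (c, i, j)" by (cases x)
  obtain c' i' j' where y: "y = (c', i', j')" by (cases y)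
  obtain c'' i'' j'' where z: "z = (c'', i'', j'')" by (cases z)
  note xyz = x y z
  have xS: "x \<notin> S" "down_closed (insert x S)" 
    and yS: "y \<notin> S" "y \<noteq> x" "down_closed (insert y (insert x S))"
    and zS: "z \<notin> S" "z \<noteq> x" "z \<noteq> y" "down_closed (insert z (insert y (insert x S)))"
    using assms unfolding addable_def by blast+
  have step: "(c, i, Suc j) \<notin> S" "(c, Suc i, j) \<notin> S"
    using xS(1) down_closedD[OF assms(1), of c i "Suc j" i j] down_closedD[OF assms(1), of c "Suc i" j i j]
    by (auto simp: x)
  show "wcontent x \<noteq> wcontent y"
  proof (rule notI)
    assume "wcontent x = wcontent y"
    then have "c = c' \<and> int j - int i = int j' - int i'"
      unfolding xyz wcontent_eq_iff .
    note * = conjunct1[OF this, symmetric] conjunct2[OF this]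
    show False
    proof (cases "i < i'")
      case True
      then have "(c, i, Suc j) \<in> insert y (insert x S)"
        using * down_closedD[OF yS(3), of c i' j' i "Suc j"] by (simp add: xyz)
      then show False using step True * xyz by auto
    next
      case False
      then have "y \<in> insert x S"
        using * down_closedD[OF xS(2), of c i j i' j'] xyz by simp
      then show False using yS by blast
    qed
  qed
  show "wcontent x \<noteq> wcontent z"
  proof (rule notI)
    assume "wcontent x = wcontent z"
    then have "c = c'' \<and> int j - int i = int j'' - int i''"
      unfolding xyz wcontent_eq_iff .
    note * = conjunct1[OF this, symmetric] conjunct2[OF this]
    show False
    proof (cases "i < i''")
      case True
      then have "(c, i, Suc j) \<in> insert z (insert y (insert x S))"
         "(c, Suc i, j) \<in> insert z (insert y (insert x S))"
        using * down_closedD[OF zS(4), of c i'' j'' i "Suc j"] down_closedD[OF zS(4), of c i'' j'' "Suc i" j]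
        by (simp_all add: xyz)
      then show False using step True * xyz by auto
    next
      case False
      then have "z \<in> insert x S"
        using * down_closedD[OF xS(2), of c i j i'' j''] xyz by simp
      then show False using zS by blast
    qed
  qed
qed

lemma wcontent_nth_neq:
  assumes "\<tau> \<in> paths n" "Suc k < n"
  shows "wcontent (\<tau> ! k) \<noteq> wcontent (\<tau> ! Suc k)"
    and "Suc (Suc k) < n \<Longrightarrow> wcontent (\<tau> ! k) \<noteq> wcontent (\<tau> ! Suc (Suc k))"
proof -
  \<comment> \<open>With one more box the entry at \<open>Suc (Suc k)\<close> exists in every case,
    so both claims follow from the same three consecutive boxes.\<close>
  obtain e where e: "\<tau> @ e \<in> paths (Suc n)" using paths_extend[OF assms(1), of "Suc n"] by auto
  define \<sigma> where "\<sigma> = \<tau> @ e"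
  have \<sigma>: "\<sigma> \<in> paths (Suc n)" and eq: "\<And>k. k < n \<Longrightarrow> \<sigma> ! k = \<tau> ! k"
    using e assms(1) by (auto simp: \<sigma>_def nth_append paths_length)
  have "set (take (Suc k) \<sigma>) = insert (\<sigma> ! k) (set (take k \<sigma>))" if "k \<le> n" for k
    using that paths_length[OF \<sigma>] by (simp add: take_Suc_conv_app_nth)
  then have "wcontent (\<sigma> ! k) \<noteq> wcontent (\<sigma> ! Suc k) \<and> wcontent (\<sigma> ! k) \<noteq> wcontent (\<sigma> ! Suc (Suc k))"
    using wcontent_two_steps[OF paths_take_down_closed[OF \<sigma>, of k], of "\<sigma> ! k" "\<sigma> ! Suc k" "\<sigma> ! Suc (Suc k)"]
      nth_addable[OF \<sigma>, of k] nth_addable[OF \<sigma>, of "Suc k"] nth_addable[OF \<sigma>, of "Suc (Suc k)"] assms(2)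
    by simp
  then show "wcontent (\<tau> ! k) \<noteq> wcontent (\<tau> ! Suc k)"
    and "Suc (Suc k) < n \<Longrightarrow> wcontent (\<tau> ! k) \<noteq> wcontent (\<tau> ! Suc (Suc k))"
    using eq[of k] eq[of "Suc k"] eq[of "Suc (Suc k)"] assms(2) by auto
qed

section \<open>Exchanging consecutive boxes of a path\<close>

fun adjacent :: "box \<Rightarrow> box \<Rightarrow> bool" where
  "adjacent (c, i, j) (c', i', j') \<longleftrightarrow> c = c' \<and>
     (i = i' \<and> (j' = Suc j \<or> j = Suc j') \<or> j = j' \<and> (i' = Suc i \<or> i = Suc i'))"

lemma adjacent_commute: "adjacent b b' \<longleftrightarrow> adjacent b' b"
  by (cases "(b, b')" rule: adjacent.cases) auto

text \<open>The only obstruction to adding \<open>y\<close> before \<open>x\<close> is that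
  \<open>y\<close> needs \<open>x\<close>, that is, lies weakly below and to the right of it. If the
  two are not adjacent, a third box lies between them; it is in \<open>S\<close>, and then so is
  \<open>x\<close>, a contradiction.\<close>

lemma addable_swap:
  assumes "down_closed S" "x \<in> addable S" "y \<in> addable (insert x S)"
  shows "y \<in> addable S \<and> x \<in> addable (insert y S) \<longleftrightarrow> \<not> adjacent x y"
proof -
  obtain c i j c' i' j' where [simp]: "x = (c, i, j)" "y = (c', i', j')"
    by (cases x; cases y)
  have x: "x \<notin> S" "down_closed (insert x S)"
    and y: "y \<notin> S" "y \<noteq> x" "down_closed (insert y (insert x S))"
    using assms by (auto simp: addable_def)
  have not_le: "\<not> (c = c' \<and> i' \<le> i \<and> j' \<le> j)"
    using down_closedD[OF x(2), of c i j i' j'] y(1,2) by auto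
  have "down_closed (insert y S)" if na: "\<not> adjacent x y"
  proof -
    have nle: "\<not> (c = c' \<and> i \<le> i' \<and> j \<le> j')"
    proof
      assume le: "c = c' \<and> i \<le> i' \<and> j \<le> j'"
      \<comment> \<open>A box strictly between the two: the lower left vertex of their rectangle, or
        the neighbour of \<open>x\<close> if they share a row or a column.\<close>
      have "\<exists>u v. i \<le> u \<and> j \<le> v \<and> u \<le> i' \<and> v \<le> j' \<and> (u, v) \<noteq> (i, j) \<and> (u, v) \<noteq> (i', j')"
      proof (cases "i < i' \<and> j < j'")
        case True
        then show ?thesis by (intro exI[of _ i'] exI[of _ j]) simp
      next
        case False
        then have "i = i' \<and> Suc j < j' \<or> j = j' \<and> Suc i < i'"
          using le na y(2) by auto
        then show ?thesis
          by (elim disjE) (intro exI[of _ i] exI[of _ "Suc j"], simp, intro exI[of _ "Suc i"] exI[of _ j], simp)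
      qed
      then obtain u v where uv: "i \<le> u" "j \<le> v" "u \<le> i'" "v \<le> j'" "(u, v) \<noteq> (i, j)" "(u, v) \<noteq> (i', j')"
        by blast
      then have "(c, u, v) \<in> S"
        using down_closedD[OF y(3), of c i' j' u v] le by auto
      then show False
        using down_closedD[OF assms(1), of c u v i j] uv x(1) by auto
    qed
    have "(d, a, b) \<in> insert y S" if *: "(d, a', b') \<in> insert y S" "a \<le> a'" "b \<le> b'" for d a b a' b'
    proof -
      have "(d, a, b) \<noteq> x"
        using * nle x(1) down_closedD[OF assms(1), of d a' b' a b] by auto
      then show ?thesis
        using down_closedD[OF y(3), of d a' b' a b] * by blast
    qed
    then show ?thesis
      unfolding down_closed_def by blast
  qed
  moreover have "\<not> adjacent x y" if "down_closed (insert y S)"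
    using down_closedD[OF that, of c' i' j' i j] not_le x(1) y(2) by auto
  ultimately show ?thesis
    using x y unfolding addable_def by (auto simp only: insert_commute mem_Collect_eq insert_iff)
qed

lemma length_swap_entries [simp]: "length (swap_entries i \<tau>) = length \<tau>"
  by (simp add: swap_entries_def)

lemma set_swap_entries: "0 < i \<Longrightarrow> i < length \<tau> \<Longrightarrow> set (swap_entries i \<tau>) = set \<tau>"
  unfolding swap_entries_def by (intro set_swap) auto

lemma swap_entries_append:
  "Suc i < length \<tau> \<Longrightarrow> swap_entries (Suc i) (\<tau> @ e) = swap_entries (Suc i) \<tau> @ e"
  by (simp add: swap_entries_def list_update_append nth_append)

lemma swap_entries_snoc2: "Suc (Suc n) = length \<tau> + 2 \<Longrightarrow>
    swap_entries (Suc n) (\<tau> @ [x, y]) = \<tau> @ [y, x]"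
  by (simp add: swap_entries_def list_update_append nth_append)

lemma split_consecutive:
  assumes "Suc i < length \<tau>"
  obtains us vs where "\<tau> = us @ [\<tau> ! i, \<tau> ! Suc i] @ vs" "length us = i"
  using assms id_take_nth_drop[of "Suc i" \<tau>]
  by (intro that[of "take i \<tau>" "drop (Suc (Suc i)) \<tau>"]) (simp_all add: take_Suc_conv_app_nth)

text \<open>The conditions on later boxes see only the diagram reached so far, not the order in
  which it was filled.\<close>

lemma paths_append_cong:
  assumes "set u = set v" "u \<in> paths n" "v \<in> paths n"
  shows "u @ e \<in> paths m \<longleftrightarrow> v @ e \<in> paths m"
proof (induction e arbitrary: m rule: rev_induct)
  case Nil
  then show ?case using assms by (auto simp: paths_def)
next
  case (snoc b e)
  show ?case
  proof (cases m)
    case 0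
    then show ?thesis by simp
  next
    case (Suc k)
    have "(u @ e) @ [b] \<in> paths m \<longleftrightarrow> u @ e \<in> paths k \<and> b \<in> addable (set (u @ e))"
      unfolding Suc by (rule paths_snoc)
    also have "\<dots> \<longleftrightarrow> v @ e \<in> paths k \<and> b \<in> addable (set (v @ e))"
      using assms(1) snoc[of k] by simp
    also have "\<dots> \<longleftrightarrow> (v @ e) @ [b] \<in> paths m"
      unfolding Suc by (rule paths_snoc[symmetric])
    finally show ?thesis by simp
  qed
qed

lemma paths_appendD: "u @ e \<in> paths m \<Longrightarrow> u \<in> paths (length u)"
  using paths_take[of "u @ e" m "length u"] paths_length[of "u @ e" m] by simp

lemma paths_snoc2: "us @ [x, y] \<in> paths (Suc (Suc n)) \<longleftrightarrow>
    us \<in> paths n \<and> x \<in> addable (set us) \<and> y \<in> addable (insert x (set us))"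
  using paths_snoc[of "us @ [x]" y "Suc n"] paths_snoc[of us x n] by auto

lemma swap_entries_in_paths_iff:
  assumes "\<tau> \<in> paths n" "Suc i < n"
  shows "swap_entries (Suc i) \<tau> \<in> paths n \<longleftrightarrow> \<not> adjacent (\<tau> ! i) (\<tau> ! Suc i)"
proof -
  have "Suc i < length \<tau>" using assms by (simp add: paths_length)
  then obtain us x y vs where \<tau>: "\<tau> = us @ [x, y] @ vs" and us: "length us = i"
    and xy: "x = \<tau> ! i" "y = \<tau> ! Suc i"
    by (metis split_consecutive)
  have swap: "swap_entries (Suc i) \<tau> = (us @ [y, x]) @ vs"
    using swap_entries_append[of i "us @ [x, y]" vs] swap_entries_snoc2[of i us x y] us
    by (simp add: \<tau>)
  have p: "us @ [x, y] \<in> paths (Suc (Suc i))"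
    using paths_appendD[of "us @ [x, y]" vs n] assms(1) us by (simp add: \<tau>)
  then have "us @ [y, x] \<in> paths (Suc (Suc i)) \<longleftrightarrow> \<not> adjacent x y"
    using addable_swap[of "set us" x y] by (auto simp: paths_snoc2 dest: paths_down_closed)
  moreover have "(us @ [y, x]) @ vs \<in> paths n \<longleftrightarrow> us @ [y, x] \<in> paths (Suc (Suc i))"
  proof
    assume "(us @ [y, x]) @ vs \<in> paths n"
    from paths_appendD[OF this] show "us @ [y, x] \<in> paths (Suc (Suc i))"
      using us by simp
  next
    assume *: "us @ [y, x] \<in> paths (Suc (Suc i))"
    have "set (us @ [y, x]) = set (us @ [x, y])" by auto
    from paths_append_cong[OF this * p, of vs n] assms(1)
    show "(us @ [y, x]) @ vs \<in> paths n"
      unfolding \<tau> by simp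
  qed
  ultimately show ?thesis unfolding swap xy by blast
qed

section \<open>Hoefsmit's operators\<close>

definition hdiag :: "box \<Rightarrow> box \<Rightarrow> ratfun" where
  "hdiag b b' = (qvar - 1) / (1 - wcontent b / wcontent b')"

text \<open>The zero has to be imposed: for boxes one above the other, \<open>1 + hdiag\<close>
  takes the value \<open>1 + q\<close> in one of the two orders, although exchanging them does not
  give a path.\<close>

definition hoff :: "box \<Rightarrow> box \<Rightarrow> ratfun" where
  "hoff b b' = (if adjacent b b' then 0 else 1 + hdiag b b')"

definition t_eigenvalue :: "box \<Rightarrow> ratfun" where
  "t_eigenvalue b = (if fst b = First then Qvar else - 1)"

text \<open>The operators act on functions of arbitrary box sequences. At a path the coefficient of a
  sequence that is not a path vanishes, so the functions on paths form a quotient.\<close>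

fun act_gen :: "nat \<Rightarrow> (box list \<Rightarrow> ratfun) \<Rightarrow> box list \<Rightarrow> ratfun" where
  "act_gen 0 f \<sigma> = t_eigenvalue (\<sigma> ! 0) * f \<sigma>"
| "act_gen (Suc i) f \<sigma> = hdiag (\<sigma> ! i) (\<sigma> ! Suc i) * f \<sigma> +
     hoff (\<sigma> ! Suc i) (\<sigma> ! i) * f (swap_entries (Suc i) \<sigma>)"

fun act_word :: "nat list \<Rightarrow> (box list \<Rightarrow> ratfun) \<Rightarrow> box list \<Rightarrow> ratfun" where
  "act_word [] f = f"
| "act_word (i # w) f = act_gen i (act_word w f)"

definition act_free :: "free_alg \<Rightarrow> (box list \<Rightarrow> ratfun) \<Rightarrow> box list \<Rightarrow> ratfun" where
  "act_free a f \<sigma> = (\<Sum>w\<in>Poly_Mapping.keys a. Poly_Mapping.lookup a w * act_word w f \<sigma>)"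

lemma act_word_append: "act_word (u @ v) f = act_word u (act_word v f)"
  by (induction u) auto

lemma act_gen_linear:
  "act_gen i (\<lambda>\<rho>. f \<rho> + g \<rho>) \<sigma> = act_gen i f \<sigma> + act_gen i g \<sigma>"
  "act_gen i (\<lambda>\<rho>. c * f \<rho>) \<sigma> = c * act_gen i f \<sigma>"
  by (cases i; simp add: algebra_simps)+

lemma act_word_linear:
  "act_word w (\<lambda>\<rho>. f \<rho> + g \<rho>) \<sigma> = act_word w f \<sigma> + act_word w g \<sigma>"
  "act_word w (\<lambda>\<rho>. c * f \<rho>) \<sigma> = c * act_word w f \<sigma>"
proof (induction w arbitrary: \<sigma>)
  case (Cons i w)
  { case 1 then show ?case using Cons.IH(1)[abs_def] by (simp add: act_gen_linear fun_eq_iff[symmetric]) }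
  { case 2 then show ?case using Cons.IH(2)[abs_def] by (simp add: act_gen_linear) }
qed simp_all

lemma act_free_superset:
  assumes "finite A" "Poly_Mapping.keys a \<subseteq> A"
  shows "act_free a f \<sigma> = (\<Sum>w\<in>A. Poly_Mapping.lookup a w * act_word w f \<sigma>)"
  unfolding act_free_def using assms
  by (intro sum.mono_neutral_left) (auto simp: in_keys_iff)

lemma act_free_single: "act_free (Poly_Mapping.single w c) f \<sigma> = c * act_word w f \<sigma>"
  by (simp add: act_free_superset[of "{w}"])

lemma act_free_add: "act_free (a + b) f \<sigma> = act_free a f \<sigma> + act_free b f \<sigma>"
proof -
  let ?A = "Poly_Mapping.keys a \<union> Poly_Mapping.keys b"
  have "Poly_Mapping.keys (a + b) \<subseteq> ?A"
    by (rule Poly_Mapping.keys_add)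
  then show ?thesis
    by (simp add: act_free_superset[of ?A] lookup_add distrib_right sum.distrib)
qed

lemma act_free_diff: "act_free (a - b) f \<sigma> = act_free a f \<sigma> - act_free b f \<sigma>"
  using act_free_add[of "a - b" b f \<sigma>] by simp

lemma act_free_linear:
  "act_free a (\<lambda>\<rho>. f \<rho> + g \<rho>) \<sigma> = act_free a f \<sigma> + act_free a g \<sigma>"
  "act_free a (\<lambda>\<rho>. c * f \<rho>) \<sigma> = c * act_free a f \<sigma>"
  by (simp_all add: act_free_def act_word_linear sum.distrib sum_distrib_left algebra_simps)

lemma act_free_mult: "act_free (a * b) f \<sigma> = act_free a (act_free b f) \<sigma>"
proof (induction a arbitrary: \<sigma> rule: free_alg_induct)
  case (single u c)
  show ?case
  proof (induction b rule: free_alg_induct)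
    case (single v d)
    then show ?case
      by (simp add: mult_single plus_list_def act_free_single[abs_def] act_word_append act_word_linear
          act_free_linear)
  qed (simp add: distrib_left act_free_add[abs_def] act_free_linear)
qed (simp add: distrib_right act_free_add)

lemma act_free_fconst: "act_free (fconst c) f \<sigma> = c * f \<sigma>"
  by (simp add: fconst_def act_free_single)

lemma act_free_fgen: "act_free (fgen i) f \<sigma> = act_gen i f \<sigma>"
  by (simp add: fgen_def act_free_single)


subsection \<open>Locality\<close>

text \<open>On such a set the image of a function depends only on the values of the function on that
  set. It is used for all paths of a given length and for the paths that fill a fixed diagram, where
  it yields the block structure.\<close>

definition swap_closed :: "nat \<Rightarrow> box list set \<Rightarrow> bool" where
  "swap_closed n A \<longleftrightarrow> A \<subseteq> paths n \<and>
     (\<forall>\<sigma>\<in>A. \<forall>i. Suc i < n \<longrightarrow> swap_entries (Suc i) \<sigma> \<in> paths n \<longrightarrow> swap_entries (Suc i) \<sigma> \<in> A)"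

lemma swap_closed_paths: "swap_closed n (paths n)"
  by (simp add: swap_closed_def)

lemma swap_closed_tableaux: "swap_closed n {\<sigma>\<in>paths n. set \<sigma> = S}"
  by (auto simp: swap_closed_def set_swap_entries paths_length)

lemma hoff_zero_if_not_path:
  assumes "\<sigma> \<in> paths n" "Suc i < n" "swap_entries (Suc i) \<sigma> \<notin> paths n"
  shows "hoff (\<sigma> ! Suc i) (\<sigma> ! i) = 0"
  using swap_entries_in_paths_iff[OF assms(1,2)] assms(3) by (simp add: hoff_def adjacent_commute)

lemma act_gen_cong:
  assumes "swap_closed n A" "\<sigma> \<in> A" "i < n" "\<And>\<rho>. \<rho> \<in> A \<Longrightarrow> f \<rho> = g \<rho>"
  shows "act_gen i f \<sigma> = act_gen i g \<sigma>"
proof (cases i)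
  case (Suc k)
  have "swap_entries (Suc k) \<sigma> \<in> A \<or> hoff (\<sigma> ! Suc k) (\<sigma> ! k) = 0"
    using assms hoff_zero_if_not_path[of \<sigma> n k] by (auto simp: swap_closed_def Suc)
  then show ?thesis
    using assms(2,4) by (auto simp: Suc)
qed (use assms in simp)

lemma act_word_cong:
  assumes "swap_closed n A" "set w \<subseteq> {..<n}" "\<And>\<rho>. \<rho> \<in> A \<Longrightarrow> f \<rho> = g \<rho>" "\<sigma> \<in> A"
  shows "act_word w f \<sigma> = act_word w g \<sigma>"
  using assms(2,4)
proof (induction w arbitrary: \<sigma>)
  case (Cons i w)
  then show ?case by (auto intro: act_gen_cong[OF assms(1)])
qed (use assms in simp)

lemma act_free_cong:
  assumes "swap_closed n A" "a \<in> free_alg_upto n" "\<And>\<rho>. \<rho> \<in> A \<Longrightarrow> f \<rho> = g \<rho>" "\<sigma> \<in> A"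
  shows "act_free a f \<sigma> = act_free a g \<sigma>"
  unfolding act_free_def
proof (intro sum.cong refl)
  fix w assume "w \<in> Poly_Mapping.keys a"
  then have "set w \<subseteq> {..<n}"
    using assms(2) by (auto simp: free_alg_upto_def)
  then show "Poly_Mapping.lookup a w * act_word w f \<sigma> = Poly_Mapping.lookup a w * act_word w g \<sigma>"
    using act_word_cong[OF assms(1) _ assms(3,4)] by simp
qed

lemma act_gen_append:
  assumes "i < length \<sigma>"
  shows "act_gen i f (\<sigma> @ e) = act_gen i (\<lambda>\<rho>. f (\<rho> @ e)) \<sigma>"
  using assms by (cases i) (auto simp: nth_append swap_entries_append)

lemma act_gen_length_cong:
  assumes "\<And>\<rho>. length \<rho> = length \<sigma> \<Longrightarrow> f \<rho> = g \<rho>"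
  shows "act_gen i f \<sigma> = act_gen i g \<sigma>"
  using assms by (cases i) auto

lemma act_word_append_path:
  assumes "set w \<subseteq> {..<length \<sigma>}"
  shows "act_word w f (\<sigma> @ e) = act_word w (\<lambda>\<rho>. f (\<rho> @ e)) \<sigma>"
  using assms
proof (induction w arbitrary: \<sigma>)
  case (Cons i w)
  then have "act_word (i # w) f (\<sigma> @ e) = act_gen i (\<lambda>\<rho>. act_word w f (\<rho> @ e)) \<sigma>"
    by (simp add: act_gen_append)
  also have "\<dots> = act_gen i (act_word w (\<lambda>\<rho>. f (\<rho> @ e))) \<sigma>"
    using Cons by (intro act_gen_length_cong) simp
  finally show ?case by simp
qed simp

lemma act_free_append_path:
  assumes "a \<in> free_alg_upto (length \<sigma>)"
  shows "act_free a f (\<sigma> @ e) = act_free a (\<lambda>\<rho>. f (\<rho> @ e)) \<sigma>"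
  unfolding act_free_def using assms
  by (intro sum.cong refl) (auto simp: free_alg_upto_def act_word_append_path in_lists_conv_set subset_iff)


subsection \<open>The defining relations\<close>

lemma hdiag_eq:
  assumes "wcontent b \<noteq> wcontent b'"
  shows "hdiag b b' = (qvar - 1) * wcontent b' / (wcontent b' - wcontent b)"
  using assms wcontent_nonzero[of b'] by (simp add: hdiag_def field_simps)

lemma hdiag_add:
  assumes "wcontent b \<noteq> wcontent b'"
  shows "hdiag b b' + hdiag b' b = qvar - 1"
  using assms by (simp add: hdiag_eq divide_simps) (simp add: algebra_simps)

lemma adjacent_wcontent:
  assumes "adjacent b b'"
  shows "wcontent b = qvar * wcontent b' \<or> wcontent b' = qvar * wcontent b"
  using assms by (cases "(b, b')" rule: adjacent.cases) (auto simp: wcontent_eq_mult_qvar_iff)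

text \<open>For adjacent boxes one content is \<open>q\<close> times the other, so one of the two
  factors \<open>1 + hdiag\<close> vanishes anyway. The zeros imposed in \<open>hoff\<close>
  therefore do not change the product.\<close>

lemma hoff_mult:
  assumes "wcontent b \<noteq> wcontent b'"
  shows "hoff b b' * hoff b' b = (1 + hdiag b b') * (1 + hdiag b' b)"
proof (cases "adjacent b b'")
  case True
  have "1 + hdiag x y = 0" if *: "wcontent x \<noteq> wcontent y" "wcontent x = qvar * wcontent y" for x y
  proof -
    have "wcontent y - wcontent x = (1 - qvar) * wcontent y" "qvar \<noteq> 1"
      using * by (auto simp: algebra_simps)
    then show ?thesis
      using * wcontent_nonzero[of y] by (simp add: hdiag_eq divide_simps del: mult_cancel_right1)
  qed
  then have "(1 + hdiag b b') * (1 + hdiag b' b) = 0"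
    using adjacent_wcontent[OF True] assms by (metis mult_eq_0_iff)
  then show ?thesis using True by (simp add: hoff_def)
qed (simp add: hoff_def adjacent_commute)

lemma swap_entries_swap_entries:
  "Suc i < length \<sigma> \<Longrightarrow> swap_entries (Suc i) (swap_entries (Suc i) \<sigma>) = \<sigma>"
  by (auto simp: swap_entries_def nth_list_update intro!: nth_equalityI)

lemma nth_swap_entries:
  "Suc i < length \<sigma> \<Longrightarrow> swap_entries (Suc i) \<sigma> ! k =
    (if k = i then \<sigma> ! Suc i else if k = Suc i then \<sigma> ! i else \<sigma> ! k)"
  by (auto simp: swap_entries_def nth_list_update)

lemma swap_entries_braid:
  assumes "Suc (Suc i) < length \<sigma>"
  shows "swap_entries (Suc i) (swap_entries (Suc (Suc i)) (swap_entries (Suc i) \<sigma>)) =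
    swap_entries (Suc (Suc i)) (swap_entries (Suc i) (swap_entries (Suc (Suc i)) \<sigma>))"
  using assms by (intro nth_equalityI) (auto simp: nth_swap_entries)

lemma swap_entries_commute:
  assumes "Suc i < j" "Suc j < length \<sigma>"
  shows "swap_entries (Suc i) (swap_entries (Suc j) \<sigma>) = swap_entries (Suc j) (swap_entries (Suc i) \<sigma>)"
  using assms by (intro nth_equalityI) (auto simp: nth_swap_entries)

lemma act_gen_quad_t: "act_gen 0 (act_gen 0 f) \<sigma> = (Qvar - 1) * act_gen 0 f \<sigma> + Qvar * f \<sigma>"
  by (simp add: t_eigenvalue_def algebra_simps)

text \<open>On a sequence and its exchange, \<open>g\<close> is a 2 by 2 matrix with trace
  \<open>q - 1\<close> by \<open>hdiag_add\<close> and determinant \<open>-q\<close> by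
  \<open>hoff_mult\<close>; the claim is Cayley-Hamilton. Since \<open>f\<close> is defined on all
  sequences, no case distinction is needed when the exchange is not a path.\<close>

lemma act_gen_quad_g:
  assumes "\<sigma> \<in> paths n" "Suc i < n"
  shows "act_gen (Suc i) (act_gen (Suc i) f) \<sigma> = (qvar - 1) * act_gen (Suc i) f \<sigma> + qvar * f \<sigma>"
proof -
  let ?x = "\<sigma> ! i" and ?y = "\<sigma> ! Suc i"
  have len: "Suc i < length \<sigma>" using assms by (simp add: paths_length)
  have ne: "wcontent ?x \<noteq> wcontent ?y" using wcontent_nth_neq assms by blast
  have hd: "hdiag ?y ?x = qvar - 1 - hdiag ?x ?y"
    using hdiag_add[OF ne] by (simp add: algebra_simps)
  have ho: "hoff ?y ?x * hoff ?x ?y = (1 + hdiag ?x ?y) * (qvar - hdiag ?x ?y)"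
    using hoff_mult[OF ne] by (simp add: hd mult.commute)
  have "act_gen (Suc i) (act_gen (Suc i) f) \<sigma> =
      (hdiag ?x ?y ^ 2 + hoff ?y ?x * hoff ?x ?y) * f \<sigma> +
      hoff ?y ?x * (hdiag ?x ?y + hdiag ?y ?x) * f (swap_entries (Suc i) \<sigma>)"
    using len by (simp only: act_gen.simps nth_swap_entries swap_entries_swap_entries) (simp add: algebra_simps power2_eq_square)
  then show ?thesis
    unfolding ho hd by (simp add: algebra_simps power2_eq_square)
qed

lemma act_gen_commute:
  assumes "Suc (Suc i) \<le> j" "j < length \<sigma>"
  shows "act_gen i (act_gen j f) \<sigma> = act_gen j (act_gen i f) \<sigma>"
proof -
  obtain k where j: "j = Suc k" "k \<ge> 1" using assms by (cases j) auto
  show ?thesis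
  proof (cases i)
    case 0
    then show ?thesis
      using assms j by (simp add: nth_swap_entries algebra_simps)
  next
    case (Suc m)
    then have "Suc m < k" "Suc k < length \<sigma>" using assms j by auto
    then show ?thesis
      using swap_entries_commute[of m k \<sigma>] unfolding j(1) Suc
      by (simp add: nth_swap_entries algebra_simps)
  qed
qed

lemma paths_first_box:
  assumes "\<sigma> \<in> paths n" "0 < n"
  shows "\<exists>c. \<sigma> ! 0 = (c, 0, 0)"
proof -
  obtain c i j where b: "\<sigma> ! 0 = (c, i, j)" by (cases "\<sigma> ! 0")
  have "down_closed {(c, i, j)}"
    using nth_addable[OF assms] b by (simp add: addable_def)
  from down_closedD[OF this, of c i j 0 0] show ?thesis by (simp add: b)
qed

lemma paths_second_box:
  assumes "\<sigma> \<in> paths n" "1 < n" "fst (\<sigma> ! Suc 0) \<noteq> fst (\<sigma> ! 0)"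
  shows "\<sigma> ! Suc 0 = (fst (\<sigma> ! Suc 0), 0, 0)"
proof -
  obtain c' i j where b: "\<sigma> ! Suc 0 = (c', i, j)" by (cases "\<sigma> ! Suc 0")
  have "set (take 1 \<sigma>) = {\<sigma> ! 0}"
    using assms(2) paths_length[OF assms(1)] by (simp add: take_Suc_conv_app_nth)
  then have "down_closed {\<sigma> ! 0, (c', i, j)}"
    using nth_addable[OF assms(1,2)] b by (simp add: addable_def insert_commute)
  from down_closedD[OF this, of c' i j 0 0] have "(c', 0, 0) = \<sigma> ! 0 \<or> (c', 0, 0) = (c', i, j)"
    by auto
  moreover have "(c', 0, 0) \<noteq> \<sigma> ! 0"
    using assms(3) by (metis b fst_conv)
  ultimately show ?thesis by (simp add: b)
qed

lemma act_gen_braid_t: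
  assumes "\<sigma> \<in> paths n" "1 < n"
  shows "act_gen 0 (act_gen 1 (act_gen 0 (act_gen 1 f))) \<sigma> =
    act_gen 1 (act_gen 0 (act_gen 1 (act_gen 0 f))) \<sigma>"
proof -
  let ?x = "\<sigma> ! 0" and ?y = "\<sigma> ! Suc 0"
  have len: "Suc 0 < length \<sigma>" using assms by (simp add: paths_length)
  have ne: "wcontent ?x \<noteq> wcontent ?y" using wcontent_nth_neq[of \<sigma> n 0] assms by simp
  \<comment> \<open>This is the factor in the difference of both sides. Boxes of the same component
    have equal eigenvalues of \<open>t\<close>. Otherwise both are the first boxes of their
    diagrams, the eigenvalues are the contents, and the second factor vanishes.\<close>
  have key: "(t_eigenvalue ?x - t_eigenvalue ?y) *
      (t_eigenvalue ?x * hdiag ?x ?y + t_eigenvalue ?y * hdiag ?y ?x) = 0"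
  proof (cases "fst ?y = fst ?x")
    case False
    obtain c where x: "?x = (c, 0, 0)" using paths_first_box assms by fastforce
    have y: "?y = (fst ?y, 0, 0)" using paths_second_box[OF assms] False by simp
    have "t_eigenvalue ?x = wcontent ?x"
      using x by (cases c) (simp_all add: t_eigenvalue_def)
    moreover have "t_eigenvalue ?y = wcontent ?y"
      by (subst (1 2) y, cases "fst ?y") (simp_all add: t_eigenvalue_def)
    ultimately show ?thesis
      using ne by (simp add: hdiag_eq divide_simps) (simp add: algebra_simps)
  qed (simp add: t_eigenvalue_def)
  have "act_gen 0 (act_gen 1 (act_gen 0 (act_gen 1 f))) \<sigma> -
      act_gen 1 (act_gen 0 (act_gen 1 (act_gen 0 f))) \<sigma> =
      hoff ?y ?x * f (swap_entries 1 \<sigma>) * ((t_eigenvalue ?x - t_eigenvalue ?y) *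
      (t_eigenvalue ?x * hdiag ?x ?y + t_eigenvalue ?y * hdiag ?y ?x))"
    using len by (simp add: nth_swap_entries swap_entries_swap_entries algebra_simps)
  then show ?thesis by (simp add: key)
qed

text \<open>Comparing coefficients in the braid relation at a path, at its first exchange and at its
  second exchange leads to these identities for \<open>hdiag\<close> as a function of
  contents.\<close>

lemma braid_identities:
  fixes X Y Z q :: "'a :: field"
  assumes "X \<noteq> Y" "X \<noteq> Z" "Y \<noteq> Z"
  defines "a \<equiv> \<lambda>x y. (q - 1) * y / (y - x)"
  shows "a X Y * a Y Z * a X Y + (1 + a X Y) * (1 + a Y X) * a X Z =
      a Y Z * a X Y * a Y Z + (1 + a Y Z) * (1 + a Z Y) * a X Z"
    and "a X Y * a Y Z + a Y X * a X Z = a X Z * a Y Z"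
    and "a X Y * a X Z = a Y Z * a X Y + a X Z * a Z Y"
proof -
  have ne: "Y - X \<noteq> 0" "Z - X \<noteq> 0" "Z - Y \<noteq> 0" "X - Y \<noteq> 0" "X - Z \<noteq> 0" "Y - Z \<noteq> 0"
    using assms by auto
  \<comment> \<open>Opposite differences are brought to one orientation, so that equal denominators
    are recognised.\<close>
  have m: "X - Y = - (Y - X)" "X - Z = - (Z - X)" "Y - Z = - (Z - Y)" by auto
  show "a X Y * a Y Z + a Y X * a X Z = a X Z * a Y Z"
    unfolding a_def m(1) using ne by (simp add: divide_simps) (simp add: algebra_simps)
  show "a X Y * a X Z = a Y Z * a X Y + a X Z * a Z Y"
    unfolding a_def m(3) using ne by (simp add: divide_simps) (simp add: algebra_simps)
  show "a X Y * a Y Z * a X Y + (1 + a X Y) * (1 + a Y X) * a X Z =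
      a Y Z * a X Y * a Y Z + (1 + a Y Z) * (1 + a Z Y) * a X Z"
    unfolding a_def m(1) m(3) using ne by (simp add: divide_simps) (simp add: algebra_simps)
qed


text \<open>Both sides expand over the six orders of three consecutive boxes. The two cyclic orders
  and the reversal have equal coefficients at once; \<open>id1\<close>, \<open>id2\<close> and
  \<open>id3\<close> settle the other three.\<close>

lemma act_gen_braid_g:
  assumes "\<sigma> \<in> paths n" "Suc (Suc i) < n"
  shows "act_gen (Suc i) (act_gen (Suc (Suc i)) (act_gen (Suc i) f)) \<sigma> =
    act_gen (Suc (Suc i)) (act_gen (Suc i) (act_gen (Suc (Suc i)) f)) \<sigma>"
proof -
  define x y z where xyz: "x = \<sigma> ! i" "y = \<sigma> ! Suc i" "z = \<sigma> ! Suc (Suc i)"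
  let ?s = "swap_entries (Suc i)" and ?t = "swap_entries (Suc (Suc i))"
  have len: "Suc (Suc i) < length \<sigma>" using assms by (simp add: paths_length)
  have ne: "wcontent x \<noteq> wcontent y" "wcontent x \<noteq> wcontent z" "wcontent y \<noteq> wcontent z"
    using wcontent_nth_neq[of \<sigma> n i] wcontent_nth_neq[of \<sigma> n "Suc i"] assms by (simp_all add: xyz)
  note eqs = hdiag_eq[OF ne(1)] hdiag_eq[OF ne(2)] hdiag_eq[OF ne(3)]
    hdiag_eq[OF ne(1)[symmetric]] hdiag_eq[OF ne(2)[symmetric]] hdiag_eq[OF ne(3)[symmetric]]
  have id1: "hdiag x y * hdiag y z * hdiag x y + hoff y x * hoff x y * hdiag x z =
      hdiag y z * hdiag x y * hdiag y z + hoff z y * hoff y z * hdiag x z"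
    using braid_identities(1)[OF ne, of qvar] hoff_mult[OF ne(1)] hoff_mult[OF ne(3)]
    by (simp add: eqs mult.commute[of "hoff y x"] mult.commute[of "hoff z y"])
  have id2: "hdiag x y * hdiag y z + hdiag y x * hdiag x z = hdiag x z * hdiag y z"
    using braid_identities(2)[OF ne, of qvar] by (simp only: eqs)
  have id3: "hdiag x y * hdiag x z = hdiag y z * hdiag x y + hdiag x z * hdiag z y"
    using braid_identities(3)[OF ne, of qvar] by (simp only: eqs)
  have L: "act_gen (Suc i) (act_gen (Suc (Suc i)) (act_gen (Suc i) f)) \<sigma> =
      (hdiag x y * hdiag y z * hdiag x y + hoff y x * hoff x y * hdiag x z) * f \<sigma> +
      hoff y x * (hdiag x y * hdiag y z + hdiag y x * hdiag x z) * f (?s \<sigma>) +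
      hoff z y * (hdiag x y * hdiag x z) * f (?t \<sigma>) +
      hdiag x y * hoff z y * hoff z x * f (?s (?t \<sigma>)) +
      hoff y x * hoff z x * hdiag y z * f (?t (?s \<sigma>)) +
      hoff y x * hoff z x * hoff z y * f (?s (?t (?s \<sigma>)))"
    using len by (simp add: nth_swap_entries swap_entries_swap_entries xyz algebra_simps)
  have R: "act_gen (Suc (Suc i)) (act_gen (Suc i) (act_gen (Suc (Suc i)) f)) \<sigma> =
      (hdiag y z * hdiag x y * hdiag y z + hoff z y * hoff y z * hdiag x z) * f \<sigma> +
      hoff y x * (hdiag x z * hdiag y z) * f (?s \<sigma>) +
      hoff z y * (hdiag y z * hdiag x y + hdiag x z * hdiag z y) * f (?t \<sigma>) +
      hdiag x y * hoff z y * hoff z x * f (?s (?t \<sigma>)) +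
      hoff y x * hoff z x * hdiag y z * f (?t (?s \<sigma>)) +
      hoff y x * hoff z x * hoff z y * f (?t (?s (?t \<sigma>)))"
    using len by (simp add: nth_swap_entries swap_entries_swap_entries xyz algebra_simps)
  show ?thesis
    unfolding L R id1 id2 id3 swap_entries_braid[OF len] by (rule refl)
qed

text \<open>The bound \<open>N\<close> ensures that every generator in the relator acts on entries
  that exist; the relations rely on the geometry of the boxes at those entries.\<close>

lemma act_free_relator:
  assumes "r \<in> hecke_relators"
  shows "\<exists>N. \<forall>n\<ge>N. \<forall>f. \<forall>\<sigma>\<in>paths n. act_free r f \<sigma> = 0"
  using assms
proof cases
  case quad_t
  then show ?thesis
    by (simp add: act_free_diff act_free_add act_free_mult act_free_fgen[abs_def]
      act_free_fconst act_gen_quad_t del: act_gen.simps)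
next
  case (quad_g i)
  then obtain k where "i = Suc k" by (cases i) auto
  with quad_g show ?thesis
    by (intro exI[of _ "Suc i"]) (auto simp: act_free_diff act_free_add act_free_mult
      act_free_fgen[abs_def] act_free_fconst act_gen_quad_g simp del: act_gen.simps)
next
  case braid_t
  then show ?thesis
    by (intro exI[of _ 2]) (auto simp: act_free_diff act_free_mult act_free_fgen[abs_def]
      act_gen_braid_t[unfolded One_nat_def] simp del: act_gen.simps)
next
  case (braid_g i)
  then obtain k where "i = Suc k" by (cases i) auto
  with braid_g show ?thesis
    by (intro exI[of _ "i + 2"]) (auto simp: act_free_diff act_free_mult act_free_fgen[abs_def]
      act_gen_braid_g simp del: act_gen.simps)
next
  case (comm i j)
  then show ?thesis
    using act_gen_commute[of i j]
    by (intro exI[of _ "Suc j"] allI impI ballI)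
      (simp add: act_free_diff act_free_mult act_free_fgen[abs_def] paths_length del: act_gen.simps)
qed

section \<open>Descent of the action to the quotient algebra\<close>

lemma free_alg_upto_mono: "m \<le> n \<Longrightarrow> free_alg_upto m \<subseteq> free_alg_upto n"
  unfolding free_alg_upto_def using lists_mono[of "{..<m}" "{..<n}"] by auto

lemma ex_free_alg_upto: "\<exists>n. a \<in> free_alg_upto n"
proof -
  have "finite (\<Union>w\<in>Poly_Mapping.keys a. set w)"
    by simp
  then obtain n where "(\<Union>w\<in>Poly_Mapping.keys a. set w) \<subseteq> {..<n}"
    using finite_nat_iff_bounded by blast
  then have "a \<in> free_alg_upto n"
    by (auto simp: free_alg_upto_def)
  then show ?thesis ..
qed

lemma act_free_ideal:
  assumes "x \<in> hecke_ideal"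
  shows "\<exists>N. \<forall>n\<ge>N. \<forall>f. \<forall>\<sigma>\<in>paths n. act_free x f \<sigma> = 0"
  using assms
proof induction
  case zero
  then show ?case by (simp add: act_free_def)
next
  case (relator r a b)
  obtain N where N: "\<And>n f \<sigma>. n \<ge> N \<Longrightarrow> \<sigma> \<in> paths n \<Longrightarrow> act_free r f \<sigma> = 0"
    using act_free_relator[OF relator] by blast
  obtain M where M: "a \<in> free_alg_upto M"
    using ex_free_alg_upto by blast
  have "act_free (a * r * b) f \<sigma> = 0" if "n \<ge> max M N" "\<sigma> \<in> paths n" for n f \<sigma>
  proof -
    \<comment> \<open>The relator is known to vanish on paths only, so \<open>n\<close> must be
      large enough that \<open>a\<close> does not lead out of them.\<close>
    have "a \<in> free_alg_upto n"
      using M free_alg_upto_mono[of M n] that by auto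
    then have "act_free a (act_free r (act_free b f)) \<sigma> = act_free a (\<lambda>\<rho>. 0 * 0) \<sigma>"
      using N that by (intro act_free_cong[OF swap_closed_paths]) auto
    also have "\<dots> = 0"
      unfolding act_free_linear(2) by simp
    finally show ?thesis
      by (simp add: act_free_mult[abs_def] mult.assoc)
  qed
  then show ?case by blast
next
  case (add x y)
  then obtain N M where "\<forall>n\<ge>N. \<forall>f. \<forall>\<sigma>\<in>paths n. act_free x f \<sigma> = 0"
    "\<forall>n\<ge>M. \<forall>f. \<forall>\<sigma>\<in>paths n. act_free y f \<sigma> = 0" by blast
  then show ?case
    by (intro exI[of _ "max N M"]) (auto simp: act_free_add)
qed

text \<open>Extending a path to one that is longer than every relator involved shows that the action of
  \<open>H\<^sub>n\<close> on paths of length \<open>n\<close> is well defined although the ideal uses all generators.\<close>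

lemma act_free_ideal_upto:
  assumes "x \<in> hecke_ideal" "x \<in> free_alg_upto n" "\<sigma> \<in> paths n"
  shows "act_free x f \<sigma> = 0"
proof -
  obtain N where N: "\<And>m f \<sigma>. m \<ge> N \<Longrightarrow> \<sigma> \<in> paths m \<Longrightarrow> act_free x f \<sigma> = 0"
    using act_free_ideal[OF assms(1)] by blast
  obtain e where e: "\<sigma> @ e \<in> paths (max n N)"
    using paths_extend[OF assms(3), of "max n N"] by auto
  have "act_free x f \<sigma> = act_free x (\<lambda>\<rho>. f (take n (\<rho> @ e))) \<sigma>"
    using assms by (intro act_free_cong[OF swap_closed_paths]) (auto simp: paths_length)
  also have "\<dots> = act_free x (\<lambda>\<rho>. f (take n \<rho>)) (\<sigma> @ e)"
    using act_free_append_path[of x \<sigma>] assms by (simp add: paths_length)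
  also have "\<dots> = 0"
    by (rule N[OF _ e]) simp
  finally show ?thesis .
qed


section \<open>The algebras H n\<close>

lemma free_alg_upto_add: "a \<in> free_alg_upto n \<Longrightarrow> b \<in> free_alg_upto n \<Longrightarrow> a + b \<in> free_alg_upto n"
  unfolding free_alg_upto_def using Poly_Mapping.keys_add[of a b] by blast

lemma free_alg_upto_diff: "a \<in> free_alg_upto n \<Longrightarrow> b \<in> free_alg_upto n \<Longrightarrow> a - b \<in> free_alg_upto n"
  unfolding free_alg_upto_def using keys_diff[of a b] by blast

lemma free_alg_upto_mult: "a \<in> free_alg_upto n \<Longrightarrow> b \<in> free_alg_upto n \<Longrightarrow> a * b \<in> free_alg_upto n"
  unfolding free_alg_upto_def using keys_mult[of a b] by (fastforce simp: plus_list_def)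

lemma free_alg_upto_fconst: "fconst c \<in> free_alg_upto n"
  by (auto simp: free_alg_upto_def fconst_def)

lemma free_alg_upto_fgen: "i < n \<Longrightarrow> fgen i \<in> free_alg_upto n"
  by (auto simp: free_alg_upto_def fgen_def)

lemma fconst_1: "fconst 1 = 1"
  by (simp add: fconst_def flip: zero_list_def)

lemma H_add: "x \<in> H n \<Longrightarrow> y \<in> H n \<Longrightarrow> x + y \<in> H n"
  by (auto simp: H_def plus_hecke.abs_eq intro: free_alg_upto_add)

lemma H_diff: "x \<in> H n \<Longrightarrow> y \<in> H n \<Longrightarrow> x - y \<in> H n"
  by (auto simp: H_def minus_hecke.abs_eq intro: free_alg_upto_diff)

lemma H_mult: "x \<in> H n \<Longrightarrow> y \<in> H n \<Longrightarrow> x * y \<in> H n"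
  by (auto simp: H_def times_hecke.abs_eq intro: free_alg_upto_mult)

lemma H_1: "1 \<in> H n"
  using free_alg_upto_fconst[of 1 n] by (auto simp: H_def one_hecke.abs_eq fconst_1)

lemma H_scale: "x \<in> H n \<Longrightarrow> hecke_scale c x \<in> H n"
  unfolding hecke_scale_def by (intro H_mult) (auto simp: H_def free_alg_upto_fconst)

lemma H_gen: "i < n \<Longrightarrow> hecke_gen i \<in> H n"
  by (auto simp: H_def hecke_gen_def intro: free_alg_upto_fgen)

lemma H_gen_inv: "i < n \<Longrightarrow> hecke_gen_inv i \<in> H n"
  by (simp add: hecke_gen_inv_def H_scale H_diff H_gen H_1)

lemma H_mono: "m \<le> n \<Longrightarrow> H m \<subseteq> H n"
  unfolding H_def using free_alg_upto_mono by blast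

lemma ex_H: "\<exists>n. x \<in> H n"
  by (metis H_def Quotient3_abs_rep Quotient3_hecke ex_free_alg_upto image_eqI)

lemma H_induct_words:
  assumes "x \<in> H n"
    and add: "\<And>x y. P x \<Longrightarrow> P y \<Longrightarrow> P (x + y)"
    and scale: "\<And>c x. P x \<Longrightarrow> P (hecke_scale c x)"
    and word: "\<And>w. set w \<subseteq> {..<n} \<Longrightarrow> P (prod_list (map hecke_gen w))"
  shows "P x"
proof -
  obtain a where a: "a \<in> free_alg_upto n" "x = abs_hecke a"
    using assms(1) by (auto simp: H_def)
  have prod: "abs_hecke (Poly_Mapping.single w 1) = prod_list (map hecke_gen w)" for w
  proof (induction w)
    case Nil
    then show ?case using fconst_1 by (simp add: one_hecke.abs_eq fconst_def)
  next
    case (Cons i w)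
    have "abs_hecke (Poly_Mapping.single (i # w) 1) = hecke_gen i * abs_hecke (Poly_Mapping.single w 1)"
      by (simp add: hecke_gen_def fgen_def times_hecke.abs_eq mult_single plus_list_def)
    then show ?case using Cons by simp
  qed
  have sum: "P (\<Sum>w\<in>A. abs_hecke (Poly_Mapping.single w (Poly_Mapping.lookup a w)))"
    if "finite A" "A \<subseteq> Poly_Mapping.keys a" for A
    using that
  proof (induction A)
    case empty
    then show ?case using scale[OF word[of "[]"], of 0] by simp
  next
    case (insert w A)
    have "abs_hecke (Poly_Mapping.single w c) = hecke_scale c (prod_list (map hecke_gen w))" for c
      unfolding prod[symmetric]
      by (simp add: hecke_scale_def fconst_def times_hecke.abs_eq mult_single plus_list_def)
    from this[of "Poly_Mapping.lookup a w"]
    have "P (abs_hecke (Poly_Mapping.single w (Poly_Mapping.lookup a w)))"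
      using insert.prems a(1) scale[OF word[of w], of "Poly_Mapping.lookup a w"]
      by (auto simp: free_alg_upto_def)
    then show ?case using insert add by simp
  qed
  have abs_sum: "abs_hecke (\<Sum>w\<in>A. g w) = (\<Sum>w\<in>A. abs_hecke (g w))" for g :: "nat list \<Rightarrow> free_alg" and A
    by (induction A rule: infinite_finite_induct) (simp_all flip: zero_hecke.abs_eq plus_hecke.abs_eq)
  have "a = (\<Sum>w\<in>Poly_Mapping.keys a. Poly_Mapping.single w (Poly_Mapping.lookup a w))"
    by (intro poly_mapping_eqI)
      (simp add: lookup_sum lookup_single when_def in_keys_iff)
  then have "x = abs_hecke (\<Sum>w\<in>Poly_Mapping.keys a. Poly_Mapping.single w (Poly_Mapping.lookup a w))"
    using a(2) by simp
  also have "\<dots> = (\<Sum>w\<in>Poly_Mapping.keys a. abs_hecke (Poly_Mapping.single w (Poly_Mapping.lookup a w)))"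
    by (rule abs_sum)
  finally have "x = (\<Sum>w\<in>Poly_Mapping.keys a. abs_hecke (Poly_Mapping.single w (Poly_Mapping.lookup a w)))" .
  then show ?thesis
    using sum[of "Poly_Mapping.keys a"] by simp
qed

lemma H_induct_left:
  assumes "x \<in> H n"
    and one: "P 1" and add: "\<And>x y. P x \<Longrightarrow> P y \<Longrightarrow> P (x + y)"
    and scale: "\<And>c x. P x \<Longrightarrow> P (hecke_scale c x)"
    and gen: "\<And>i x. i < n \<Longrightarrow> P x \<Longrightarrow> P (hecke_gen i * x)"
  shows "P x"
  using assms(1) add scale
proof (rule H_induct_words)
  show "P (prod_list (map hecke_gen w))" if "set w \<subseteq> {..<n}" for w
    using that by (induction w) (auto intro: one gen)
qed

lemma H_induct_right:
  assumes "x \<in> H n"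
    and one: "P 1" and add: "\<And>x y. P x \<Longrightarrow> P y \<Longrightarrow> P (x + y)"
    and scale: "\<And>c x. P x \<Longrightarrow> P (hecke_scale c x)"
    and gen: "\<And>i x. i < n \<Longrightarrow> P x \<Longrightarrow> P (x * hecke_gen i)"
  shows "P x"
  using assms(1) add scale
proof (rule H_induct_words)
  show "P (prod_list (map hecke_gen w))" if "set w \<subseteq> {..<n}" for w
    using that by (induction w rule: rev_induct) (auto intro: one gen)
qed

section \<open>The action of \<open>H n\<close> on functions on paths\<close>

definition hrep :: "nat \<Rightarrow> hecke \<Rightarrow> (box list \<Rightarrow> ratfun) \<Rightarrow> box list \<Rightarrow> ratfun" where
  "hrep n x = act_free (SOME a. a \<in> free_alg_upto n \<and> abs_hecke a = x)"

text \<open>Two representatives in \<open>free_alg_upto n\<close> differ by an element of the ideal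
  that again involves only generators below \<open>n\<close>, so \<open>act_free_ideal_upto\<close>
  applies. The choice in \<open>hrep\<close> is the one made in \<open>rep\<close>, which makes the
  later comparison immediate.\<close>

lemma hrep_abs:
  assumes "a \<in> free_alg_upto n" "\<sigma> \<in> paths n"
  shows "hrep n (abs_hecke a) f \<sigma> = act_free a f \<sigma>"
proof -
  define b where "b = (SOME b. b \<in> free_alg_upto n \<and> abs_hecke b = abs_hecke a)"
  have b: "b \<in> free_alg_upto n" "abs_hecke b = abs_hecke a"
    using someI[of "\<lambda>b. b \<in> free_alg_upto n \<and> abs_hecke b = abs_hecke a" a] assms(1)
    by (auto simp: b_def)
  then have "b - a \<in> hecke_ideal"
    by (simp add: hecke.abs_eq_iff hecke_cong_def)
  then have "act_free (b - a) f \<sigma> = 0"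
    using act_free_ideal_upto free_alg_upto_diff b(1) assms by blast
  then show ?thesis
    by (simp add: act_free_diff hrep_def flip: b_def)
qed

lemma hrep_cong:
  assumes "swap_closed n A" "x \<in> H n" "\<And>\<rho>. \<rho> \<in> A \<Longrightarrow> f \<rho> = g \<rho>" "\<sigma> \<in> A"
  shows "hrep n x f \<sigma> = hrep n x g \<sigma>"
proof -
  obtain a where a: "a \<in> free_alg_upto n" "x = abs_hecke a"
    using assms(2) by (auto simp: H_def)
  have "\<sigma> \<in> paths n" using assms(1,4) by (auto simp: swap_closed_def)
  then show ?thesis
    using act_free_cong[OF assms(1) a(1), of f g \<sigma>] assms(3,4) by (simp add: a hrep_abs)
qed

lemmas hrep_cong_paths = hrep_cong[OF swap_closed_paths]

lemma hrep_mult: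
  assumes "x \<in> H n" "y \<in> H n" "\<sigma> \<in> paths n"
  shows "hrep n (x * y) f \<sigma> = hrep n x (hrep n y f) \<sigma>"
proof -
  obtain a b where a: "a \<in> free_alg_upto n" "x = abs_hecke a" and b: "b \<in> free_alg_upto n" "y = abs_hecke b"
    using assms by (auto simp: H_def)
  have "hrep n (x * y) f \<sigma> = hrep n x (act_free b f) \<sigma>"
    using assms a b by (simp add: times_hecke.abs_eq hrep_abs free_alg_upto_mult act_free_mult)
  also have "\<dots> = hrep n x (hrep n y f) \<sigma>"
    using assms b by (intro hrep_cong_paths) (auto simp: hrep_abs)
  finally show ?thesis .
qed

lemma hrep_add:
  assumes "x \<in> H n" "y \<in> H n" "\<sigma> \<in> paths n"
  shows "hrep n (x + y) f \<sigma> = hrep n x f \<sigma> + hrep n y f \<sigma>"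
  using assms by (auto simp: H_def plus_hecke.abs_eq hrep_abs free_alg_upto_add act_free_add)

lemma hrep_scale:
  assumes "x \<in> H n" "\<sigma> \<in> paths n"
  shows "hrep n (hecke_scale c x) f \<sigma> = c * hrep n x f \<sigma>"
  using assms by (auto simp: H_def hecke_scale_def times_hecke.abs_eq hrep_abs free_alg_upto_mult
      free_alg_upto_fconst act_free_mult act_free_fconst)

lemma hrep_diff:
  assumes "x \<in> H n" "y \<in> H n" "\<sigma> \<in> paths n"
  shows "hrep n (x - y) f \<sigma> = hrep n x f \<sigma> - hrep n y f \<sigma>"
  using hrep_add[of "x - y" n y \<sigma>] assms by (simp add: H_diff)

lemma hrep_1: "\<sigma> \<in> paths n \<Longrightarrow> hrep n 1 f \<sigma> = f \<sigma>"
  using hrep_abs[of "fconst 1" n \<sigma> f]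
  by (simp add: free_alg_upto_fconst act_free_fconst) (simp add: fconst_1 one_hecke.abs_eq)

lemma hrep_gen: "i < n \<Longrightarrow> \<sigma> \<in> paths n \<Longrightarrow> hrep n (hecke_gen i) f \<sigma> = act_gen i f \<sigma>"
  by (simp add: hecke_gen_def hrep_abs free_alg_upto_fgen act_free_fgen)

lemma hrep_linear:
  "hrep n x (\<lambda>\<rho>. f \<rho> + g \<rho>) \<sigma> = hrep n x f \<sigma> + hrep n x g \<sigma>"
  "hrep n x (\<lambda>\<rho>. c * f \<rho>) \<sigma> = c * hrep n x f \<sigma>"
  by (simp_all add: hrep_def act_free_linear)

lemma hrep_zero: "hrep n x (\<lambda>\<rho>. 0) \<sigma> = 0"
  using hrep_linear(2)[of n x 0 "\<lambda>\<rho>. 0" \<sigma>] by simp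

lemma hrep_sum: "hrep n x (\<lambda>\<rho>. \<Sum>k\<in>K. f k \<rho>) \<sigma> = (\<Sum>k\<in>K. hrep n x (f k) \<sigma>)"
  by (induction K rule: infinite_finite_induct) (simp_all add: hrep_zero hrep_linear)

text \<open>The branching rule: elements of \<open>H n\<close> rearrange only the first
  \<open>n\<close> boxes, and the tail \<open>e\<close> is a spectator.\<close>

lemma hrep_append:
  assumes "x \<in> H n" "\<sigma> @ e \<in> paths m" "\<sigma> \<in> paths n"
  shows "hrep m x f (\<sigma> @ e) = hrep n x (\<lambda>\<rho>. f (\<rho> @ e)) \<sigma>"
proof -
  obtain a where a: "a \<in> free_alg_upto n" "x = abs_hecke a"
    using assms(1) by (auto simp: H_def)
  have "n \<le> m"
    using paths_length[OF assms(2)] paths_length[OF assms(3)] by simp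
  then have "a \<in> free_alg_upto m"
    using a(1) free_alg_upto_mono by blast
  then show ?thesis
    using assms a act_free_append_path[of a \<sigma> f e] by (simp add: hrep_abs paths_length)
qed

section \<open>Uniqueness of Markov traces\<close>

lemma hecke_relator_zero: "r \<in> hecke_relators \<Longrightarrow> abs_hecke r = 0"
  using hecke_ideal.relator[of r 1 1] by (simp add: zero_hecke.abs_eq hecke.abs_eq_iff hecke_cong_def)

lemma hecke_gen_commute: "i + 2 \<le> j \<Longrightarrow> hecke_gen i * hecke_gen j = hecke_gen j * hecke_gen i"
  using hecke_relator_zero[OF hecke_relators.comm[of i j]]
  by (simp add: hecke_gen_def times_hecke.abs_eq flip: minus_hecke.abs_eq)

lemma hecke_gen_braid: "i \<ge> 1 \<Longrightarrow>
    hecke_gen i * (hecke_gen (Suc i) * hecke_gen i) = hecke_gen (Suc i) * (hecke_gen i * hecke_gen (Suc i))"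
  using hecke_relator_zero[OF hecke_relators.braid_g[of i]]
  by (simp add: hecke_gen_def times_hecke.abs_eq mult.assoc flip: minus_hecke.abs_eq)

lemma hecke_gen_braid_t: "hecke_gen 0 * (hecke_gen 1 * (hecke_gen 0 * hecke_gen 1)) =
    hecke_gen 1 * (hecke_gen 0 * (hecke_gen 1 * hecke_gen 0))"
  using hecke_relator_zero[OF hecke_relators.braid_t]
  by (simp add: hecke_gen_def times_hecke.abs_eq mult.assoc flip: minus_hecke.abs_eq)

lemma hecke_gen_quad_t:
  "hecke_gen 0 * hecke_gen 0 = hecke_scale (Qvar - 1) (hecke_gen 0) + hecke_scale Qvar 1"
proof -
  have "abs_hecke (fgen 0 * fgen 0 - (fconst (Qvar - 1) * fgen 0 + fconst Qvar * 1)) = 0"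
    using hecke_relator_zero[OF hecke_relators.quad_t] by simp
  then show ?thesis
    by (simp add: hecke_gen_def hecke_scale_def times_hecke.abs_eq plus_hecke.abs_eq one_hecke.abs_eq
        flip: minus_hecke.abs_eq)
qed

lemma hecke_gen_inv_left: "1 \<le> i \<Longrightarrow> hecke_gen_inv i * (hecke_gen i * x) = x"
  and hecke_gen_inv_right: "1 \<le> i \<Longrightarrow> hecke_gen i * (hecke_gen_inv i * x) = x"
  by (simp_all add: hecke_gen_inv flip: mult.assoc)

lemma hecke_gen_inv_eq:
  "hecke_scale qvar (hecke_gen_inv i) = hecke_gen i - hecke_scale (qvar - 1) 1"
  by (simp add: hecke_gen_inv_def qvar_nonzero)

lemma hecke_gen_eq_inv:
  "hecke_gen i = hecke_scale qvar (hecke_gen_inv i) + hecke_scale (qvar - 1) 1"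
  by (simp add: hecke_gen_inv_eq)

lemma commute_gen_inv:
  assumes "hecke_gen i * x = x * hecke_gen i"
  shows "hecke_gen_inv i * x = x * hecke_gen_inv i"
  using assms by (simp add: hecke_gen_inv_def hecke_scale_mult_left hecke_scale_mult_right
      left_diff_distrib right_diff_distrib)

lemma hecke_gen_commute_H:
  assumes "x \<in> H m" "m < n"
  shows "hecke_gen n * x = x * hecke_gen n"
  using assms(1)
proof (rule H_induct_left)
  fix i x assume *: "i < m" "hecke_gen n * x = x * hecke_gen n"
  then have "hecke_gen n * hecke_gen i = hecke_gen i * hecke_gen n"
    using assms(2) hecke_gen_commute[of i n] by simp
  then have "hecke_gen n * (hecke_gen i * x) = hecke_gen i * (hecke_gen n * x)"
    by (simp flip: mult.assoc)
  then show "hecke_gen n * (hecke_gen i * x) = hecke_gen i * x * hecke_gen n"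
    using * by (simp add: mult.assoc)
qed (simp_all add: distrib_left distrib_right hecke_scale_mult_left hecke_scale_mult_right)

lemma hecke_gen_inv_commute_H:
  assumes "x \<in> H m" "m < n"
  shows "hecke_gen_inv n * x = x * hecke_gen_inv n"
  by (rule commute_gen_inv[OF hecke_gen_commute_H[OF assms]])

lemma tprime_in_H: "tprime n \<in> H (Suc n)"
proof (induction n)
  case (Suc n)
  then have "tprime n \<in> H (Suc (Suc n))"
    using H_mono[of "Suc n" "Suc (Suc n)"] by auto
  then show ?case by (simp add: H_mult H_gen H_gen_inv)
qed (simp add: H_gen)

lemma tprime_shift: "hecke_gen (Suc n) * tprime n = tprime (Suc n) * hecke_gen (Suc n)"
  by (simp add: mult.assoc hecke_gen_inv)

text \<open>The three forms serve, in this order, the commutation of generators with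
  \<open>tprime\<close>, the conjugations in \<open>ex_shift\<close>, and the conjugation by
  \<open>g_n\<close> in the coset decomposition.\<close>

lemma hecke_gen_braid_inv:
  assumes "i \<ge> 1"
  shows "hecke_gen (Suc i) * (hecke_gen_inv i * hecke_gen_inv (Suc i)) =
    hecke_gen_inv i * (hecke_gen_inv (Suc i) * hecke_gen i)"
    and "hecke_gen_inv (Suc i) * (hecke_gen i * hecke_gen (Suc i)) =
    hecke_gen i * (hecke_gen (Suc i) * hecke_gen_inv i)"
    and "hecke_gen (Suc i) * (hecke_gen i * hecke_gen_inv (Suc i)) =
    hecke_gen_inv i * (hecke_gen (Suc i) * hecke_gen i)"
proof -
  let ?a = "hecke_gen i" and ?b = "hecke_gen (Suc i)"
  let ?a' = "hecke_gen_inv i" and ?b' = "hecke_gen_inv (Suc i)"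
  have inv: "?a * ?a' = 1" "?a' * ?a = 1" "?b * ?b' = 1" "?b' * ?b = 1"
    "\<And>x. ?a * (?a' * x) = x" "\<And>x. ?a' * (?a * x) = x" "\<And>x. ?b * (?b' * x) = x" "\<And>x. ?b' * (?b * x) = x"
    using assms by (simp_all add: hecke_gen_inv hecke_gen_inv_left hecke_gen_inv_right)
  have braid: "?b * (?a * (?b * x)) = ?a * (?b * (?a * x))" for x
    using hecke_gen_braid[OF assms] by (metis mult.assoc)
  have "?b * (?a' * ?b') = ?a' * (?b' * (?b * (?a * (?b * (?a' * ?b')))))"
    by (simp add: inv)
  also have "\<dots> = ?a' * (?b' * ?a)"
    unfolding braid by (simp add: inv)
  finally show "?b * (?a' * ?b') = ?a' * (?b' * ?a)" .
  have "?b' * (?a * ?b) = ?b' * (?a * (?b * (?a * ?a')))"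
    by (simp add: inv)
  also have "\<dots> = ?a * (?b * ?a')"
    unfolding braid[symmetric] by (simp add: inv)
  finally show "?b' * (?a * ?b) = ?a * (?b * ?a')" .
  have "?b * (?a * ?b') = ?a' * (?a * (?b * (?a * ?b')))"
    by (simp add: inv)
  also have "\<dots> = ?a' * (?b * ?a)"
    unfolding braid[symmetric] by (simp add: inv)
  finally show "?b * (?a * ?b') = ?a' * (?b * ?a)" .
qed

lemma hecke_gen_commute_tprime:
  assumes "1 \<le> i" "i < n"
  shows "hecke_gen i * tprime n = tprime n * hecke_gen i"
  using assms(2)
proof (induction n)
  case (Suc n)
  let ?g = "hecke_gen (Suc n)" and ?g' = "hecke_gen_inv (Suc n)"
  show ?case
  proof (cases "i < n")
    case True
    then have c: "hecke_gen i * ?g = ?g * hecke_gen i"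
      using hecke_gen_commute[of i "Suc n"] by simp
    then have c': "hecke_gen i * ?g' = ?g' * hecke_gen i"
      using commute_gen_inv[of "Suc n" "hecke_gen i"] by simp
    have "hecke_gen i * tprime (Suc n) = (hecke_gen i * ?g) * (tprime n * ?g')"
      by (simp add: mult.assoc)
    also have "\<dots> = ?g * ((hecke_gen i * tprime n) * ?g')"
      unfolding c by (simp add: mult.assoc)
    also have "\<dots> = ?g * (tprime n * (hecke_gen i * ?g'))"
      unfolding Suc.IH[OF True] by (simp add: mult.assoc)
    also have "\<dots> = tprime (Suc n) * hecke_gen i"
      unfolding c' by (simp add: mult.assoc)
    finally show ?thesis .
  next
    case False
    \<comment> \<open>The critical index. Unfolding \<open>tprime\<close> twice exposes
      \<open>tprime m\<close>, which commutes with \<open>?g\<close>; the braid relation then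
      carries \<open>?a\<close> through from left to right.\<close>
    then have i: "i = n" using Suc by simp
    obtain m where m: "n = Suc m" using assms(1) i by (cases n) auto
    let ?a = "hecke_gen n" and ?a' = "hecke_gen_inv n"
    have n1: "1 \<le> n" using assms(1) i by simp
    have c: "?g * tprime m = tprime m * ?g"
      using hecke_gen_commute_H[OF tprime_in_H[of m], of "Suc n"] m by simp
    have T: "tprime (Suc n) = ?g * (?a * (tprime m * (?a' * ?g')))"
      by (simp add: m mult.assoc)
    have "?a * tprime (Suc n) = ?g * (?a * ((?g * tprime m) * (?a' * ?g')))"
      unfolding T using arg_cong[OF hecke_gen_braid[OF n1], of "\<lambda>u. u * (tprime m * (?a' * ?g'))"]
      by (simp only: mult.assoc)
    also have "\<dots> = ?g * (?a * (tprime m * (?g * (?a' * ?g'))))"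
      unfolding c by (simp add: mult.assoc)
    also have "\<dots> = tprime (Suc n) * ?a"
      unfolding hecke_gen_braid_inv(1)[OF n1] T by (simp add: mult.assoc)
    finally show ?thesis unfolding i .
  qed
qed simp

text \<open>The coset decomposition of the Hecke algebra of type \<open>B\<^sub>n\<^sub>+\<^sub>1\<close> with respect to that of
  type \<open>B\<^sub>n\<close>.\<close>

inductive_set coset_span :: "nat \<Rightarrow> hecke set" for n where
  base: "a \<in> H n \<Longrightarrow> a \<in> coset_span n"
| gen: "1 \<le> n \<Longrightarrow> a \<in> H n \<Longrightarrow> b \<in> H n \<Longrightarrow> a * hecke_gen n * b \<in> coset_span n"
| tprime: "a \<in> H n \<Longrightarrow> a * tprime n \<in> coset_span n"
| add: "x \<in> coset_span n \<Longrightarrow> y \<in> coset_span n \<Longrightarrow> x + y \<in> coset_span n"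

lemma coset_span_mult_left:
  assumes "a \<in> H n" "x \<in> coset_span n"
  shows "a * x \<in> coset_span n"
  using assms(2)
proof induction
  case (gen b c)
  then show ?case
    using coset_span.gen[of n "a * b" c] assms(1) by (simp add: mult.assoc H_mult)
next
  case (tprime b)
  then show ?case
    using coset_span.tprime[of "a * b" n] assms(1) by (simp add: mult.assoc H_mult)
qed (use assms(1) in \<open>auto simp: distrib_left intro: coset_span.intros H_mult\<close>)

lemma coset_span_scale: "x \<in> coset_span n \<Longrightarrow> hecke_scale c x \<in> coset_span n"
  using coset_span_mult_left[OF H_scale[OF H_1], of x n c] by (simp add: hecke_scale_mult_left)

lemma coset_span_diff: "x \<in> coset_span n \<Longrightarrow> y \<in> coset_span n \<Longrightarrow> x - y \<in> coset_span n"
  using coset_span.add[OF _ coset_span_scale[of y n "-1"], of x] by simp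

text \<open>Conjugation by \<open>g_n\<close> fixes \<open>H (n - 1)\<close>, turns
  \<open>g_(n-1)\<close> into \<open>g_(n-1)^-1 g_n g_(n-1)\<close> by the braid relation, and turns
  \<open>t'_(n-1)\<close> into \<open>t'_n\<close>. This resolves words in which \<open>g_n\<close>
  occurs twice.\<close>

lemma coset_span_conj:
  assumes "1 \<le> n" "y \<in> coset_span (n - 1)"
  shows "hecke_gen n * y * hecke_gen_inv n \<in> coset_span n"
  using assms(2)
proof induction
  case (base a)
  then have "hecke_gen n * a * hecke_gen_inv n = a"
    using assms(1) by (simp add: hecke_gen_commute_H[of a "n - 1" n] mult.assoc hecke_gen_inv)
  then show ?case
    using base H_mono[of "n - 1" n] by (auto intro: coset_span.base)
next
  case (gen a b)
  define m where "m = n - 1"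
  have m: "n = Suc m" "1 \<le> m" using gen assms by (auto simp: m_def)
  have "hecke_gen n * (a * hecke_gen m * b) * hecke_gen_inv n =
      (hecke_gen n * a) * (hecke_gen m * (b * hecke_gen_inv n))"
    by (simp add: mult.assoc)
  also have "\<dots> = a * (hecke_gen n * (hecke_gen m * hecke_gen_inv n)) * b"
    using gen m hecke_gen_commute_H[of a m n] hecke_gen_inv_commute_H[of b m n]
    by (simp add: mult.assoc)
  also have "\<dots> = (a * hecke_gen_inv m) * hecke_gen n * (hecke_gen m * b)"
    unfolding m(1) hecke_gen_braid_inv(3)[OF m(2)] by (simp add: mult.assoc)
  also have "\<dots> \<in> coset_span n"
    using gen m assms(1) H_mono[of m n] H_gen[of m n] H_gen_inv[of m n]
    by (intro coset_span.gen H_mult) auto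
  finally show ?case by (simp add: m_def)
next
  case (tprime a)
  define m where "m = n - 1"
  have m: "n = Suc m" using assms by (auto simp: m_def)
  have "hecke_gen n * (a * tprime m) * hecke_gen_inv n = (hecke_gen n * a) * (tprime m * hecke_gen_inv n)"
    by (simp add: mult.assoc)
  also have "\<dots> = a * tprime n"
    using tprime m hecke_gen_commute_H[of a m n] by (simp add: mult.assoc)
  also have "\<dots> \<in> coset_span n"
    using tprime m H_mono[of m n] by (intro coset_span.tprime) auto
  finally show ?case by (simp add: m_def)
qed (auto simp: distrib_left distrib_right intro: coset_span.add)

text \<open>It is \<open>g t g\<close>, not \<open>g t g^-1\<close>, that commutes with
  \<open>t\<close>. Replacing \<open>q g^-1\<close> by \<open>g - (q - 1)\<close> and back leaves
  correction terms that contain \<open>g_1\<close> only once.\<close>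

lemma tprime_1_mult_t: "tprime 1 * hecke_gen 0 \<in> coset_span 1"
proof -
  let ?t = "hecke_gen 0" and ?g = "hecke_gen 1"
  have t: "?t \<in> H 1" "?t * ?t \<in> H 1" by (auto intro: H_gen H_mult)
  have T: "tprime 1 = ?g * (?t * hecke_gen_inv 1)"
    using tprime.simps(2)[of 0] by (simp add: mult.assoc)
  have "hecke_scale qvar (tprime 1 * ?t) = ?g * (?t * (hecke_scale qvar (hecke_gen_inv 1) * ?t))"
    unfolding T by (simp only: mult.assoc hecke_scale_mult_left hecke_scale_mult_right)
  also have "\<dots> = ?g * (?t * (?g * ?t)) - hecke_scale (qvar - 1) (1 * ?g * (?t * ?t))"
    by (simp only: hecke_gen_inv_eq left_diff_distrib right_diff_distrib hecke_scale_mult_left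
        hecke_scale_mult_right mult_1_left)
  also have "?g * (?t * (?g * ?t)) = ?t * (?g * (?t * ?g))"
    by (rule hecke_gen_braid_t[symmetric])
  also have "\<dots> = ?t * (?g * (?t * (hecke_scale qvar (hecke_gen_inv 1) + hecke_scale (qvar - 1) 1)))"
    by (simp only: hecke_gen_eq_inv[of 1, symmetric])
  also have "\<dots> = hecke_scale qvar (?t * tprime 1) + hecke_scale (qvar - 1) (?t * ?g * ?t)"
    unfolding T by (simp only: distrib_left hecke_scale_mult_left hecke_scale_mult_right mult.assoc mult_1_right)
  finally have *: "hecke_scale qvar (tprime 1 * ?t) = hecke_scale qvar (?t * tprime 1) +
      hecke_scale (qvar - 1) (?t * ?g * ?t) - hecke_scale (qvar - 1) (1 * ?g * (?t * ?t))" .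
  have "hecke_scale qvar (tprime 1 * ?t) \<in> coset_span 1"
    unfolding * using t
    by (intro coset_span_diff coset_span.add coset_span_scale coset_span.tprime coset_span.gen) (auto intro: H_1)
  from coset_span_scale[OF this, of "inverse qvar"] show ?thesis
    by (simp add: qvar_nonzero)
qed

text \<open>The span contains 1 and is closed under right multiplication by every generator. The
  spanning set for the previous \<open>n\<close> enters through conjugation by
  \<open>g_n\<close>.\<close>

lemma H_Suc_coset_span: "H (Suc n) \<subseteq> coset_span n"
proof (induction n)
  case 0
  show ?case
  proof
    fix x assume "x \<in> H (Suc 0)"
    then show "x \<in> coset_span 0"
    proof (rule H_induct_right)
      fix i x assume *: "i < Suc 0" "x \<in> coset_span 0"
      show "x * hecke_gen i \<in> coset_span 0"
        using *(2)
      proof induction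
        case (base a)
        then show ?case using *(1) coset_span.tprime[of a 0] by simp
      next
        case (tprime a)
        have "a * tprime 0 * hecke_gen i = hecke_scale (Qvar - 1) (a * tprime 0) + hecke_scale Qvar a"
          using *(1) by (simp add: mult.assoc hecke_gen_quad_t distrib_left hecke_scale_mult_right)
        also have "\<dots> \<in> coset_span 0"
          using tprime by (intro coset_span.add coset_span_scale coset_span.tprime coset_span.base)
        finally show ?case .
      qed (auto simp: distrib_right intro: coset_span.add)
    qed (auto intro: coset_span.intros H_1 coset_span_scale)
  qed
next
  case (Suc m)
  define n where "n = Suc m"
  have conj: "hecke_gen n * y * hecke_gen_inv n \<in> coset_span n" if "y \<in> H n" for y
    using coset_span_conj[of n y] that Suc by (auto simp: n_def)
  show ?case
  proof
    fix x assume "x \<in> H (Suc (Suc m))"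
    then have "x \<in> H (Suc n)" by (simp add: n_def)
    then have "x \<in> coset_span n"
    proof (rule H_induct_right)
      fix i x assume *: "i < Suc n" "x \<in> coset_span n"
      show "x * hecke_gen i \<in> coset_span n"
        using *(2)
      proof induction
        case (base a)
        show ?case
        proof (cases "i < n")
          case True
          then show ?thesis using base by (auto intro: coset_span.base H_mult H_gen)
        next
          case False
          then show ?thesis using base *(1) coset_span.gen[of n a 1] H_1 by (simp add: n_def less_Suc_eq)
        qed
      next
        case (gen a b)
        show ?case
        proof (cases "i < n")
          case True
          then show ?thesis
            using gen coset_span.gen[of n a "b * hecke_gen i"] by (simp add: mult.assoc H_mult H_gen)
        next
          case False
          then have i: "i = n" using * by simp
          \<comment> \<open>The second \<open>g_n\<close> is replaced by its inverse up to a term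
            with a single \<open>g_n\<close>, so that \<open>b\<close> appears conjugated.\<close>
          have "a * hecke_gen n * b * hecke_gen n =
              a * hecke_gen n * b * (hecke_scale qvar (hecke_gen_inv n) + hecke_scale (qvar - 1) 1)"
            by (simp flip: hecke_gen_eq_inv)
          also have "\<dots> = hecke_scale qvar (a * (hecke_gen n * b * hecke_gen_inv n)) +
              hecke_scale (qvar - 1) (a * hecke_gen n * b)"
            by (simp add: distrib_left hecke_scale_mult_right mult.assoc)
          also have "\<dots> \<in> coset_span n"
            using gen by (intro coset_span.add coset_span_scale coset_span_mult_left[OF gen(2) conj] coset_span.gen)
          finally show ?thesis unfolding i .
        qed
      next
        case (tprime a)
        consider "i = n" | "1 \<le> i" "i < n" | "i = 0" using *(1) by linarith
        then show ?case
        proof cases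
          case 1
          have "tprime n * hecke_gen n = hecke_gen n * tprime m"
            using tprime_shift[of m] unfolding n_def by (rule sym)
          then have "a * tprime n * hecke_gen i = a * hecke_gen n * tprime m"
            by (simp only: 1 mult.assoc)
          also have "\<dots> \<in> coset_span n"
            using tprime tprime_in_H[of m] by (intro coset_span.gen) (auto simp: n_def)
          finally show ?thesis .
        next
          case 2
          then have "a * tprime n * hecke_gen i = (a * hecke_gen i) * tprime n"
            by (simp add: hecke_gen_commute_tprime mult.assoc)
          then show ?thesis
            using tprime 2 by (simp add: coset_span.tprime H_mult H_gen)
        next
          case 3
          \<comment> \<open>For \<open>n > 1\<close> the generator \<open>t\<close> passes through
            \<open>g_n^-1\<close>, and again a conjugate of an element of \<open>H n\<close>
            remains; \<open>n = 1\<close> needs the relation between \<open>t\<close> and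
            \<open>g_1\<close>.\<close>
          have "tprime n * hecke_gen 0 \<in> coset_span n"
          proof (cases "m = 0")
            case True
            then show ?thesis using tprime_1_mult_t by (simp add: n_def)
          next
            case False
            have "hecke_gen_inv n * hecke_gen 0 = hecke_gen 0 * hecke_gen_inv n"
              using False hecke_gen_inv_commute_H[OF H_gen[of 0 1], of n] by (simp add: n_def)
            then have "tprime n * hecke_gen 0 = hecke_gen n * (tprime m * hecke_gen 0) * hecke_gen_inv n"
              by (simp add: n_def mult.assoc)
            moreover have "tprime m * hecke_gen 0 \<in> H n"
              using tprime_in_H[of m] by (auto simp: n_def intro: H_mult H_gen)
            ultimately show ?thesis using conj by simp
          qed
          then show ?thesis
            using tprime 3 coset_span_mult_left by (simp add: mult.assoc)
        qed
      qed (auto simp: distrib_right intro: coset_span.add)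
    qed (auto intro: coset_span.intros H_1 coset_span_scale)
    then show "x \<in> coset_span (Suc m)" by (simp add: n_def)
  qed
qed


text \<open>Conjugation by \<open>c = g\<^bsub>m+1\<^esub> \<dots> g\<^sub>n\<close> shifts the elements \<open>t'\<^sub>i\<close>, and it takes \<open>g\<^sub>m\<close> to a conjugate of
  \<open>g\<^sub>n\<close> by \<open>e = g\<^sub>m \<dots> g\<^bsub>n-1\<^esub>\<close>.\<close>

definition is_shift :: "nat \<Rightarrow> nat \<Rightarrow> hecke \<Rightarrow> hecke \<Rightarrow> hecke \<Rightarrow> hecke \<Rightarrow> bool" where
  "is_shift m n c c' e e' \<longleftrightarrow> c * c' = 1 \<and> c' * c = 1 \<and> e \<in> H n \<and> e' \<in> H n \<and>
    (\<forall>x. (\<forall>i. m < i \<and> i \<le> n \<longrightarrow> hecke_gen i * x = x * hecke_gen i) \<longrightarrow> c * x = x * c) \<and>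
    (\<forall>i. m \<le> i \<and> i < n \<longrightarrow> c * tprime i = tprime (Suc i) * c) \<and>
    (1 \<le> m \<longrightarrow> c' * (hecke_gen m * c) = e * (hecke_gen n * e'))"

lemma is_shiftD:
  assumes "is_shift m n c c' e e'"
  shows "c * c' = 1" "c' * c = 1" "e \<in> H n" "e' \<in> H n"
    and "\<And>x. (\<And>i. m < i \<Longrightarrow> i \<le> n \<Longrightarrow> hecke_gen i * x = x * hecke_gen i) \<Longrightarrow> c * x = x * c"
    and "\<And>i. m \<le> i \<Longrightarrow> i < n \<Longrightarrow> c * tprime i = tprime (Suc i) * c"
    and "1 \<le> m \<Longrightarrow> c' * (hecke_gen m * c) = e * (hecke_gen n * e')"
  using assms unfolding is_shift_def by (simp_all del: tprime.simps)

lemma ex_shift: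
  assumes "m \<le> n"
  shows "\<exists>c c' e e'. is_shift m n c c' e e'"
  using assms
proof (induction n rule: dec_induct)
  case base
  show ?case
    by (intro exI[of _ 1]) (auto simp: H_1 is_shift_def)
next
  case (step n)
  then obtain c c' e e' where shift: "is_shift m n c c' e e'" by blast
  note c = is_shiftD(1,2)[OF shift] and e = is_shiftD(3,4)[OF shift] and cc = is_shiftD(5)[OF shift]
    and ct = is_shiftD(6)[OF shift] and cg = is_shiftD(7)[OF shift]
  let ?g = "hecke_gen (Suc n)" and ?g' = "hecke_gen_inv (Suc n)"
  have inv: "?g * ?g' = 1" "?g' * ?g = 1" by (simp_all add: hecke_gen_inv)
  have "is_shift m (Suc n) (c * ?g) (?g' * c') (e * hecke_gen n) (hecke_gen_inv n * e')"
    unfolding is_shift_def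
  proof (intro conjI allI impI)
    show "c * ?g * (?g' * c') = 1"
      using c(1) inv(1) by (metis mult.assoc mult_1_left)
    show "?g' * c' * (c * ?g) = 1"
      using c(2) inv(2) by (metis mult.assoc mult_1_left)
    show "e * hecke_gen n \<in> H (Suc n)" "hecke_gen_inv n * e' \<in> H (Suc n)"
      using e H_mono[of n "Suc n"] by (auto intro!: H_mult H_gen H_gen_inv)
  next
    fix x assume x: "\<forall>i. m < i \<and> i \<le> Suc n \<longrightarrow> hecke_gen i * x = x * hecke_gen i"
    then have "c * x = x * c" "?g * x = x * ?g"
      using cc step.hyps by auto
    then show "c * ?g * x = x * (c * ?g)"
      by (metis mult.assoc)
  next
    fix i assume i: "m \<le> i \<and> i < Suc n"
    show "c * ?g * tprime i = tprime (Suc i) * (c * ?g)"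
    proof (cases "i < n")
      case True
      have "?g * tprime i = tprime i * ?g"
        using True by (intro hecke_gen_commute_H[OF tprime_in_H]) simp
      then show ?thesis
        using ct[of i] i True by (metis mult.assoc)
    next
      case False
      then have i: "i = n" using i by simp
      have "c * tprime (Suc n) = tprime (Suc n) * c"
        by (intro cc hecke_gen_commute_tprime) auto
      then show ?thesis
        unfolding i using tprime_shift[of n] by (metis mult.assoc)
    qed
  next
    assume m: "1 \<le> m"
    then have n: "1 \<le> n" using step.hyps by simp
    have "?g' * c' * (hecke_gen m * (c * ?g)) = ?g' * (c' * (hecke_gen m * c)) * ?g"
      by (simp only: mult.assoc)
    also have "\<dots> = (?g' * e) * (hecke_gen n * (e' * ?g))"
      unfolding cg[OF m] by (simp only: mult.assoc)
    also have "\<dots> = e * (?g' * (hecke_gen n * ?g)) * e'"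
      using hecke_gen_inv_commute_H[OF e(1), of "Suc n"] hecke_gen_commute_H[OF e(2), of "Suc n"]
      by (simp add: mult.assoc)
    also have "\<dots> = e * hecke_gen n * (?g * (hecke_gen_inv n * e'))"
      unfolding hecke_gen_braid_inv(2)[OF n] by (simp only: mult.assoc)
    finally show "?g' * c' * (hecke_gen m * (c * ?g)) = e * hecke_gen n * (?g * (hecke_gen_inv n * e'))" .
  qed
  then show ?case by blast
qed

lemma prod_list_conj:
  fixes c :: "'a :: monoid_mult"
  assumes "\<And>i. i \<in> set xs \<Longrightarrow> c * f i = g i * c"
  shows "c * prod_list (map f xs) = prod_list (map g xs) * c"
  using assms
proof (induction xs)
  case (Cons a xs)
  then show ?case
    by simp (metis mult.assoc)
qed simp

lemma prod_list_tprime_in_H: "set xs \<subseteq> {..<n} \<Longrightarrow> prod_list (map tprime xs) \<in> H n"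
proof (induction xs)
  case (Cons i xs)
  then have "tprime i \<in> H n"
    using tprime_in_H[of i] H_mono[of "Suc i" n] by auto
  then show ?case using Cons by (simp add: H_mult)
qed (simp add: H_1)

text \<open>Applied to the difference of two Markov traces. Cyclicity and the Markov rule handle
  \<open>a g_n b\<close>; the difficulty is \<open>a t'_n\<close>, since the hypothesis speaks only
  of full products of the \<open>t'_i\<close>.\<close>

lemma markov_functional_zero:
  fixes D :: "hecke \<Rightarrow> ratfun"
  assumes add: "\<And>x y. D (x + y) = D x + D y" and scale: "\<And>c x. D (hecke_scale c x) = c * D x"
    and cyc: "\<And>x y. D (x * y) = D (y * x)"
    and markov: "\<And>n h. 1 \<le> n \<Longrightarrow> h \<in> H n \<Longrightarrow> D (h * hecke_gen n) = z * D h"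
    and tprimes: "\<And>k. D (prod_list (map tprime [0..<k])) = 0"
  shows "D x = 0"
proof -
  have scalars: "D (h * y) = 0" if "D y = 0" "h \<in> H 0" for h y
    using that(2) by (rule H_induct_left) (simp_all add: that(1) add scale distrib_right hecke_scale_mult_left)
  have markov': "D (x * hecke_gen n * y) = z * D (y * x)" if "1 \<le> n" "x \<in> H n" "y \<in> H n" for x y n
    using cyc[of "x * hecke_gen n" y] markov[of n "y * x"] that by (simp add: H_mult mult.assoc)
  have H: "\<forall>x\<in>H n. D x = 0" for n
  proof (induction n)
    case 0
    show ?case using scalars[of 1] tprimes[of 0] by simp
  next
    case (Suc n)
    let ?T = "\<lambda>m k. prod_list (map tprime [m..<k])"
    \<comment> \<open>Induction on \<open>m\<close> lets \<open>h\<close> shrink while the product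
      grows to the left. A coset \<open>a t'_m\<close> lengthens the product. For the other cosets,
      conjugation by \<open>c\<close> shifts the product down into \<open>H n\<close>, and what is
      left is in \<open>H n\<close> or contains \<open>g_n\<close> once.\<close>
    have T: "D (h * ?T m (Suc n)) = 0" if "h \<in> H m" "m \<le> n" for h m
      using that
    proof (induction m arbitrary: h)
      case 0
      then show ?case using scalars tprimes by blast
    next
      case (Suc m)
      have TH: "?T m n \<in> H n"
        by (rule prod_list_tprime_in_H) auto
      obtain c c' e e' where shift: "is_shift m n c c' e e'"
        using ex_shift[of m n] Suc.prems(2) by auto
      note c = is_shiftD(1,2)[OF shift] and e = is_shiftD(3,4)[OF shift] and cc = is_shiftD(5)[OF shift]
        and ct = is_shiftD(6)[OF shift] and cg = is_shiftD(7)[OF shift]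
      have cH: "c * x = x * c" if "x \<in> H m" for x
        using that by (intro cc hecke_gen_commute_H) auto
      have "c * ?T m n = prod_list (map (\<lambda>i. tprime (Suc i)) [m..<n]) * c"
        using ct by (intro prod_list_conj) auto
      also have "map (\<lambda>i. tprime (Suc i)) [m..<n] = map tprime [Suc m..<Suc n]"
        by (simp add: map_Suc_upt[symmetric] comp_def del: upt_Suc map_Suc_upt)
      \<comment> \<open>All indices drop by one under the conjugation; the product now ends at
        \<open>t'_(n-1)\<close> and lies in \<open>H n\<close>.\<close>
      finally have shift: "?T (Suc m) (Suc n) = c * ?T m n * c'"
        using c(1) by (metis mult.assoc mult_1_right)
      have "h \<in> coset_span m" using Suc.prems H_Suc_coset_span by blast
      then show ?case
      proof induction
        case (base a)
        have "D (a * ?T (Suc m) (Suc n)) = D (c' * (a * c * ?T m n))"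
          unfolding shift using cyc[of "a * (c * ?T m n)" c'] by (simp only: mult.assoc)
        also have "c' * (a * c * ?T m n) = (c' * c) * (a * ?T m n)"
          unfolding cH[OF base, symmetric] by (simp only: mult.assoc)
        also have "D \<dots> = 0"
          using Suc.IH TH base c(2) \<open>\<forall>x\<in>H n. D x = 0\<close> H_mono[of m n] Suc.prems(2)
          by (auto intro!: H_mult)
        finally show ?case .
      next
        case (gen a b)
        have c'a: "c' * a = a * c'"
          using cH[OF gen(2)] c by (metis mult.assoc mult_1_left mult_1_right)
        have "D (a * hecke_gen m * b * ?T (Suc m) (Suc n)) = D (c' * (a * (hecke_gen m * ((b * c) * ?T m n))))"
          unfolding shift using cyc[of "a * (hecke_gen m * (b * (c * ?T m n)))" c'] by (simp only: mult.assoc)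
        also have "c' * (a * (hecke_gen m * ((b * c) * ?T m n))) = (c' * a) * (hecke_gen m * (c * (b * ?T m n)))"
          unfolding cH[OF gen(3), symmetric] by (simp only: mult.assoc)
        also have "\<dots> = a * (c' * (hecke_gen m * c)) * (b * ?T m n)"
          unfolding c'a by (simp only: mult.assoc)
        also have "\<dots> = (a * e) * hecke_gen n * (e' * (b * ?T m n))"
          unfolding cg[OF gen(1)] by (simp only: mult.assoc)
        also have "D \<dots> = z * D (e' * (b * ?T m n) * (a * e))"
          using gen e TH Suc.prems(2) H_mono[of m n] by (intro markov') (auto intro!: H_mult)
        also have "\<dots> = 0"
          using gen e TH Suc.prems(2) H_mono[of m n] \<open>\<forall>x\<in>H n. D x = 0\<close> by (auto intro!: H_mult)
        finally show ?case .
      next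
        case (tprime a)
        have "a * tprime m * ?T (Suc m) (Suc n) = a * ?T m (Suc n)"
          using Suc.prems(2) by (simp add: upt_conv_Cons mult.assoc del: upt_Suc)
        then show ?case
          using Suc.IH[of a] tprime Suc.prems(2) by simp
      qed (simp add: distrib_right add)
    qed
    show ?case
    proof
      fix x assume "x \<in> H (Suc n)"
      then have "x \<in> coset_span n" using H_Suc_coset_span by blast
      then show "D x = 0"
      proof induction
        case (gen a b)
        then show ?case using markov'[of n a b] Suc by (simp add: H_mult)
      next
        case (tprime a)
        then show ?case using T[of a n] by simp
      qed (use Suc in \<open>simp_all add: add\<close>)
    qed
  qed
  then show ?thesis using ex_H[of x] by blast
qed

theorem markov_trace_unique:
  assumes "markov_trace z tr" "markov_trace z tr'"
    and "\<And>k. k \<ge> 1 \<Longrightarrow> tr (prod_list (map tprime [0..<k])) = tr' (prod_list (map tprime [0..<k]))"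
  shows "tr = tr'"
proof
  fix x
  interpret tr: Vector_Spaces.linear hecke_scale "(*)" tr
    using assms(1) by (simp add: markov_trace_def)
  interpret tr': Vector_Spaces.linear hecke_scale "(*)" tr'
    using assms(2) by (simp add: markov_trace_def)
  have "tr x - tr' x = 0"
  proof (rule markov_functional_zero)
    show "tr (prod_list (map tprime [0..<k])) - tr' (prod_list (map tprime [0..<k])) = 0" for k
      using assms by (cases "k = 0") (simp_all add: markov_trace_def)
    show "tr (x * y) - tr' (x * y) = tr (y * x) - tr' (y * x)" for x y
      using assms(1,2) by (simp add: markov_trace_def)
    show "tr (h * hecke_gen n) - tr' (h * hecke_gen n) = z * (tr h - tr' h)" if "1 \<le> n" "h \<in> H n" for n h
      using assms(1,2) that by (simp add: markov_trace_def algebra_simps)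
  qed (simp_all add: tr.add tr'.add tr.scale tr'.scale algebra_simps)
  then show "tr x = tr' x" by simp
qed

section \<open>Interpolation identities\<close>

lemma coeff_prod_linear_factors:
  fixes Z :: "'k \<Rightarrow> 'a :: comm_ring_1"
  assumes "finite A"
  shows "degree (\<Prod>l\<in>A. [:- Z l, c:]) \<le> card A"
    and "coeff (\<Prod>l\<in>A. [:- Z l, c:]) (card A) = c ^ card A"
  using assms
proof (induction A)
  case (insert l A)
  let ?p = "\<Prod>l\<in>A. [:- Z l, c:]"
  { case 1
    have "degree ([:- Z l, c:] * ?p) \<le> degree [:- Z l, c:] + degree ?p"
      by (rule degree_mult_le)
    also have "\<dots> \<le> 1 + card A"
      using insert by (intro add_mono) auto
    finally show ?case using insert by simp }
  { case 2
    have "coeff ?p (Suc (card A)) = 0"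
      using insert by (intro coeff_eq_0) auto
    then show ?case using insert by simp }
qed simp_all

text \<open>Comparison of the top coefficients of \<open>p\<close> and of its Lagrange interpolant.
  If the degree of \<open>p\<close> is below \<open>card K - 1\<close>, the sum is 0, which gives
  the vanishing statements further on.\<close>

lemma lagrange_leading_coeff:
  fixes Z :: "'k \<Rightarrow> 'a :: field"
  assumes "finite K" "inj_on Z K" "degree p < card K"
  shows "(\<Sum>k\<in>K. poly p (Z k) / (\<Prod>l\<in>K - {k}. Z k - Z l)) = coeff p (card K - 1)"
proof -
  define c where "c k = poly p (Z k) / (\<Prod>l\<in>K - {k}. Z k - Z l)" for k
  define L where "L = (\<Sum>k\<in>K. smult (c k) (\<Prod>l\<in>K - {k}. [:- Z l, 1:]))"
  have K: "card (K - {k}) = card K - 1" if "k \<in> K" for k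
    using that assms(1) by simp
  have "degree L \<le> card K - 1"
    unfolding L_def
  proof (intro degree_sum_le assms(1))
    fix k assume k: "k \<in> K"
    have "degree (smult (c k) (\<Prod>l\<in>K - {k}. [:- Z l, 1:])) \<le> degree (\<Prod>l\<in>K - {k}. [:- Z l, 1:])"
      by (rule degree_smult_le)
    also have "\<dots> \<le> card (K - {k})"
      using assms(1) by (intro coeff_prod_linear_factors) simp
    finally show "degree (smult (c k) (\<Prod>l\<in>K - {k}. [:- Z l, 1:])) \<le> card K - 1"
      using K[OF k] by simp
  qed
  then have deg: "degree L < card K" using assms(3) by simp
  have "poly L (Z m) = poly p (Z m)" if m: "m \<in> K" for m
  proof -
    have "poly L (Z m) = (\<Sum>k\<in>K. c k * (\<Prod>l\<in>K - {k}. Z m - Z l))"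
      by (simp add: L_def poly_sum poly_prod)
    also have "\<dots> = c m * (\<Prod>l\<in>K - {m}. Z m - Z l) + (\<Sum>k\<in>K - {m}. c k * (\<Prod>l\<in>K - {k}. Z m - Z l))"
      using m assms(1) by (simp add: sum.remove)
    also have "(\<Sum>k\<in>K - {m}. c k * (\<Prod>l\<in>K - {k}. Z m - Z l)) = 0"
    proof (intro sum.neutral ballI)
      fix k assume "k \<in> K - {m}"
      then have "(\<Prod>l\<in>K - {k}. Z m - Z l) = 0"
        using m assms(1) by (intro prod_zero) auto
      then show "c k * (\<Prod>l\<in>K - {k}. Z m - Z l) = 0" by simp
    qed
    also have "(\<Prod>l\<in>K - {m}. Z m - Z l) \<noteq> 0"
      using m assms(1,2) by (auto simp: inj_on_def)
    then have "c m * (\<Prod>l\<in>K - {m}. Z m - Z l) = poly p (Z m)"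
      by (simp add: c_def)
    finally show ?thesis by simp
  qed
  then have "L = p"
    using deg assms(3) card_image[OF assms(2)] by (intro poly_eqI_degree[of "Z ` K"]) auto
  moreover have "coeff L (card K - 1) = (\<Sum>k\<in>K. c k)"
    unfolding L_def coeff_sum coeff_smult
  proof (intro sum.cong refl)
    fix k assume "k \<in> K"
    then show "c k * coeff (\<Prod>l\<in>K - {k}. [:- Z l, 1:]) (card K - 1) = c k"
      using coeff_prod_linear_factors(2)[of "K - {k}" Z 1] K[of k] assms(1) by simp
  qed
  ultimately show ?thesis by (simp add: c_def)
qed

text \<open>The ratio of weights from the overview without the factor
  \<open>(1 - q) / (1 - q^r)\<close>.\<close>

definition transition :: "'a :: field \<Rightarrow> ('k \<Rightarrow> 'a) \<Rightarrow> 'k set \<Rightarrow> 'k \<Rightarrow> 'a" where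
  "transition q Z K k = (\<Prod>l\<in>K - {k}. (q * Z k - Z l) / (Z k - Z l))"

lemma sum_transition:
  fixes Z :: "'k \<Rightarrow> 'a :: field"
  assumes K: "finite K" and inj: "inj_on Z K" and nz: "\<And>k. k \<in> K \<Longrightarrow> Z k \<noteq> 0" and q: "q \<noteq> 1"
  shows "(\<Sum>k\<in>K. transition q Z K k) = (1 - q ^ card K) / (1 - q)"
proof (cases "K = {}")
  case False
  define r where "r = card K - 1"
  have r: "card K = Suc r" using False K by (simp add: r_def card_gt_0_iff)
  define N where "N = (\<Prod>l\<in>K. [:- Z l, q:]) - (\<Prod>l\<in>K. [:- Z l, 1:])"
  obtain a p where N: "N = pCons a p" by (cases N)
  have "poly N 0 = 0" by (simp add: N_def poly_prod)
  then have a: "a = 0" by (simp add: N)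
  have "degree N \<le> card K"
    unfolding N_def using coeff_prod_linear_factors(1)[OF K] by (intro degree_diff_le) auto
  then have deg: "degree p < card K"
    using r by (cases "p = 0") (auto simp: N)
  have coeff: "coeff p (card K - 1) = q ^ card K - 1"
    using coeff_prod_linear_factors(2)[OF K, of Z q] coeff_prod_linear_factors(2)[OF K, of Z 1]
      arg_cong[OF N, of "\<lambda>p. coeff p (card K)"] by (simp add: N_def r)
  have "transition q Z K k = poly p (Z k) / (\<Prod>l\<in>K - {k}. Z k - Z l) / (q - 1)" if k: "k \<in> K" for k
  proof -
    have "Z k * poly p (Z k) = (\<Prod>l\<in>K. q * Z k - Z l) - (\<Prod>l\<in>K. Z k - Z l)"
      using arg_cong[OF N, of "\<lambda>p. poly p (Z k)"] by (simp add: N_def a poly_prod mult.commute)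
    also have "(\<Prod>l\<in>K. Z k - Z l) = 0"
      using k K by (intro prod_zero) auto
    also have "(\<Prod>l\<in>K. q * Z k - Z l) = Z k * ((q - 1) * (\<Prod>l\<in>K - {k}. q * Z k - Z l))"
      using k K by (simp add: prod.remove algebra_simps)
    finally have "poly p (Z k) = (q - 1) * (\<Prod>l\<in>K - {k}. q * Z k - Z l)"
      using nz[OF k] by simp
    then show ?thesis using q by (simp add: transition_def prod_dividef)
  qed
  then have "(\<Sum>k\<in>K. transition q Z K k) =
      (\<Sum>k\<in>K. poly p (Z k) / (\<Prod>l\<in>K - {k}. Z k - Z l) / (q - 1))"
    by (intro sum.cong) auto
  also have "\<dots> = (q ^ card K - 1) / (q - 1)"
    using lagrange_leading_coeff[OF K inj deg] coeff by (simp only: sum_divide_distrib[symmetric])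
  also have "\<dots> = (1 - q ^ card K) / (1 - q)"
    using minus_divide_divide[of "1 - q ^ card K" "1 - q"] by simp
  finally show ?thesis .
qed simp

text \<open>In the following, \<open>b\<close> is the content of a removable box in row \<open>m\<close>, and \<open>Z k\<close> that of the
  addable box in row \<open>k\<close>.\<close>

context
  fixes q :: "'a :: field" and Z :: "'k \<Rightarrow> 'a" and K :: "'k set"
  assumes K: "finite K" and inj: "inj_on Z K" and nz: "\<And>k. k \<in> K \<Longrightarrow> Z k \<noteq> 0"
    and q: "q \<noteq> 0" "q \<noteq> 1"
begin

text \<open>The factor of row \<open>m\<close> is \<open>q * Z k - Z m = q * (Z k - b)\<close> and
  cancels the pole of Hoefsmit's coefficient. The summand becomes a polynomial in \<open>Z k\<close>
  over the interpolation denominator.\<close>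

lemma transition_removable:
  assumes "m \<in> K" "k \<in> K" "Z m = q * b" "Z k \<noteq> b"
  shows "transition q Z K k * ((q - 1) * Z k / (Z k - b)) =
    q * ((\<Prod>l\<in>K - {m}. q * Z k - Z l) / (\<Prod>l\<in>K - {k}. Z k - Z l))"
proof -
  have "(q - 1) * Z k * (\<Prod>l\<in>K - {k}. q * Z k - Z l) = (\<Prod>l\<in>K. q * Z k - Z l)"
    using assms(2) K by (simp add: prod.remove[of K k] algebra_simps)
  also have "\<dots> = q * (Z k - b) * (\<Prod>l\<in>K - {m}. q * Z k - Z l)"
    using assms(1,3) K by (simp add: prod.remove[of K m] algebra_simps)
  finally have "(q - 1) * Z k * (\<Prod>l\<in>K - {k}. q * Z k - Z l) / (Z k - b) =
      q * (\<Prod>l\<in>K - {m}. q * Z k - Z l)"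
    using assms(4) by (simp add: field_simps)
  then have "(q - 1) * Z k * (\<Prod>l\<in>K - {k}. q * Z k - Z l) / (Z k - b) / (\<Prod>l\<in>K - {k}. Z k - Z l) =
      q * (\<Prod>l\<in>K - {m}. q * Z k - Z l) / (\<Prod>l\<in>K - {k}. Z k - Z l)"
    by simp
  then show ?thesis
    unfolding transition_def prod_dividef by (simp only: divide_inverse mult_ac)
qed

text \<open>The polynomial left after the cancellation has degree \<open>card K - 1\<close> and
  leading coefficient \<open>q ^ (card K - 1)\<close>. This is the source of \<open>q^r\<close> in
  \<open>z\<close>.\<close>

lemma sum_transition_hdiag:
  assumes "m \<in> K" "Z m = q * b" "\<And>k. k \<in> K \<Longrightarrow> Z k \<noteq> b"
  shows "(\<Sum>k\<in>K. transition q Z K k * ((q - 1) * Z k / (Z k - b))) = q ^ card K"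
proof -
  let ?p = "\<Prod>l\<in>K - {m}. [:- Z l, q:]"
  have c: "card (K - {m}) = card K - 1" "0 < card K"
    using assms(1) K by (auto simp: card_gt_0_iff)
  have "degree ?p < card K" "coeff ?p (card K - 1) = q ^ (card K - 1)"
    using coeff_prod_linear_factors[of "K - {m}" Z q] K unfolding c(1) using c(2) by simp_all
  then have "(\<Sum>k\<in>K. (\<Prod>l\<in>K - {m}. q * Z k - Z l) / (\<Prod>l\<in>K - {k}. Z k - Z l)) = q ^ (card K - 1)"
    using lagrange_leading_coeff[OF K inj, of ?p] by (simp add: poly_prod mult.commute)
  moreover have "(\<Sum>k\<in>K. transition q Z K k * ((q - 1) * Z k / (Z k - b))) =
      (\<Sum>k\<in>K. q * ((\<Prod>l\<in>K - {m}. q * Z k - Z l) / (\<Prod>l\<in>K - {k}. Z k - Z l)))"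
    using assms by (intro sum.cong refl transition_removable) auto
  ultimately have "(\<Sum>k\<in>K. transition q Z K k * ((q - 1) * Z k / (Z k - b))) = q * q ^ (card K - 1)"
    by (simp only: sum_distrib_left[symmetric])
  also have "\<dots> = q ^ card K"
    using c(2) by (simp flip: power_Suc)
  finally show ?thesis .
qed

text \<open>Two different removable boxes cancel both poles, and the degree drops below
  \<open>card K - 1\<close>. It makes the entries of the expectation of \<open>t'_n\<close> vanish
  between paths with different last boxes.\<close>

lemma sum_transition_hdiag2_neq:
  assumes "m \<in> K" "m' \<in> K" "m \<noteq> m'" "Z m = q * b" "Z m' = q * b'"
    and "\<And>k. k \<in> K \<Longrightarrow> Z k \<noteq> b" "\<And>k. k \<in> K \<Longrightarrow> Z k \<noteq> b'"
  shows "(\<Sum>k\<in>K. transition q Z K k * ((q - 1) * Z k / (Z k - b)) *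
      ((q - 1) * Z k / (Z k - b') - (q - 1))) = 0"
proof -
  let ?p = "\<Prod>l\<in>K - {m} - {m'}. [:- Z l, q:]"
  have "card {m, m'} \<le> card K"
    using assms(1,2) K by (intro card_mono) auto
  then have c: "card (K - {m} - {m'}) = card K - 2" "2 \<le> card K"
    using assms(1-3) K by (simp_all add: card_Diff_singleton)
  then have d: "degree ?p < card K - 1"
    using coeff_prod_linear_factors(1)[of "K - {m} - {m'}" Z q] K unfolding c(1) using c(2) by simp
  then have "(\<Sum>k\<in>K. (\<Prod>l\<in>K - {m} - {m'}. q * Z k - Z l) / (\<Prod>l\<in>K - {k}. Z k - Z l)) = 0"
    using lagrange_leading_coeff[OF K inj, of ?p] coeff_eq_0[OF d] by (simp add: poly_prod mult.commute)
  moreover have eq: "transition q Z K k * ((q - 1) * Z k / (Z k - b)) * ((q - 1) * Z k / (Z k - b') - (q - 1)) =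
      q * ((q - 1) * (q * b')) * ((\<Prod>l\<in>K - {m} - {m'}. q * Z k - Z l) / (\<Prod>l\<in>K - {k}. Z k - Z l))"
    if k: "k \<in> K" for k
  proof -
    have "(\<Prod>l\<in>K - {m}. q * Z k - Z l) = q * (Z k - b') * (\<Prod>l\<in>K - {m} - {m'}. q * Z k - Z l)"
      using assms K by (subst prod.remove[of _ m']) (auto simp: algebra_simps)
    moreover have "(q - 1) * Z k / (Z k - b') - (q - 1) = (q - 1) * b' / (Z k - b')"
      using assms(7)[OF k] by (simp add: field_simps)
    ultimately show ?thesis
      using assms(7)[OF k] unfolding transition_removable[OF assms(1) k assms(4) assms(6)[OF k]]
      by simp
  qed
  ultimately show ?thesis
    by (simp only: eq sum_distrib_left[symmetric] mult_zero_right cong: sum.cong)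
qed

text \<open>Here only one of two equal poles is cancelled. Taking \<open>b\<close> as an additional
  node makes the full interpolation sum vanish, so the wanted sum is minus the term at
  \<open>b\<close>, and that term is the transition in row \<open>m\<close> of the diagram without
  the box.\<close>

lemma sum_transition_hdiag2_eq:
  assumes "m \<in> K" "Z m = q * b" "\<And>k. k \<in> K \<Longrightarrow> Z k \<noteq> b"
  shows "(\<Sum>k\<in>K. transition q Z K k * ((q - 1) * Z k / (Z k - b)) *
      ((q - 1) * Z k / (Z k - b) - (q - 1))) = q * transition q (Z(m := b)) K m"
proof -
  let ?p = "\<Prod>l\<in>K - {m}. [:- Z l, q:]"
  \<comment> \<open>\<open>None\<close> is the additional node \<open>b\<close>.\<close>
  let ?Z = "\<lambda>k. case k of None \<Rightarrow> b | Some k \<Rightarrow> Z k"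
  let ?K = "insert None (Some ` K)"
  have b: "b \<noteq> 0" using nz[OF assms(1)] assms(2) by auto
  have c: "card (K - {m}) = card K - 1" "0 < card K" "card ?K = Suc (card K)"
    using assms(1) K by (auto simp: card_gt_0_iff card_image)
  have d: "degree ?p < card K"
    using coeff_prod_linear_factors(1)[of "K - {m}" Z q] K unfolding c(1) using c(2) by simp
  have inj': "inj_on ?Z ?K"
    using inj assms(3) by (auto simp: inj_on_def)
  have "?K - {None} = Some ` K" by auto
  then have none: "(\<Prod>l\<in>?K - {None}. b - ?Z l) = (\<Prod>l\<in>K. b - Z l)"
    by (simp add: prod.reindex)
  have some: "(\<Prod>l\<in>?K - {Some k}. Z k - ?Z l) = (Z k - b) * (\<Prod>l\<in>K - {k}. Z k - Z l)" for k
  proof -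
    have "?K - {Some k} = insert None (Some ` (K - {k}))" by auto
    then show ?thesis using K by (simp add: prod.reindex)
  qed
  have "(\<Sum>k\<in>?K. poly ?p (?Z k) / (\<Prod>l\<in>?K - {k}. ?Z k - ?Z l)) = 0"
    using lagrange_leading_coeff[of ?K ?Z ?p, OF _ inj'] K d coeff_eq_0[OF d] c(3) by simp
  then have "poly ?p b / (\<Prod>l\<in>?K - {None}. b - ?Z l) +
      (\<Sum>k\<in>K. poly ?p (Z k) / (\<Prod>l\<in>?K - {Some k}. Z k - ?Z l)) = 0"
    using K by (simp add: sum.reindex)
  then have sum: "(\<Sum>k\<in>K. poly ?p (Z k) / ((Z k - b) * (\<Prod>l\<in>K - {k}. Z k - Z l))) =
      - (poly ?p b / (\<Prod>l\<in>K. b - Z l))"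
    unfolding none some by (simp add: eq_neg_iff_add_eq_0 add.commute)
  have eq: "transition q Z K k * ((q - 1) * Z k / (Z k - b)) * ((q - 1) * Z k / (Z k - b) - (q - 1)) =
      q * ((q - 1) * b) * (poly ?p (Z k) / ((Z k - b) * (\<Prod>l\<in>K - {k}. Z k - Z l)))"
    if k: "k \<in> K" for k
  proof -
    have "(q - 1) * Z k / (Z k - b) - (q - 1) = (q - 1) * b / (Z k - b)"
      using assms(3)[OF k] by (simp add: field_simps)
    then show ?thesis
      unfolding transition_removable[OF assms(1) k assms(2) assms(3)[OF k]]
      by (simp add: poly_prod mult.commute)
  qed
  then have "(\<Sum>k\<in>K. transition q Z K k * ((q - 1) * Z k / (Z k - b)) *
      ((q - 1) * Z k / (Z k - b) - (q - 1))) = q * ((q - 1) * b) * (- (poly ?p b / (\<Prod>l\<in>K. b - Z l)))"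
    by (simp only: eq sum_distrib_left[symmetric] sum cong: sum.cong)
  also have "(\<Prod>l\<in>K. b - Z l) = (b - q * b) * (\<Prod>l\<in>K - {m}. b - Z l)"
    using assms(1,2) K by (simp add: prod.remove)
  also have "b - q * b = - ((q - 1) * b)"
    by (simp add: algebra_simps)
  also have "q * ((q - 1) * b) * (- (poly ?p b / (- ((q - 1) * b) * (\<Prod>l\<in>K - {m}. b - Z l)))) =
      q * (poly ?p b / (\<Prod>l\<in>K - {m}. b - Z l))"
    using b q by simp
  also have "poly ?p b / (\<Prod>l\<in>K - {m}. b - Z l) = transition q (Z(m := b)) K m"
    by (simp add: transition_def prod_dividef poly_prod mult.commute)
  finally show ?thesis .
qed

text \<open>For the rows other than \<open>m\<close>, the two off-diagonal coefficients exchange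
  exactly the factor of row \<open>m\<close>, from node \<open>q * b\<close> to node
  \<open>b\<close>, up to \<open>q\<close>.\<close>

lemma transition_hoff:
  assumes "m \<in> K" "k \<in> K" "k \<noteq> m" "Z m = q * b" "Z k \<noteq> b"
  shows "transition q Z K k * ((1 + (q - 1) * Z k / (Z k - b)) * (1 + (q - 1) * b / (b - Z k))) =
    q * transition q (Z(m := b)) K k"
proof -
  have ne: "Z k - b \<noteq> 0" "Z k - q * b \<noteq> 0"
    using assms inj unfolding inj_on_def by auto
  let ?R = "\<Prod>l\<in>K - {k} - {m}. (q * Z k - Z l) / (Z k - Z l)"
  have 1: "transition q Z K k = q * (Z k - b) / (Z k - q * b) * ?R"
    using assms K unfolding transition_def by (subst prod.remove[of _ m]) (auto simp: right_diff_distrib)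
  have 2: "transition q (Z(m := b)) K k = (q * Z k - b) / (Z k - b) * ?R"
    using assms K unfolding transition_def by (subst prod.remove[of _ m]) (auto intro!: prod.cong)
  have 3: "1 + (q - 1) * b / (b - Z k) = (Z k - q * b) / (Z k - b)"
    using ne by (subst minus_diff_eq[of "Z k" b, symmetric]) (simp add: field_simps del: minus_diff_eq)
  have 4: "1 + (q - 1) * Z k / (Z k - b) = (q * Z k - b) / (Z k - b)"
    using ne by (simp add: field_simps)
  show ?thesis
    unfolding 1 2 3 4 using ne by simp
qed

end

section \<open>Vandermonde determinants\<close>

definition vandermonde :: "nat \<Rightarrow> (nat \<Rightarrow> 'a :: field) \<Rightarrow> 'a" where
  "vandermonde k y = det (mat k k (\<lambda>(i, j). y j ^ i))"

text \<open>A kernel vector of the transposed matrix would be the coefficient vector of a nonzero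
  polynomial of degree below \<open>k\<close> with \<open>k\<close> roots.\<close>

lemma vandermonde_nonzero:
  assumes "inj_on y {..<k}"
  shows "vandermonde k y \<noteq> 0"
proof
  assume "vandermonde k y = 0"
  define M where "M = mat k k (\<lambda>(i, j). y i ^ j)"
  have M: "M \<in> carrier_mat k k" by (simp add: M_def)
  have "mat k k (\<lambda>(i, j). y j ^ i) = transpose_mat M"
    by (intro eq_matI) (auto simp: M_def)
  then have "det M = 0"
    using \<open>vandermonde k y = 0\<close> det_transpose[OF M] by (simp add: vandermonde_def)
  then obtain v where v: "v \<in> carrier_vec k" "v \<noteq> 0\<^sub>v k" "M *\<^sub>v v = 0\<^sub>v k"
    using det_0_iff_vec_prod_zero_field[OF M] by blast
  define p where "p = (\<Sum>j<k. monom (v $ j) j)"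
  have coeff: "coeff p j = (if j < k then v $ j else 0)" for j
    by (simp add: p_def coeff_sum)
  have "poly p (y i) = 0" if i: "i < k" for i
  proof -
    have "poly p (y i) = (\<Sum>j<k. y i ^ j * v $ j)"
      by (simp add: p_def poly_sum poly_monom mult.commute)
    also have "\<dots> = (M *\<^sub>v v) $ i"
      using i v(1) by (auto simp: M_def scalar_prod_def lessThan_atLeast0 intro!: sum.cong)
    finally show ?thesis using v(3) i by simp
  qed
  moreover have "k > 0"
    using v(1,2) by (metis carrier_vecD gr0I vec_of_dim_0)
  then have "degree p < k"
    by (intro degree_lessI) (auto simp: coeff)
  ultimately have "p = 0"
    using assms \<open>k > 0\<close> card_image[OF assms] by (intro poly_eqI_degree[of "y ` {..<k}"]) auto
  then have "v = 0\<^sub>v k"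
    using v(1) coeff by (intro eq_vecI) (auto, metis coeff_0)
  then show False using v(2) by simp
qed

text \<open>As a function of the node \<open>m\<close> alone the determinant is a polynomial of
  degree below \<open>k\<close> that vanishes at all other nodes, hence proportional to
  \<open>R\<close>. The cross-multiplied form also covers values of \<open>v\<close> that coincide
  with a node.\<close>

lemma vandermonde_update:
  assumes "m < k" "inj_on y ({..<k} - {m})"
  shows "vandermonde k (y(m := u)) * (\<Prod>l\<in>{..<k} - {m}. v - y l) =
    vandermonde k (y(m := v)) * (\<Prod>l\<in>{..<k} - {m}. u - y l)"
proof -
  define M where "M u = mat k k (\<lambda>(i, j). (y(m := u)) j ^ i)" for u
  have M: "M u \<in> carrier_mat k k" for u by (simp add: M_def)
  define c where "c i = cofactor (M 0) i m" for i
  have del: "mat_delete (M u) i m = mat_delete (M 0) i m" for u i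
    by (intro eq_matI) (auto simp: mat_delete_def M_def)
  have cof: "cofactor (M u) i m = c i" for u i
    unfolding c_def cofactor_def del[of u] by (rule refl)
  define p where "p = (\<Sum>i<k. monom (c i) i)"
  have p: "poly p u = vandermonde k (y(m := u))" for u
  proof -
    have "vandermonde k (y(m := u)) = (\<Sum>i<k. M u $$ (i, m) * cofactor (M u) i m)"
      unfolding vandermonde_def M_def[symmetric] by (rule laplace_expansion_column[OF M assms(1)])
    also have "\<dots> = (\<Sum>i<k. u ^ i * c i)"
      unfolding cof using assms(1) by (intro sum.cong) (auto simp: M_def)
    finally show ?thesis by (simp add: p_def poly_sum poly_monom mult.commute)
  qed
  define R where "R = (\<Prod>l\<in>{..<k} - {m}. [:- y l, 1:])"
  have R: "poly R u = (\<Prod>l\<in>{..<k} - {m}. u - y l)" for u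
    by (simp add: R_def poly_prod)
  have "degree R \<le> card ({..<k} - {m})"
    unfolding R_def by (rule coeff_prod_linear_factors) simp
  then have deg: "degree R < k" "degree p < k"
    using assms(1) by (auto simp: p_def coeff_sum intro!: degree_lessI)
  have zero: "poly p (y l) = 0" "poly R (y l) = 0" if "l \<in> {..<k} - {m}" for l
  proof -
    have "col (M (y l)) l = col (M (y l)) m"
      by (rule eq_vecI) (use that assms(1) in \<open>auto simp: M_def\<close>)
    then have "det (M (y l)) = 0"
      using that assms(1) M by (intro det_identical_columns[of _ k l m]) auto
    then show "poly p (y l) = 0"
      unfolding p vandermonde_def M_def .
    show "poly R (y l) = 0"
      unfolding R using that by (intro prod_zero) auto
  qed
  have "poly p u * poly R v = poly p v * poly R u"
  proof (cases "v \<in> y ` ({..<k} - {m})")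
    case True
    then obtain l where "l \<in> {..<k} - {m}" "v = y l" by blast
    then show ?thesis using zero[of l] by simp
  next
    case False
    have "card (insert v (y ` ({..<k} - {m}))) = k"
      using False assms card_image[OF assms(2)] by simp
    moreover have "poly (smult (poly R v) p) x = poly (smult (poly p v) R) x"
      if x: "x \<in> insert v (y ` ({..<k} - {m}))" for x
    proof (cases "x = v")
      case False
      then obtain l where "l \<in> {..<k} - {m}" "x = y l" using x by blast
      then show ?thesis using zero[of l] by simp
    qed (simp add: mult.commute)
    ultimately have "smult (poly R v) p = smult (poly p v) R"
      using deg by (intro poly_eqI_degree[of "insert v (y ` ({..<k} - {m}))"])
        (auto intro: le_less_trans[OF degree_smult_le])
    from arg_cong[OF this, of "\<lambda>p. poly p u"] show ?thesis by (simp add: mult.commute)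
  qed
  then show ?thesis by (simp add: p R)
qed


section \<open>Diagrams and their rows\<close>

definition row_length :: "box set \<Rightarrow> component \<Rightarrow> nat \<Rightarrow> nat" where
  "row_length S c i = card {j. (c, i, j) \<in> S}"

lemma down_set_eq_lessThan_card:
  fixes T :: "nat set"
  assumes "finite T" "\<And>j j'. j' \<in> T \<Longrightarrow> j \<le> j' \<Longrightarrow> j \<in> T"
  shows "T = {..<card T}"
proof -
  define n where "n = (LEAST n. n \<notin> T)"
  have "\<exists>n. n \<notin> T" using ex_new_if_finite[OF infinite_UNIV_nat assms(1)] .
  then have n: "n \<notin> T"
    unfolding n_def by (rule LeastI_ex)
  have "j \<in> T" if "j < n" for j
    using not_less_Least[of j "\<lambda>n. n \<notin> T"] that by (simp add: n_def)
  moreover have "j < n" if "j \<in> T" for j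
    using assms(2)[OF that, of n] n by (cases "j < n") auto
  ultimately have "T = {..<n}" by blast
  then show ?thesis by simp
qed

definition diagram :: "box set \<Rightarrow> bool" where
  "diagram S \<longleftrightarrow> finite S \<and> down_closed S"

lemma diagram_paths: "\<sigma> \<in> paths n \<Longrightarrow> diagram (set \<sigma>)"
  by (simp add: diagram_def paths_down_closed)

lemma finite_row:
  assumes "finite S"
  shows "finite {j. (c, i, j) \<in> S}" "finite {i. (c, i, j) \<in> S}"
proof -
  have "finite ((\<lambda>j. (c, i, j)) -` S)" "finite ((\<lambda>i. (c, i, j)) -` S)"
    using assms by (intro finite_vimageI; simp add: inj_on_def)+
  then show "finite {j. (c, i, j) \<in> S}" "finite {i. (c, i, j) \<in> S}"
    by (simp_all add: vimage_def)
qed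

lemma mem_diagram_iff:
  assumes "diagram S"
  shows "(c, i, j) \<in> S \<longleftrightarrow> j < row_length S c i"
proof -
  have "{j. (c, i, j) \<in> S} = {..<row_length S c i}"
    unfolding row_length_def using assms
    by (intro down_set_eq_lessThan_card) (auto simp: diagram_def finite_row intro: down_closedD)
  then show ?thesis by auto
qed

lemma row_length_antimono:
  assumes "diagram S" "i \<le> i'"
  shows "row_length S c i' \<le> row_length S c i"
  unfolding row_length_def using assms
  by (intro card_mono) (auto simp: diagram_def finite_row intro: down_closedD)

text \<open>Meaningful for every row, whether or not the box can be added: all rows have to serve as
  interpolation nodes.\<close>

definition corner :: "box set \<Rightarrow> component \<times> nat \<Rightarrow> box" where
  "corner S k = (fst k, snd k, row_length S (fst k) (snd k))"

definition addable_row :: "box set \<Rightarrow> component \<times> nat \<Rightarrow> bool" where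
  "addable_row S k \<longleftrightarrow> snd k = 0 \<or> row_length S (fst k) (snd k) < row_length S (fst k) (snd k - 1)"

lemma addable_eq_corners:
  assumes "diagram S"
  shows "addable S = corner S ` {k. addable_row S k}"
proof (intro Set.set_eqI iffI)
  fix b assume b: "b \<in> addable S"
  obtain c i j where [simp]: "b = (c, i, j)" by (cases b)
  have 1: "(c, i, j) \<notin> S" "down_closed (insert (c, i, j) S)"
    using b by (auto simp: addable_def)
  have "(c, i, row_length S c i) \<notin> S" by (simp add: mem_diagram_iff[OF assms])
  then have j: "j = row_length S c i"
    using down_closedD[OF 1(2), of c i j i "row_length S c i"] 1(1)
    by (simp add: mem_diagram_iff[OF assms])
  have "row_length S c i < row_length S c (i - 1)" if "i \<noteq> 0"
    using down_closedD[OF 1(2), of c i j "i - 1" j] that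
    by (auto simp: mem_diagram_iff[OF assms] j)
  then have "addable_row S (c, i)" by (auto simp: addable_row_def)
  then show "b \<in> corner S ` {k. addable_row S k}"
    by (intro image_eqI[of _ _ "(c, i)"]) (auto simp: corner_def j)
next
  fix b assume "b \<in> corner S ` {k. addable_row S k}"
  then obtain c i where b: "b = (c, i, row_length S c i)" and add: "addable_row S (c, i)"
    by (auto simp: corner_def)
  have "(d, u, v) \<in> insert b S" if *: "(d, u', v') \<in> insert b S" "u \<le> u'" "v \<le> v'" for d u v u' v'
  proof (cases "(d, u', v') = b")
    case True
    then have d: "d = c" "u \<le> i" "v \<le> row_length S c i" using * b by auto
    show ?thesis
    proof (cases "u = i")
      case False
      then have "row_length S c i < row_length S c (i - 1)" "row_length S c (i - 1) \<le> row_length S c u"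
        using add d row_length_antimono[OF assms, of u "i - 1" c] by (auto simp: addable_row_def)
      then show ?thesis using d by (simp add: mem_diagram_iff[OF assms])
    qed (use d b in \<open>auto simp: mem_diagram_iff[OF assms]\<close>)
  next
    case False
    then show ?thesis using * assms down_closedD[of S d u' v' u v] by (auto simp: diagram_def)
  qed
  then have "down_closed (insert b S)" unfolding down_closed_def by blast
  then show "b \<in> addable S"
    using b by (simp add: addable_def mem_diagram_iff[OF assms])
qed

lemma inj_corner: "inj (corner S)"
  by (auto simp: inj_def corner_def)

lemma diagram_insert: "diagram S \<Longrightarrow> b \<in> addable S \<Longrightarrow> diagram (insert b S)"
  by (simp add: diagram_def addable_def)

lemma row_length_insert_corner:
  assumes "diagram S"
  shows "row_length (insert (corner S k) S) c i = (if k = (c, i) then Suc (row_length S c i) else row_length S c i)"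
proof (cases "k = (c, i)")
  case True
  have eq: "{j. (c, i, j) \<in> insert (corner S k) S} = insert (row_length S c i) {j. (c, i, j) \<in> S}"
    by (auto simp: True corner_def)
  have "row_length S c i \<notin> {j. (c, i, j) \<in> S}"
    by (simp add: mem_diagram_iff[OF assms])
  moreover have "finite {j. (c, i, j) \<in> S}"
    using assms by (simp add: diagram_def finite_row)
  ultimately have "row_length (insert (corner S k) S) c i = Suc (card {j. (c, i, j) \<in> S})"
    unfolding row_length_def[of "insert (corner S k) S"] eq by (intro card_insert_disjoint)
  then show ?thesis
    using True by (simp add: row_length_def)
next
  case False
  then have "{j. (c, i, j) \<in> insert (corner S k) S} = {j. (c, i, j) \<in> S}"
    by (cases k) (auto simp: corner_def)
  then show ?thesis using False by (simp add: row_length_def)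
qed

lemma corner_insert_corner:
  assumes "diagram S"
  shows "corner (insert (corner S m) S) k =
    (if k = m then (fst m, snd m, Suc (row_length S (fst m) (snd m))) else corner S k)"
  by (simp add: corner_def[of "insert (corner S m) S"] row_length_insert_corner[OF assms])
    (auto simp: corner_def)

section \<open>Correspondence between diagrams and double partitions\<close>

definition num_rows :: "box set \<Rightarrow> component \<Rightarrow> nat" where
  "num_rows S c = card {i. (c, i, 0) \<in> S}"

lemma row_length_pos_iff:
  assumes "diagram S"
  shows "0 < row_length S c i \<longleftrightarrow> i < num_rows S c"
proof -
  have "{i. (c, i, 0) \<in> S} = {..<num_rows S c}"
    unfolding num_rows_def using assms
    by (intro down_set_eq_lessThan_card) (auto simp: diagram_def finite_row intro: down_closedD)
  then show ?thesis by (auto simp: mem_diagram_iff[OF assms, symmetric])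
qed

definition shape :: "box set \<Rightarrow> double_partition" where
  "shape S = (map (row_length S First) [0..<num_rows S First], map (row_length S Second) [0..<num_rows S Second])"

lemma part_map_row_length:
  assumes "diagram S"
  shows "part (map (row_length S c) [0..<num_rows S c]) i = row_length S c i"
  using row_length_pos_iff[OF assms, of c i] by (auto simp: part_def)

lemma boxes_shape:
  assumes "diagram S"
  shows "boxes (shape S) = S"
proof -
  have "(c, i, j) \<in> boxes (shape S) \<longleftrightarrow> (c, i, j) \<in> S" for c i j
    by (cases c) (auto simp: boxes_def shape_def part_map_row_length[OF assms] mem_diagram_iff[OF assms])
  then show ?thesis by auto
qed

lemma is_partition_map_row_length:
  assumes "diagram S"
  shows "is_partition (map (row_length S c) [0..<num_rows S c])"
proof -
  have "row_length S c i \<noteq> 0" if "i < num_rows S c" for i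
    using row_length_pos_iff[OF assms] that by blast
  then have "0 \<notin> set (map (row_length S c) [0..<num_rows S c])"
    by (auto simp: image_iff)
  then show ?thesis
    using row_length_antimono[OF assms, of _ _ c] by (simp add: is_partition_def sorted_wrt_iff_nth_less)
qed

lemma part_antimono:
  assumes "is_partition \<alpha>" "i \<le> i'"
  shows "part \<alpha> i' \<le> part \<alpha> i"
  using assms by (cases "i = i'") (auto simp: part_def is_partition_def sorted_wrt_iff_nth_less)

lemma part_pos_iff: "is_partition \<alpha> \<Longrightarrow> 0 < part \<alpha> i \<longleftrightarrow> i < length \<alpha>"
  by (auto simp: part_def is_partition_def in_set_conv_nth)

lemma boxes_eq_Sigma: "boxes (\<alpha>, \<beta>) =
    Pair First ` (SIGMA i:{..<length \<alpha>}. {..<\<alpha> ! i}) \<union> Pair Second ` (SIGMA i:{..<length \<beta>}. {..<\<beta> ! i})"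
  by (auto simp: boxes_def part_def split: if_splits)

lemma finite_boxes: "finite (boxes \<mu>)"
  by (cases \<mu>) (simp add: boxes_eq_Sigma)

lemma card_boxes: "card (boxes (\<alpha>, \<beta>)) = sum_list \<alpha> + sum_list \<beta>"
proof -
  have "card (Pair c ` (SIGMA i:{..<length \<alpha>}. {..<\<alpha> ! i})) = sum_list \<alpha>" for c :: component and \<alpha> :: "nat list"
    by (subst card_image) (auto simp: inj_on_def sum_list_sum_nth lessThan_atLeast0)
  then show ?thesis
    unfolding boxes_eq_Sigma by (subst card_Un_disjoint) auto
qed

lemma diagram_boxes:
  assumes "\<mu> \<in> double_partitions n"
  shows "diagram (boxes \<mu>)"
proof -
  obtain \<alpha> \<beta> where \<mu>: "\<mu> = (\<alpha>, \<beta>)" "is_partition \<alpha>" "is_partition \<beta>"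
    using assms by (auto simp: double_partitions_def)
  have "down_closed (boxes \<mu>)"
    unfolding down_closed_def \<mu>(1) boxes_def
    using part_antimono[OF \<mu>(2)] part_antimono[OF \<mu>(3)] by (fastforce intro: le_less_trans less_le_trans)
  then show ?thesis by (simp add: diagram_def finite_boxes)
qed

lemma shape_boxes:
  assumes "\<mu> \<in> double_partitions n"
  shows "shape (boxes \<mu>) = \<mu>"
proof -
  obtain \<alpha> \<beta> where \<mu>: "\<mu> = (\<alpha>, \<beta>)" "is_partition \<alpha>" "is_partition \<beta>"
    using assms by (auto simp: double_partitions_def)
  have "row_length (boxes (\<alpha>, \<beta>)) First i = part \<alpha> i" "row_length (boxes (\<alpha>, \<beta>)) Second i = part \<beta> i" for i
    by (simp_all add: row_length_def boxes_def)
  moreover have "num_rows (boxes (\<alpha>, \<beta>)) First = length \<alpha>" "num_rows (boxes (\<alpha>, \<beta>)) Second = length \<beta>"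
    using part_pos_iff[OF \<mu>(2)] part_pos_iff[OF \<mu>(3)] by (simp_all add: num_rows_def boxes_def)
  moreover have "map (part \<gamma>) [0..<length \<gamma>] = \<gamma>" for \<gamma>
    by (auto simp: part_def intro!: nth_equalityI)
  ultimately show ?thesis
    by (simp add: shape_def \<mu>(1) cong: map_cong)
qed

lemma shape_in_double_partitions:
  assumes "diagram S"
  shows "shape S \<in> double_partitions (card S)"
proof -
  have "sum_list (fst (shape S)) + sum_list (snd (shape S)) = card S"
    using card_boxes[of "fst (shape S)" "snd (shape S)"] boxes_shape[OF assms] by simp
  then show ?thesis
    using is_partition_map_row_length[OF assms] by (auto simp: double_partitions_def shape_def)
qed

text \<open>Standardness compares the positions of two boxes; for a full diagram this amounts to
  every prefix being down-closed.\<close>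

lemma standard_tableaux_eq:
  assumes "\<mu> \<in> double_partitions n"
  shows "standard_tableaux \<mu> = {\<sigma> \<in> paths n. set \<sigma> = boxes \<mu>}"
proof (intro Set.set_eqI iffI)
  fix \<sigma> assume \<sigma>: "\<sigma> \<in> standard_tableaux \<mu>"
  then have d: "distinct \<sigma>" "set \<sigma> = boxes \<mu>"
    and std: "\<And>c i j i' j' k l. k < length \<sigma> \<Longrightarrow> l < length \<sigma> \<Longrightarrow> \<sigma> ! k = (c, i, j) \<Longrightarrow> \<sigma> ! l = (c, i', j') \<Longrightarrow>
           i \<le> i' \<Longrightarrow> j \<le> j' \<Longrightarrow> k \<le> l"
    unfolding standard_tableaux_def by blast+
  have len: "length \<sigma> = n"
    using distinct_card[OF d(1)] card_boxes[of "fst \<mu>" "snd \<mu>"] assms d(2)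
    by (auto simp: double_partitions_def)
  have "down_closed (set (take k \<sigma>))" for k
    unfolding down_closed_def
  proof (intro allI impI, elim conjE)
    fix c i j i' j' assume *: "(c, i', j') \<in> set (take k \<sigma>)" "i \<le> i'" "j \<le> j'"
    then obtain l where l: "l < length \<sigma>" "l < k" "\<sigma> ! l = (c, i', j')"
      by (auto simp: in_set_conv_nth)
    have "(c, i', j') \<in> boxes \<mu>" using l d(2) by (metis nth_mem)
    then have "(c, i, j) \<in> set \<sigma>"
      using diagram_boxes[OF assms] * d(2) by (auto simp: diagram_def intro: down_closedD)
    then obtain m where m: "m < length \<sigma>" "\<sigma> ! m = (c, i, j)" by (auto simp: in_set_conv_nth)
    have "m \<le> l" using std[OF m(1) l(1) m(2) l(3)] * by simp
    then show "(c, i, j) \<in> set (take k \<sigma>)"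
      using m l by (auto simp: in_set_conv_nth intro!: exI[of _ m])
  qed
  then show "\<sigma> \<in> {\<sigma> \<in> paths n. set \<sigma> = boxes \<mu>}"
    using d len by (simp add: paths_def)
next
  fix \<sigma> assume *: "\<sigma> \<in> {\<sigma> \<in> paths n. set \<sigma> = boxes \<mu>}"
  have "k \<le> l" if kl: "k < length \<sigma>" "l < length \<sigma>" "\<sigma> ! k = (c, i, j)" "\<sigma> ! l = (c, i', j')" "i \<le> i'" "j \<le> j'"
    for c i j i' j' k l
  proof -
    have "down_closed (set (take (Suc l) \<sigma>))" using * by (simp add: paths_def)
    moreover have "(c, i', j') \<in> set (take (Suc l) \<sigma>)"
      using that by (auto simp: in_set_conv_nth intro!: exI[of _ l])
    ultimately have "(c, i, j) \<in> set (take (Suc l) \<sigma>)"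
      using that down_closedD by blast
    then obtain m where "m < Suc l" "m < length \<sigma>" "\<sigma> ! m = \<sigma> ! k"
      using kl by (auto simp: in_set_conv_nth)
    then show ?thesis
      using * kl(1) by (auto simp: paths_def nth_eq_iff_index_eq)
  qed
  then show "\<sigma> \<in> standard_tableaux \<mu>"
    using * unfolding standard_tableaux_def by (auto simp: paths_distinct)
qed

lemma finite_paths: "finite (paths n)"
proof -
  have "finite {\<sigma>. set \<sigma> \<subseteq> S \<and> length \<sigma> = n}" if "finite S" for S :: "box set"
    using finite_lists_length_eq[OF that] .
  moreover have "paths n \<subseteq> (\<Union>\<mu>\<in>double_partitions n. {\<sigma>. set \<sigma> \<subseteq> boxes \<mu> \<and> length \<sigma> = n})"
  proof
    fix \<sigma> assume \<sigma>: "\<sigma> \<in> paths n"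
    then have "shape (set \<sigma>) \<in> double_partitions n"
      using shape_in_double_partitions[OF diagram_paths] by (metis paths_card)
    moreover have "boxes (shape (set \<sigma>)) = set \<sigma>"
      using \<sigma> by (intro boxes_shape diagram_paths)
    ultimately show "\<sigma> \<in> (\<Union>\<mu>\<in>double_partitions n. {\<sigma>. set \<sigma> \<subseteq> boxes \<mu> \<and> length \<sigma> = n})"
      using \<sigma> by (auto simp: paths_length intro!: bexI[of _ "shape (set \<sigma>)"])
  qed
  ultimately show ?thesis
    using finite_boxes finite_double_partitions[of n] by (meson finite_UN_I finite_subset)
qed

section \<open>The weights as a Markov chain on diagrams\<close>

definition diagram_rows :: "nat \<Rightarrow> nat \<Rightarrow> (component \<times> nat) set" where
  "diagram_rows r1 r2 = Pair First ` {..<r1} \<union> Pair Second ` {..<r2}"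

text \<open>The nodes \<open>Z_k\<close> of the overview.\<close>

definition row_content :: "box set \<Rightarrow> component \<times> nat \<Rightarrow> ratfun" where
  "row_content S k = wcontent (corner S k)"

definition set_weight :: "nat \<Rightarrow> nat \<Rightarrow> box set \<Rightarrow> ratfun" where
  "set_weight r1 r2 S = weight r1 r2 (shape S)"

definition fits :: "nat \<Rightarrow> nat \<Rightarrow> box set \<Rightarrow> bool" where
  "fits r1 r2 S \<longleftrightarrow> num_rows S First \<le> r1 \<and> num_rows S Second \<le> r2"

definition qexponents :: "nat \<Rightarrow> (nat \<Rightarrow> nat) \<Rightarrow> nat \<Rightarrow> ratfun" where
  "qexponents k A j = qvar ^ (A j + (k - 1 - j))"

definition schur_quotient :: "nat \<Rightarrow> (nat \<Rightarrow> nat) \<Rightarrow> ratfun" where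
  "schur_quotient k A = vandermonde k (qexponents k A) / vandermonde k (qexponents k (\<lambda>j. 0))"

definition mixed_factor :: "(nat \<Rightarrow> nat) \<Rightarrow> (nat \<Rightarrow> nat) \<Rightarrow> nat \<Rightarrow> nat \<Rightarrow> ratfun" where
  "mixed_factor A B i j = (1 + Qvar * qvar powi (int (A i) - int (B j) + int j - int i)) /
      (1 + Qvar * qvar powi (int j - int i))"

text \<open>The weight in terms of row lengths padded by zeros, so that adding a box becomes a
  function update.\<close>

definition row_weight :: "nat \<Rightarrow> nat \<Rightarrow> (nat \<Rightarrow> nat) \<Rightarrow> (nat \<Rightarrow> nat) \<Rightarrow> ratfun" where
  "row_weight r1 r2 A B = qvar ^ (r1 * (\<Sum>j<r2. B j)) *
     (schur_quotient r1 A * schur_quotient r2 B /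
       ((1 - qvar ^ (r1 + r2)) / (1 - qvar)) ^ ((\<Sum>i<r1. A i) + (\<Sum>j<r2. B j))) *
     (\<Prod>i<r1. \<Prod>j<r2. mixed_factor A B i j)"

lemma finite_diagram_rows [simp]: "finite (diagram_rows r1 r2)"
  by (simp add: diagram_rows_def)

lemma card_diagram_rows [simp]: "card (diagram_rows r1 r2) = r1 + r2"
  unfolding diagram_rows_def by (subst card_Un_disjoint) (auto simp: card_image inj_on_def)

lemma mem_diagram_rows_iff: "(First, i) \<in> diagram_rows r1 r2 \<longleftrightarrow> i < r1" "(Second, i) \<in> diagram_rows r1 r2 \<longleftrightarrow> i < r2"
  by (auto simp: diagram_rows_def)

lemma row_content_First: "row_content S (First, i) = Qvar * qvar powi (int (row_length S First i) - int i)"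
  and row_content_Second: "row_content S (Second, i) = - (qvar powi (int (row_length S Second i) - int i))"
  by (simp_all add: row_content_def corner_def)

lemma inj_row_content:
  assumes "diagram S"
  shows "inj (row_content S)"
proof (rule injI)
  fix k k' assume *: "row_content S k = row_content S k'"
  obtain c i c' i' where [simp]: "k = (c, i)" "k' = (c', i')" by (cases k; cases k')
  have "c = c'" "int (row_length S c i) - int i = int (row_length S c i') - int i'"
    using * by (auto simp: row_content_def corner_def wcontent_eq_iff)
  then show "k = k'"
    using row_length_antimono[OF assms, of i i' c] row_length_antimono[OF assms, of i' i c]
    by (cases "i \<le> i'") auto
qed

lemma row_content_nonzero: "row_content S k \<noteq> 0"
  by (simp add: row_content_def wcontent_nonzero)

lemma row_content_insert_corner:
  assumes "diagram S"
  shows "row_content (insert (corner S m) S) = (row_content S)(m := qvar * row_content S m)"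
proof
  fix k :: "component \<times> nat"
  obtain c i where [simp]: "k = (c, i)" by (cases k)
  have "corner (insert (corner S m) S) k =
      (c, i, if m = (c, i) then Suc (row_length S c i) else row_length S c i)"
    by (simp add: corner_def[of "insert (corner S m) S"] row_length_insert_corner[OF assms])
  then show "row_content (insert (corner S m) S) k = ((row_content S)(m := qvar * row_content S m)) k"
    using wcontent_eq_mult_qvar_iff[of c i "Suc (row_length S c i)" c i "row_length S c i"]
    by (auto simp: row_content_def) (auto simp: corner_def)
qed

text \<open>At \<open>x_i = q^i\<close> the entry \<open>x_i ^ e_j\<close> equals
  \<open>(q ^ e_j) ^ i\<close>, so the alternant is a Vandermonde determinant in the quantities
  \<open>q ^ e_j\<close>. Adding a box then changes a single node.\<close>

lemma schur_principal:
  assumes "length \<alpha> \<le> k"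
  shows "schur k \<alpha> (\<lambda>i. qvar ^ i) = schur_quotient k (part \<alpha>)"
proof -
  have "mat k k (\<lambda>(i, j). (qvar ^ i) ^ (A j + (k - 1 - j))) = mat k k (\<lambda>(i, j). qexponents k A j ^ i)" for A
    by (intro eq_matI) (auto simp: qexponents_def mult.commute simp flip: power_mult)
  from this[of "part \<alpha>"] this[of "\<lambda>j. 0"] show ?thesis
    using assms by (simp add: schur_def schur_quotient_def vandermonde_def)
qed

lemma sum_list_row_lengths:
  assumes "diagram S" "num_rows S c \<le> r"
  shows "sum_list (map (row_length S c) [0..<num_rows S c]) = (\<Sum>i<r. row_length S c i)"
proof -
  have "sum_list (map (row_length S c) [0..<num_rows S c]) = (\<Sum>i<num_rows S c. row_length S c i)"
    by (simp add: interv_sum_list_conv_sum_set_nat atLeast0LessThan)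
  also have "\<dots> = (\<Sum>i<r. row_length S c i)"
  proof (intro sum.mono_neutral_left ballI)
    fix i assume "i \<in> {..<r} - {..<num_rows S c}"
    then show "row_length S c i = 0"
      using row_length_pos_iff[OF assms(1), of c i] by simp
  qed (use assms(2) in auto)
  finally show ?thesis .
qed

lemma set_weight_fits:
  assumes "diagram S" "fits r1 r2 S"
  shows "set_weight r1 r2 S = row_weight r1 r2 (row_length S First) (row_length S Second)"
  using assms sum_list_row_lengths[OF assms(1), of First r1] sum_list_row_lengths[OF assms(1), of Second r2]
  by (simp add: set_weight_def weight_def shape_def row_weight_def fits_def schur_principal
      part_map_row_length mixed_factor_def part_map_row_length[OF assms(1), abs_def])

lemma set_weight_not_fits:
  assumes "\<not> fits r1 r2 S"
  shows "set_weight r1 r2 S = 0"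
  using assms by (auto simp: set_weight_def weight_def shape_def schur_def fits_def)

lemma set_weight_empty: "set_weight r1 r2 {} = 1"
proof -
  have "inj_on (qexponents k (\<lambda>j. 0)) {..<k}" for k
  proof (rule inj_onI)
    fix i j assume *: "i \<in> {..<k}" "j \<in> {..<k}" "qexponents k (\<lambda>j. 0) i = qexponents k (\<lambda>j. 0) j"
    then have "k - 1 - i = k - 1 - j"
      by (simp add: qexponents_def qvar_power_eq_iff)
    then show "i = j" using * by auto
  qed
  then have "schur_quotient k (\<lambda>i. 0) = 1" for k
    by (simp add: schur_quotient_def vandermonde_nonzero)
  moreover have "1 + Qvar * qvar powi m \<noteq> 0" for m
    using Qvar_qvar_powi_add_nonzero[of m 0] by (simp add: add.commute)
  moreover have "row_length {} c = (\<lambda>i. 0)" for c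
    by (simp add: row_length_def fun_eq_iff)
  ultimately show ?thesis
    using set_weight_fits[of "{}" r1 r2]
    by (simp add: diagram_def fits_def num_rows_def row_weight_def mixed_factor_def)
qed

section \<open>Change of the weights when a box is added\<close>

lemma schur_quotient_update:
  assumes "m < k" "inj_on (qexponents k A) {..<k}"
  shows "schur_quotient k (A(m := Suc (A m))) = schur_quotient k A *
    (\<Prod>l\<in>{..<k} - {m}. (qvar * qexponents k A m - qexponents k A l) / (qexponents k A m - qexponents k A l))"
proof -
  let ?y = "qexponents k A"
  have "inj_on ?y ({..<k} - {m})" using assms(2) by (auto simp: inj_on_def)
  \<comment> \<open>Lengthening row \<open>m\<close> by one multiplies its node by
    \<open>q\<close>.\<close>
  from vandermonde_update[OF assms(1) this, of "qvar * ?y m" "?y m"]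
  have "vandermonde k (?y(m := qvar * ?y m)) * (\<Prod>l\<in>{..<k} - {m}. ?y m - ?y l) =
      vandermonde k ?y * (\<Prod>l\<in>{..<k} - {m}. qvar * ?y m - ?y l)"
    by simp
  moreover have "?y(m := qvar * ?y m) = qexponents k (A(m := Suc (A m)))"
    by (auto simp: qexponents_def fun_eq_iff)
  moreover have "(\<Prod>l\<in>{..<k} - {m}. ?y m - ?y l) \<noteq> 0"
    using assms by (auto simp: inj_on_def)
  ultimately have "vandermonde k (qexponents k (A(m := Suc (A m)))) = vandermonde k ?y *
      ((\<Prod>l\<in>{..<k} - {m}. qvar * ?y m - ?y l) / (\<Prod>l\<in>{..<k} - {m}. ?y m - ?y l))"
    by (simp add: field_simps)
  then show ?thesis
    by (simp add: schur_quotient_def prod_dividef)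
qed

lemma qexponents_powi:
  assumes "i < k"
  shows "qexponents k A i = qvar powi (int k - 1) * qvar powi (int (A i) - int i)"
proof -
  have "qexponents k A i = qvar powi (int (A i + (k - 1 - i)))"
    unfolding qexponents_def power_int_of_nat ..
  also have "int (A i + (k - 1 - i)) = (int k - 1) + (int (A i) - int i)"
    using assms by (simp add: of_nat_diff)
  finally show ?thesis by (simp add: power_int_add qvar_nonzero)
qed

text \<open>Within one component the nodes are the row contents up to a common factor, which cancels
  in the ratios.\<close>

lemma qexponents_row_content:
  assumes "i < k"
  shows "qexponents k (row_length S c) i =
    (case c of First \<Rightarrow> inverse Qvar | Second \<Rightarrow> - 1) * qvar powi (int k - 1) * row_content S (c, i)"
  using assms by (cases c) (simp_all add: qexponents_powi row_content_First row_content_Second Qvar_nonzero)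

lemma schur_quotient_insert_corner:
  assumes "diagram S" "m < k"
  shows "schur_quotient k ((row_length S c)(m := Suc (row_length S c m))) = schur_quotient k (row_length S c) *
    (\<Prod>l\<in>{..<k} - {m}. (qvar * row_content S (c, m) - row_content S (c, l)) /
      (row_content S (c, m) - row_content S (c, l)))"
proof -
  define C where "C = (case c of First \<Rightarrow> inverse Qvar | Second \<Rightarrow> - 1) * qvar powi (int k - 1)"
  have C: "C \<noteq> 0" by (cases c) (simp_all add: C_def qvar_nonzero Qvar_nonzero)
  have eq: "qexponents k (row_length S c) i = C * row_content S (c, i)" if "i < k" for i
    using qexponents_row_content[OF that] by (simp add: C_def)
  have "inj_on (qexponents k (row_length S c)) {..<k}"
    using inj_row_content[OF assms(1)] by (auto simp: inj_on_def eq C)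
  note update = schur_quotient_update[OF assms(2) this]
  have "(qvar * qexponents k (row_length S c) m - qexponents k (row_length S c) l) /
      (qexponents k (row_length S c) m - qexponents k (row_length S c) l) =
      (qvar * row_content S (c, m) - row_content S (c, l)) / (row_content S (c, m) - row_content S (c, l))"
    if "l < k" for l
  proof -
    have "qvar * qexponents k (row_length S c) m - qexponents k (row_length S c) l =
        C * (qvar * row_content S (c, m) - row_content S (c, l))"
      "qexponents k (row_length S c) m - qexponents k (row_length S c) l =
        C * (row_content S (c, m) - row_content S (c, l))"
      using assms(2) that by (simp_all add: eq algebra_simps)
    then show ?thesis using C by simp
  qed
  then have "(\<Prod>l\<in>{..<k} - {m}. (qvar * qexponents k (row_length S c) m - qexponents k (row_length S c) l) /
      (qexponents k (row_length S c) m - qexponents k (row_length S c) l)) =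
      (\<Prod>l\<in>{..<k} - {m}. (qvar * row_content S (c, m) - row_content S (c, l)) /
        (row_content S (c, m) - row_content S (c, l)))"
    by (intro prod.cong) auto
  then show ?thesis
    unfolding update by (simp only:)
qed

lemma one_add_Qvar_nonzero: "1 + Qvar * qvar powi m \<noteq> 0"
  using Qvar_qvar_powi_add_nonzero[of m 0] by (simp add: add.commute)

lemma mixed_factor_First:
  fixes S :: "box set"
  defines "A \<equiv> row_length S First" and "B \<equiv> row_length S Second"
  shows "mixed_factor (A(m := Suc (A m))) B m j = mixed_factor A B m j *
    ((qvar * row_content S (First, m) - row_content S (Second, j)) /
      (row_content S (First, m) - row_content S (Second, j)))"
proof -
  define e where "e = int (A m) - int (B j) + int j - int m"
  define d where "d = int (B j) - int j"
  have a: "int (A m) - int m = e + d" by (simp add: e_def d_def)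
  have "mixed_factor (A(m := Suc (A m))) B m j =
      (1 + Qvar * qvar powi (e + 1)) / (1 + Qvar * qvar powi (int j - int m))"
    "mixed_factor A B m j = (1 + Qvar * qvar powi e) / (1 + Qvar * qvar powi (int j - int m))"
    by (simp_all add: mixed_factor_def e_def algebra_simps)
  moreover have "qvar * row_content S (First, m) - row_content S (Second, j) =
      qvar powi d * (1 + Qvar * qvar powi (e + 1))"
    unfolding row_content_First row_content_Second A_def[symmetric] B_def[symmetric] a d_def[symmetric]
    by (simp add: power_int_add qvar_nonzero algebra_simps)
  moreover have "row_content S (First, m) - row_content S (Second, j) = qvar powi d * (1 + Qvar * qvar powi e)"
    unfolding row_content_First row_content_Second A_def[symmetric] B_def[symmetric] a d_def[symmetric]
    by (simp add: power_int_add qvar_nonzero algebra_simps)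
  ultimately show ?thesis
    using one_add_Qvar_nonzero[of e] qvar_nonzero
    by simp
qed

text \<open>In contrast to the first component a factor \<open>q\<close> appears for each row
  \<open>i\<close>. Over all \<open>r1\<close> rows these factors are supplied by the prefactor
  \<open>q^(r1 |\<beta>|)\<close> of the weight.\<close>

lemma mixed_factor_Second:
  fixes S :: "box set"
  defines "A \<equiv> row_length S First" and "B \<equiv> row_length S Second"
  shows "qvar * mixed_factor A (B(m := Suc (B m))) i m = mixed_factor A B i m *
    ((qvar * row_content S (Second, m) - row_content S (First, i)) /
      (row_content S (Second, m) - row_content S (First, i)))"
proof -
  define e where "e = int (A i) - int (B m) + int m - int i"
  define d where "d = int (B m) - int m"
  have a: "int (A i) - int i = e + d" by (simp add: e_def d_def)
  have "mixed_factor A (B(m := Suc (B m))) i m =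
      (1 + Qvar * qvar powi (e - 1)) / (1 + Qvar * qvar powi (int m - int i))"
    "mixed_factor A B i m = (1 + Qvar * qvar powi e) / (1 + Qvar * qvar powi (int m - int i))"
    by (simp_all add: mixed_factor_def e_def algebra_simps)
  moreover have "qvar * row_content S (Second, m) - row_content S (First, i) =
      - (qvar powi d) * (qvar * (1 + Qvar * qvar powi (e - 1)))"
    unfolding row_content_First row_content_Second A_def[symmetric] B_def[symmetric] a d_def[symmetric]
    by (simp add: power_int_add power_int_diff qvar_nonzero algebra_simps)
  moreover have "row_content S (Second, m) - row_content S (First, i) = - (qvar powi d) * (1 + Qvar * qvar powi e)"
    unfolding row_content_First row_content_Second A_def[symmetric] B_def[symmetric] a d_def[symmetric]
    by (simp add: power_int_add qvar_nonzero algebra_simps)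
  ultimately show ?thesis
    using one_add_Qvar_nonzero[of e] qvar_nonzero
    by simp
qed


lemma transition_diagram_rows_First:
  assumes "m < r1"
  shows "transition qvar Z (diagram_rows r1 r2) (First, m) =
    (\<Prod>l\<in>{..<r1} - {m}. (qvar * Z (First, m) - Z (First, l)) / (Z (First, m) - Z (First, l))) *
    (\<Prod>l<r2. (qvar * Z (First, m) - Z (Second, l)) / (Z (First, m) - Z (Second, l)))"
proof -
  have "diagram_rows r1 r2 - {(First, m)} = Pair First ` ({..<r1} - {m}) \<union> Pair Second ` {..<r2}"
    by (auto simp: diagram_rows_def)
  then show ?thesis
    unfolding transition_def by (simp, subst prod.union_disjoint) (auto simp: prod.reindex inj_on_def)
qed

lemma transition_diagram_rows_Second:
  assumes "m < r2"
  shows "transition qvar Z (diagram_rows r1 r2) (Second, m) =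
    (\<Prod>l\<in>{..<r2} - {m}. (qvar * Z (Second, m) - Z (Second, l)) / (Z (Second, m) - Z (Second, l))) *
    (\<Prod>l<r1. (qvar * Z (Second, m) - Z (First, l)) / (Z (Second, m) - Z (First, l)))"
proof -
  have "diagram_rows r1 r2 - {(Second, m)} = Pair Second ` ({..<r2} - {m}) \<union> Pair First ` {..<r1}"
    by (auto simp: diagram_rows_def)
  then show ?thesis
    unfolding transition_def by (simp, subst prod.union_disjoint) (auto simp: prod.reindex inj_on_def)
qed

lemma row_weight_First:
  assumes "diagram S" "m < r1"
  defines "A \<equiv> row_length S First" and "B \<equiv> row_length S Second"
  shows "row_weight r1 r2 (A(m := Suc (A m))) B = row_weight r1 r2 A B *
    transition qvar (row_content S) (diagram_rows r1 r2) (First, m) / ((1 - qvar ^ (r1 + r2)) / (1 - qvar))"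
proof -
  let ?A = "A(m := Suc (A m))" and ?Z = "row_content S"
  have "(\<Sum>i<r1. ?A i) = Suc (\<Sum>i<r1. A i)"
    using assms(2) by (simp add: sum.remove[of _ m])
  moreover have "(\<Prod>i<r1. \<Prod>j<r2. mixed_factor ?A B i j) = (\<Prod>i<r1. \<Prod>j<r2. mixed_factor A B i j) *
      (\<Prod>j<r2. (qvar * ?Z (First, m) - ?Z (Second, j)) / (?Z (First, m) - ?Z (Second, j)))"
  proof -
    have "(\<Prod>i<r1. \<Prod>j<r2. mixed_factor ?A B i j) =
        (\<Prod>j<r2. mixed_factor ?A B m j) * (\<Prod>i\<in>{..<r1} - {m}. \<Prod>j<r2. mixed_factor ?A B i j)"
      using assms(2) by (intro prod.remove) auto
    moreover have "(\<Prod>i\<in>{..<r1} - {m}. \<Prod>j<r2. mixed_factor ?A B i j) =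
        (\<Prod>i\<in>{..<r1} - {m}. \<Prod>j<r2. mixed_factor A B i j)"
      by (intro prod.cong) (auto simp: mixed_factor_def)
    moreover have "(\<Prod>j<r2. mixed_factor ?A B m j) = (\<Prod>j<r2. mixed_factor A B m j) *
        (\<Prod>j<r2. (qvar * ?Z (First, m) - ?Z (Second, j)) / (?Z (First, m) - ?Z (Second, j)))"
      unfolding A_def B_def mixed_factor_First by (rule prod.distrib)
    moreover have "(\<Prod>i<r1. \<Prod>j<r2. mixed_factor A B i j) =
        (\<Prod>j<r2. mixed_factor A B m j) * (\<Prod>i\<in>{..<r1} - {m}. \<Prod>j<r2. mixed_factor A B i j)"
      using assms(2) by (intro prod.remove) auto
    ultimately show ?thesis by (simp only: mult_ac)
  qed
  ultimately show ?thesis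
    using schur_quotient_insert_corner[OF assms(1,2), of First]
    unfolding row_weight_def transition_diagram_rows_First[OF assms(2)] A_def[symmetric]
    by (simp add: field_simps)
qed

lemma row_weight_Second:
  assumes "diagram S" "m < r2"
  defines "A \<equiv> row_length S First" and "B \<equiv> row_length S Second"
  shows "row_weight r1 r2 A (B(m := Suc (B m))) = row_weight r1 r2 A B *
    transition qvar (row_content S) (diagram_rows r1 r2) (Second, m) / ((1 - qvar ^ (r1 + r2)) / (1 - qvar))"
proof -
  let ?B = "B(m := Suc (B m))" and ?Z = "row_content S"
  have "(\<Sum>i<r2. ?B i) = Suc (\<Sum>i<r2. B i)"
    using assms(2) by (simp add: sum.remove[of _ m])
  moreover have "qvar ^ r1 * (\<Prod>i<r1. \<Prod>j<r2. mixed_factor A ?B i j) = (\<Prod>i<r1. \<Prod>j<r2. mixed_factor A B i j) *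
      (\<Prod>i<r1. (qvar * ?Z (Second, m) - ?Z (First, i)) / (?Z (Second, m) - ?Z (First, i)))"
  proof -
    have "(\<Prod>j<r2. mixed_factor A ?B i j) =
        mixed_factor A ?B i m * (\<Prod>j\<in>{..<r2} - {m}. mixed_factor A B i j)" for i
    proof -
      have "(\<Prod>j<r2. mixed_factor A ?B i j) =
          mixed_factor A ?B i m * (\<Prod>j\<in>{..<r2} - {m}. mixed_factor A ?B i j)"
        using assms(2) by (intro prod.remove) auto
      also have "(\<Prod>j\<in>{..<r2} - {m}. mixed_factor A ?B i j) = (\<Prod>j\<in>{..<r2} - {m}. mixed_factor A B i j)"
        by (intro prod.cong) (auto simp: mixed_factor_def)
      finally show ?thesis .
    qed
    then have "qvar * (\<Prod>j<r2. mixed_factor A ?B i j) =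
        (qvar * mixed_factor A ?B i m) * (\<Prod>j\<in>{..<r2} - {m}. mixed_factor A B i j)" for i
      by (simp only: mult.assoc)
    moreover have "(\<Prod>j<r2. mixed_factor A B i j) =
        mixed_factor A B i m * (\<Prod>j\<in>{..<r2} - {m}. mixed_factor A B i j)" for i
      using assms(2) by (intro prod.remove) auto
    moreover have "qvar * mixed_factor A ?B i m = mixed_factor A B i m *
        ((qvar * ?Z (Second, m) - ?Z (First, i)) / (?Z (Second, m) - ?Z (First, i)))" for i
      unfolding A_def B_def by (rule mixed_factor_Second)
    ultimately have "qvar * (\<Prod>j<r2. mixed_factor A ?B i j) = (\<Prod>j<r2. mixed_factor A B i j) *
        ((qvar * ?Z (Second, m) - ?Z (First, i)) / (?Z (Second, m) - ?Z (First, i)))" for i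
      by (simp only: mult_ac)
    then have "(\<Prod>i<r1. qvar * (\<Prod>j<r2. mixed_factor A ?B i j)) = (\<Prod>i<r1. (\<Prod>j<r2. mixed_factor A B i j) *
        ((qvar * ?Z (Second, m) - ?Z (First, i)) / (?Z (Second, m) - ?Z (First, i))))"
      by (simp only:)
    then show ?thesis
      by (simp only: prod.distrib) simp
  qed
  moreover have "qs * qr * (u * (v * T1) / (k * kn)) * X' = qs * (u * v / kn) * X * (T1 * T2) / k"
    if "qr * X' = X * T2" for qs qr u v T1 k kn X X' T2 :: ratfun
  proof -
    have "qs * qr * (u * (v * T1) / (k * kn)) * X' = qs * (u * (v * T1) / (k * kn)) * (qr * X')"
      by (simp only: mult_ac)
    then show ?thesis unfolding that by (simp add: field_simps)
  qed
  moreover have "qvar ^ (r1 * Suc n) = qvar ^ (r1 * n) * qvar ^ r1" for n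
    by (simp add: power_add)
  ultimately show ?thesis
    unfolding row_weight_def transition_diagram_rows_Second[OF assms(2)] add_Suc_right power_Suc
    using schur_quotient_insert_corner[OF assms(1,2), of Second]
    by (simp only: B_def[symmetric] add_Suc_right power_Suc)
qed

lemma fits_iff:
  assumes "diagram S"
  shows "fits r1 r2 S \<longleftrightarrow> (\<forall>c i. 0 < row_length S c i \<longrightarrow> (c, i) \<in> diagram_rows r1 r2)"
proof -
  have *: "n \<le> r \<longleftrightarrow> (\<forall>i<n. i < r)" for n r :: nat
    by (metis linorder_not_le order_less_irrefl order_less_le_trans)
  have "(\<forall>c i. P c i) \<longleftrightarrow> (\<forall>i. P First i) \<and> (\<forall>i. P Second i)" for P :: "component \<Rightarrow> nat \<Rightarrow> bool"
    by (metis component.exhaust)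
  then show ?thesis
    unfolding fits_def row_length_pos_iff[OF assms] by (simp add: mem_diagram_rows_iff *[of "num_rows S _"])
qed

lemma fits_insert_corner:
  assumes "diagram S" "k \<in> {k. addable_row S k}"
  shows "fits r1 r2 (insert (corner S k) S) \<longleftrightarrow> fits r1 r2 S \<and> k \<in> diagram_rows r1 r2"
proof -
  have "corner S k \<in> addable S"
    using assms by (simp add: addable_eq_corners)
  then have d: "diagram (insert (corner S k) S)"
    using assms(1) diagram_insert by blast
  show ?thesis
    unfolding fits_iff[OF d] fits_iff[OF assms(1)] row_length_insert_corner[OF assms(1)]
    by (cases k) (auto split: if_splits)
qed

abbreviation quantum_int :: "nat \<Rightarrow> ratfun" where
  "quantum_int r \<equiv> (1 - qvar ^ r) / (1 - qvar)"

lemma qvar_neq_1: "qvar \<noteq> 1"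
  using qvar_power_eq_1_iff[of 1] by simp

lemma quantum_int_nonzero: "0 < r \<Longrightarrow> quantum_int r \<noteq> 0"
  using qvar_power_eq_1_iff[of r] qvar_neq_1 by auto

lemma set_weight_insert_corner:
  assumes "diagram S" "fits r1 r2 S" "addable_row S k" "k \<in> diagram_rows r1 r2"
  shows "set_weight r1 r2 (insert (corner S k) S) =
    set_weight r1 r2 S * transition qvar (row_content S) (diagram_rows r1 r2) k / quantum_int (r1 + r2)"
proof -
  let ?S = "insert (corner S k) S"
  have "corner S k \<in> addable S"
    using assms by (simp add: addable_eq_corners)
  then have d: "diagram ?S" and f: "fits r1 r2 ?S"
    using assms diagram_insert fits_insert_corner by auto
  obtain c m where k: "k = (c, m)" by (cases k)
  have eq: "row_length ?S c' = (if c' = c then (row_length S c)(m := Suc (row_length S c m)) else row_length S c')" for c'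
    by (rule ext) (auto simp: row_length_insert_corner[OF assms(1)] k)
  show ?thesis
  proof (cases c)
    case First
    then show ?thesis
      using row_weight_First[OF assms(1), of m r1 r2] assms(4)
      unfolding set_weight_fits[OF d f] set_weight_fits[OF assms(1,2)] eq
      by (simp add: k mem_diagram_rows_iff)
  next
    case Second
    then show ?thesis
      using row_weight_Second[OF assms(1), of m r2 r1] assms(4)
      unfolding set_weight_fits[OF d f] set_weight_fits[OF assms(1,2)] eq
      by (simp add: k mem_diagram_rows_iff)
  qed
qed

text \<open>The row above has the same length, hence a node equal to \<open>q\<close> times that of
  row \<open>k\<close>, and the corresponding numerator is zero.\<close>

lemma transition_not_addable:
  assumes "diagram S" "\<not> addable_row S k" "k \<in> diagram_rows r1 r2"
  shows "transition qvar (row_content S) (diagram_rows r1 r2) k = 0"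
proof -
  obtain c i where k: "k = (c, i)" by (cases k)
  have i: "i > 0" "row_length S c (i - 1) \<le> row_length S c i"
    using assms(2) by (auto simp: addable_row_def k)
  then have "row_length S c (i - 1) = row_length S c i"
    using row_length_antimono[OF assms(1), of "i - 1" i c] by simp
  then have "row_content S (c, i - 1) = qvar * row_content S k"
    unfolding row_content_def corner_def k using i(1)
    by (simp add: wcontent_eq_mult_qvar_iff of_nat_diff)
  moreover have "(c, i - 1) \<in> diagram_rows r1 r2 - {k}"
    using assms(3) i(1) by (cases c) (auto simp: k mem_diagram_rows_iff)
  ultimately show ?thesis
    unfolding transition_def by (intro prod_zero bexI[of _ "(c, i - 1)"]) auto
qed

lemma finite_addable:
  assumes "diagram S"
  shows "finite {k. addable_row S k}" "finite (addable S)"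
proof -
  define n where "n = max (num_rows S First) (num_rows S Second)"
  have "{k. addable_row S k} \<subseteq> diagram_rows (Suc n) (Suc n)"
  proof
    fix k assume "k \<in> {k. addable_row S k}"
    moreover obtain c i where k: "k = (c, i)" by (cases k)
    ultimately have "i = 0 \<or> 0 < row_length S c (i - 1)"
      by (auto simp: addable_row_def)
    then have "i \<le> num_rows S c"
      unfolding row_length_pos_iff[OF assms] by auto
    then show "k \<in> diagram_rows (Suc n) (Suc n)"
      by (cases c) (auto simp: k mem_diagram_rows_iff n_def)
  qed
  then show "finite {k. addable_row S k}"
    using finite_diagram_rows finite_subset by blast
  then show "finite (addable S)"
    by (simp add: addable_eq_corners[OF assms])
qed

text \<open>Sums over addable boxes become sums over all allowed rows, as interpolation requires:
  rows without an addable box have transition 0, and boxes outside the allowed rows lead to weight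
  0.\<close>

lemma sum_addable_weight:
  assumes "diagram S"
  shows "(\<Sum>b\<in>addable S. set_weight r1 r2 (insert b S) * F b) =
    set_weight r1 r2 S * (\<Sum>k\<in>diagram_rows r1 r2. transition qvar (row_content S) (diagram_rows r1 r2) k * F (corner S k)) /
      quantum_int (r1 + r2)"
proof -
  let ?A = "{k. addable_row S k}" and ?K = "diagram_rows r1 r2"
  have sum: "(\<Sum>b\<in>addable S. set_weight r1 r2 (insert b S) * F b) =
      (\<Sum>k\<in>?A. set_weight r1 r2 (insert (corner S k) S) * F (corner S k))"
    unfolding addable_eq_corners[OF assms] using inj_corner
    by (subst sum.reindex) (auto intro: inj_on_subset)
  show ?thesis
  proof (cases "fits r1 r2 S")
    case False
    then have "set_weight r1 r2 (insert (corner S k) S) = 0" if "k \<in> ?A" for k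
      using fits_insert_corner[OF assms that] by (simp add: set_weight_not_fits)
    then show ?thesis
      unfolding sum using False by (simp add: set_weight_not_fits)
  next
    case True
    have "(\<Sum>k\<in>?A. set_weight r1 r2 (insert (corner S k) S) * F (corner S k)) =
        (\<Sum>k\<in>?A \<inter> ?K. set_weight r1 r2 (insert (corner S k) S) * F (corner S k))"
      using finite_addable[OF assms] fits_insert_corner[OF assms]
      by (intro sum.mono_neutral_right) (auto simp: set_weight_not_fits)
    also have "\<dots> = (\<Sum>k\<in>?A \<inter> ?K. set_weight r1 r2 S *
        (transition qvar (row_content S) ?K k * F (corner S k)) / quantum_int (r1 + r2))"
      using True assms by (intro sum.cong) (auto simp: set_weight_insert_corner)
    also have "\<dots> = (\<Sum>k\<in>?K. set_weight r1 r2 S *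
        (transition qvar (row_content S) ?K k * F (corner S k)) / quantum_int (r1 + r2))"
    proof (intro sum.mono_neutral_left ballI)
      fix k assume "k \<in> ?K - ?A \<inter> ?K"
      then show "set_weight r1 r2 S * (transition qvar (row_content S) ?K k * F (corner S k)) / quantum_int (r1 + r2) = 0"
        using transition_not_addable[OF assms, of k r1 r2] by (cases "addable_row S k") auto
    qed auto
    finally show ?thesis
      unfolding sum by (simp only: sum_distrib_left sum_divide_distrib)
  qed
qed


section \<open>The weighted character\<close>

definition delta :: "'a \<Rightarrow> 'a \<Rightarrow> ratfun" where
  "delta \<tau> \<rho> = (if \<rho> = \<tau> then 1 else 0)"

lemma delta_same [simp]: "delta \<tau> \<tau> = 1"
  by (simp add: delta_def)

definition weighted_char :: "nat \<Rightarrow> nat \<Rightarrow> nat \<Rightarrow> hecke \<Rightarrow> ratfun" where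
  "weighted_char r1 r2 n x = (\<Sum>\<sigma>\<in>paths n. set_weight r1 r2 (set \<sigma>) * hrep n x (delta \<sigma>) \<sigma>)"

lemma hrep_expand:
  assumes "x \<in> H n" "\<sigma> \<in> paths n"
  shows "hrep n x f \<sigma> = (\<Sum>\<tau>\<in>paths n. hrep n x (delta \<tau>) \<sigma> * f \<tau>)"
proof -
  have "hrep n x f \<sigma> = hrep n x (\<lambda>\<rho>. \<Sum>\<tau>\<in>paths n. f \<tau> * delta \<tau> \<rho>) \<sigma>"
    using assms by (intro hrep_cong_paths)
      (simp_all add: delta_def finite_paths if_distrib[of "\<lambda>x. _ * x"] cong: if_cong)
  then show ?thesis
    by (simp add: hrep_sum hrep_linear mult.commute)
qed

lemma hrep_delta_block:
  assumes "x \<in> H n" "\<sigma> \<in> paths n" "set \<tau> \<noteq> set \<sigma>"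
  shows "hrep n x (delta \<tau>) \<sigma> = 0"
proof -
  have "hrep n x (delta \<tau>) \<sigma> = hrep n x (\<lambda>\<rho>. 0) \<sigma>"
    using assms by (intro hrep_cong[OF swap_closed_tableaux[of n "set \<sigma>"]]) (auto simp: delta_def)
  then show ?thesis by (simp add: hrep_zero)
qed

lemma weighted_char_add: "x \<in> H n \<Longrightarrow> y \<in> H n \<Longrightarrow>
    weighted_char r1 r2 n (x + y) = weighted_char r1 r2 n x + weighted_char r1 r2 n y"
  by (simp add: weighted_char_def hrep_add distrib_left sum.distrib)

lemma weighted_char_scale: "x \<in> H n \<Longrightarrow>
    weighted_char r1 r2 n (hecke_scale c x) = c * weighted_char r1 r2 n x"
  by (simp add: weighted_char_def hrep_scale sum_distrib_left mult_ac)

text \<open>The matrices are block diagonal with one block per diagram, and the weight is constant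
  on each block.\<close>

lemma weighted_char_commute:
  assumes "x \<in> H n" "y \<in> H n"
  shows "weighted_char r1 r2 n (x * y) = weighted_char r1 r2 n (y * x)"
proof -
  let ?W = "\<lambda>\<sigma>. set_weight r1 r2 (set \<sigma>)"
  have *: "weighted_char r1 r2 n (x * y) = (\<Sum>\<sigma>\<in>paths n. \<Sum>\<tau>\<in>paths n.
      ?W \<sigma> * (hrep n x (delta \<tau>) \<sigma> * hrep n y (delta \<sigma>) \<tau>))" if "x \<in> H n" "y \<in> H n" for x y
    unfolding weighted_char_def sum_distrib_left[symmetric]
  proof (intro sum.cong refl arg_cong2[of _ _ _ _ "(*)"])
    fix \<sigma> assume \<sigma>: "\<sigma> \<in> paths n"
    have "hrep n (x * y) (delta \<sigma>) \<sigma> = hrep n x (hrep n y (delta \<sigma>)) \<sigma>"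
      by (rule hrep_mult[OF that \<sigma>])
    also have "\<dots> = (\<Sum>\<tau>\<in>paths n. hrep n x (delta \<tau>) \<sigma> * hrep n y (delta \<sigma>) \<tau>)"
      by (rule hrep_expand[OF that(1) \<sigma>])
    finally show "hrep n (x * y) (delta \<sigma>) \<sigma> =
        (\<Sum>\<tau>\<in>paths n. hrep n x (delta \<tau>) \<sigma> * hrep n y (delta \<sigma>) \<tau>)" .
  qed
  have "weighted_char r1 r2 n (x * y) = (\<Sum>\<sigma>\<in>paths n. \<Sum>\<tau>\<in>paths n.
      ?W \<tau> * (hrep n y (delta \<sigma>) \<tau> * hrep n x (delta \<tau>) \<sigma>))"
    unfolding *[OF assms]
  proof (intro sum.cong refl)
    fix \<sigma> \<tau> assume "\<sigma> \<in> paths n" "\<tau> \<in> paths n"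
    then show "?W \<sigma> * (hrep n x (delta \<tau>) \<sigma> * hrep n y (delta \<sigma>) \<tau>) =
        ?W \<tau> * (hrep n y (delta \<sigma>) \<tau> * hrep n x (delta \<tau>) \<sigma>)"
      using hrep_delta_block[OF assms(1), of \<sigma> \<tau>] by (cases "set \<tau> = set \<sigma>") auto
  qed
  also have "\<dots> = weighted_char r1 r2 n (y * x)"
    unfolding *[OF assms(2,1)] by (rule sum.swap)
  finally show ?thesis .
qed

lemma sum_paths_Suc:
  "(\<Sum>\<sigma>\<in>paths (Suc n). f \<sigma>) = (\<Sum>\<sigma>\<in>paths n. \<Sum>b\<in>addable (set \<sigma>). f (\<sigma> @ [b]))"
proof -
  have "paths (Suc n) = (\<lambda>(\<sigma>, b). \<sigma> @ [b]) ` (SIGMA \<sigma>:paths n. addable (set \<sigma>))"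
    by (auto simp: paths_Suc)
  then have "(\<Sum>\<sigma>\<in>paths (Suc n). f \<sigma>) = (\<Sum>(\<sigma>, b)\<in>(SIGMA \<sigma>:paths n. addable (set \<sigma>)). f (\<sigma> @ [b]))"
    by (simp add: sum.reindex inj_on_def case_prod_unfold)
  also have "\<dots> = (\<Sum>\<sigma>\<in>paths n. \<Sum>b\<in>addable (set \<sigma>). f (\<sigma> @ [b]))"
    using finite_paths finite_addable(2)[OF diagram_paths] by (subst sum.Sigma) auto
  finally show ?thesis .
qed

text \<open>The hypothesis says that \<open>\<kappa>\<close> is the conditional expectation of \<open>x\<close> onto \<open>H\<^sub>n\<close>.\<close>

lemma weighted_char_Suc:
  assumes "h \<in> H n" "x \<in> H (Suc n)"
    and E: "\<And>\<sigma> \<tau>. \<sigma> \<in> paths n \<Longrightarrow> \<tau> \<in> paths n \<Longrightarrow> set \<tau> = set \<sigma> \<Longrightarrow>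
      (\<Sum>b\<in>addable (set \<sigma>). set_weight r1 r2 (insert b (set \<sigma>)) *
        hrep (Suc n) x (delta (\<sigma> @ [b])) (\<tau> @ [b])) = \<kappa> * set_weight r1 r2 (set \<sigma>) * delta \<sigma> \<tau>"
  shows "weighted_char r1 r2 (Suc n) (h * x) = \<kappa> * weighted_char r1 r2 n h"
proof -
  have hS: "h \<in> H (Suc n)" using assms(1) H_mono[of n "Suc n"] by auto
  let ?W = "set_weight r1 r2"
  have entry: "hrep (Suc n) (h * x) (delta (\<sigma> @ [b])) (\<sigma> @ [b]) =
      (\<Sum>\<tau>\<in>paths n. hrep n h (delta \<tau>) \<sigma> * hrep (Suc n) x (delta (\<sigma> @ [b])) (\<tau> @ [b]))"
    if "\<sigma> \<in> paths n" "b \<in> addable (set \<sigma>)" for \<sigma> b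
  proof -
    have "\<sigma> @ [b] \<in> paths (Suc n)" using that by (simp add: paths_snoc)
    then have "hrep (Suc n) (h * x) (delta (\<sigma> @ [b])) (\<sigma> @ [b]) =
        hrep n h (\<lambda>\<rho>. hrep (Suc n) x (delta (\<sigma> @ [b])) (\<rho> @ [b])) \<sigma>"
      using assms(1,2) hS that by (simp add: hrep_mult hrep_append)
    also have "\<dots> = (\<Sum>\<tau>\<in>paths n. hrep n h (delta \<tau>) \<sigma> * hrep (Suc n) x (delta (\<sigma> @ [b])) (\<tau> @ [b]))"
      by (rule hrep_expand[OF assms(1) that(1)])
    finally show ?thesis .
  qed
  have "weighted_char r1 r2 (Suc n) (h * x) = (\<Sum>\<sigma>\<in>paths n. \<Sum>b\<in>addable (set \<sigma>). \<Sum>\<tau>\<in>paths n.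
      hrep n h (delta \<tau>) \<sigma> * (?W (insert b (set \<sigma>)) * hrep (Suc n) x (delta (\<sigma> @ [b])) (\<tau> @ [b])))"
    unfolding weighted_char_def sum_paths_Suc
    by (intro sum.cong refl) (simp add: entry sum_distrib_left mult_ac)
  also have "\<dots> = (\<Sum>\<sigma>\<in>paths n. \<Sum>\<tau>\<in>paths n. hrep n h (delta \<tau>) \<sigma> * (\<Sum>b\<in>addable (set \<sigma>).
      ?W (insert b (set \<sigma>)) * hrep (Suc n) x (delta (\<sigma> @ [b])) (\<tau> @ [b])))"
    unfolding sum_distrib_left by (intro sum.cong refl sum.swap)
  also have "\<dots> = (\<Sum>\<sigma>\<in>paths n. \<Sum>\<tau>\<in>paths n. hrep n h (delta \<tau>) \<sigma> * (\<kappa> * ?W (set \<sigma>) * delta \<sigma> \<tau>))"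
  proof (intro sum.cong refl)
    fix \<sigma> \<tau> assume \<sigma>: "\<sigma> \<in> paths n" and \<tau>: "\<tau> \<in> paths n"
    show "hrep n h (delta \<tau>) \<sigma> * (\<Sum>b\<in>addable (set \<sigma>).
        ?W (insert b (set \<sigma>)) * hrep (Suc n) x (delta (\<sigma> @ [b])) (\<tau> @ [b])) =
        hrep n h (delta \<tau>) \<sigma> * (\<kappa> * ?W (set \<sigma>) * delta \<sigma> \<tau>)"
      using E[OF \<sigma> \<tau>] hrep_delta_block[OF assms(1) \<sigma>, of \<tau>] by (cases "set \<tau> = set \<sigma>") auto
  qed
  also have "\<dots> = \<kappa> * weighted_char r1 r2 n h"
    by (simp add: weighted_char_def delta_def finite_paths sum_distrib_left mult_ac
        if_distrib[of "\<lambda>x. _ * x"] cong: if_cong)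
  finally show ?thesis .
qed



section \<open>Conditional expectations\<close>

text \<open>With \<open>b\<close> the content of the last box these are the hypotheses of the
  interpolation sums; the third part identifies \<open>Z(m := b)\<close> with the nodes of the
  diagram before that box was added.\<close>

lemma row_content_neq_last:
  assumes "diagram S" "m \<in> {m. addable_row S m}"
  shows "row_content (insert (corner S m) S) m = qvar * wcontent (corner S m)"
    and "row_content (insert (corner S m) S) k \<noteq> wcontent (corner S m)"
    and "row_content S = (row_content (insert (corner S m) S))(m := wcontent (corner S m))"
proof -
  note * = row_content_insert_corner[OF assms(1), of m]
  show "row_content (insert (corner S m) S) m = qvar * wcontent (corner S m)"
    by (simp add: *) (simp add: row_content_def)
  show "row_content S = (row_content (insert (corner S m) S))(m := wcontent (corner S m))"
    by (simp add: *) (simp add: row_content_def fun_eq_iff)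
  show "row_content (insert (corner S m) S) k \<noteq> wcontent (corner S m)"
  proof (cases "k = m")
    case True
    then show ?thesis
      using qvar_neq_1 wcontent_nonzero[of "corner S m"] by (simp add: *) (simp add: row_content_def)
  next
    case False
    then have "row_content S k \<noteq> row_content S m"
      using inj_eq[OF inj_row_content[OF assms(1)], of k m] by blast
    then show ?thesis using False by (simp add: *) (simp add: row_content_def)
  qed
qed

lemma sum_transition_rows:
  assumes "diagram S"
  shows "(\<Sum>k\<in>diagram_rows r1 r2. transition qvar (row_content S) (diagram_rows r1 r2) k) = quantum_int (r1 + r2)"
  using sum_transition[of "diagram_rows r1 r2" "row_content S" qvar] inj_row_content[OF assms]
    row_content_nonzero qvar_neq_1 by (simp add: inj_on_subset)

text \<open>An exchange of the last two boxes would change the last one, so only the diagonal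
  coefficient survives.\<close>

lemma hrep_gen_delta:
  assumes "\<sigma> @ [c] \<in> paths (Suc (Suc n))" "\<tau> @ [c] \<in> paths (Suc (Suc n))"
  shows "hrep (Suc (Suc n)) (hecke_gen (Suc n)) (delta (\<sigma> @ [c])) (\<tau> @ [c]) =
    hdiag (\<tau> ! n) c * delta \<sigma> \<tau>"
proof -
  obtain \<rho> b where \<tau>: "\<tau> = \<rho> @ [b]" "\<rho> \<in> paths n"
    using assms(2) paths_snoc[of \<tau> c "Suc n"] by (auto elim: paths_SucE)
  have n: "length \<rho> = n" using \<tau>(2) by (rule paths_length)
  have "b \<noteq> c" using paths_distinct[OF assms(2)] by (auto simp: \<tau>)
  moreover have "swap_entries (Suc n) (\<tau> @ [c]) = \<rho> @ [c, b]"
    using swap_entries_snoc2[of n \<rho> b c] n by (simp add: \<tau>)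
  ultimately show ?thesis
    using assms(2) n by (simp add: hrep_gen delta_def nth_append \<tau>)
qed

text \<open>The coefficient \<open>hdiag e b\<close> involves, besides the new box, only the last
  box \<open>e\<close> of \<open>\<tau>\<close>, which is removable in the common diagram; this is
  the situation of \<open>sum_transition_hdiag\<close>.\<close>

lemma expectation_gen:
  assumes "\<sigma> \<in> paths (Suc n)" "\<tau> \<in> paths (Suc n)" "set \<tau> = set \<sigma>"
  shows "(\<Sum>b\<in>addable (set \<sigma>). set_weight r1 r2 (insert b (set \<sigma>)) *
    hrep (Suc (Suc n)) (hecke_gen (Suc n)) (delta (\<sigma> @ [b])) (\<tau> @ [b])) =
    qvar ^ (r1 + r2) / quantum_int (r1 + r2) * set_weight r1 r2 (set \<sigma>) * delta \<sigma> \<tau>"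
proof -
  let ?S = "set \<sigma>" and ?K = "diagram_rows r1 r2"
  obtain \<rho> e where \<tau>: "\<tau> = \<rho> @ [e]" "\<rho> \<in> paths n" "e \<in> addable (set \<rho>)"
    using assms(2) by (rule paths_SucE)
  have d: "diagram (set \<rho>)" "diagram ?S"
    using \<tau>(2) assms(1) by (auto intro: diagram_paths)
  then obtain m where m: "m \<in> {m. addable_row (set \<rho>) m}" "e = corner (set \<rho>) m"
    using \<tau>(3) by (auto simp: addable_eq_corners)
  have S: "?S = insert (corner (set \<rho>) m) (set \<rho>)"
    using assms(3) by (simp add: \<tau> m)
  note last = row_content_neq_last[OF d(1) m(1), folded S, folded m(2)]
  have "(\<Sum>b\<in>addable ?S. set_weight r1 r2 (insert b ?S) *
      hrep (Suc (Suc n)) (hecke_gen (Suc n)) (delta (\<sigma> @ [b])) (\<tau> @ [b])) =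
      (\<Sum>b\<in>addable ?S. set_weight r1 r2 (insert b ?S) * hdiag e b) * delta \<sigma> \<tau>"
    unfolding sum_distrib_right
  proof (intro sum.cong refl)
    fix b assume "b \<in> addable ?S"
    then have "\<sigma> @ [b] \<in> paths (Suc (Suc n))" "\<tau> @ [b] \<in> paths (Suc (Suc n))"
      using assms by (simp_all add: paths_snoc)
    then show "set_weight r1 r2 (insert b ?S) *
        hrep (Suc (Suc n)) (hecke_gen (Suc n)) (delta (\<sigma> @ [b])) (\<tau> @ [b]) =
        set_weight r1 r2 (insert b ?S) * hdiag e b * delta \<sigma> \<tau>"
      using paths_length[OF \<tau>(2)] by (simp add: hrep_gen_delta) (simp add: \<tau>(1) nth_append)
  qed
  also have "(\<Sum>b\<in>addable ?S. set_weight r1 r2 (insert b ?S) * hdiag e b) =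
      set_weight r1 r2 ?S * (\<Sum>k\<in>?K. transition qvar (row_content ?S) ?K k * hdiag e (corner ?S k)) /
      quantum_int (r1 + r2)"
    by (rule sum_addable_weight[OF d(2)])
  also have "\<dots> = set_weight r1 r2 ?S * qvar ^ (r1 + r2) / quantum_int (r1 + r2)"
  proof (cases "fits r1 r2 ?S")
    case True
    then have "m \<in> ?K"
      using fits_insert_corner[OF d(1) m(1)] S by simp
    moreover have "hdiag e (corner ?S k) = (qvar - 1) * row_content ?S k / (row_content ?S k - wcontent e)" for k
    proof -
      have "wcontent e \<noteq> wcontent (corner ?S k)"
        using last(2)[of k] unfolding row_content_def by (rule not_sym)
      then show ?thesis by (simp add: hdiag_eq row_content_def)
    qed
    ultimately have "(\<Sum>k\<in>?K. transition qvar (row_content ?S) ?K k * hdiag e (corner ?S k)) = qvar ^ (r1 + r2)"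
      using sum_transition_hdiag[of ?K "row_content ?S" qvar m "wcontent e"] last(1,2)
        inj_row_content[OF d(2)] row_content_nonzero qvar_neq_1 qvar_nonzero by (simp add: inj_on_subset)
    then show ?thesis by simp
  qed (simp add: set_weight_not_fits)
  finally show ?thesis by simp
qed

text \<open>Both paths end in \<open>c\<close>. Either neither factor exchanges the last two boxes,
  which gives the first term, or both do. In the second case \<open>x\<close> leaves the exchanged
  last box alone, which forces \<open>b = b'\<close>. The term \<open>q - 1\<close> comes from
  \<open>q g^-1 = g - (q - 1)\<close>.\<close>

lemma hrep_conj_delta:
  assumes x: "x \<in> H (Suc n)"
    and \<sigma>: "\<rho> @ [b, c] \<in> paths (Suc (Suc n))" and \<tau>: "\<rho>' @ [b', c] \<in> paths (Suc (Suc n))"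
  shows "hrep (Suc (Suc n)) (hecke_gen (Suc n) * x * hecke_gen_inv (Suc n)) (delta (\<rho> @ [b, c])) (\<rho>' @ [b', c]) =
    hdiag b' c * (hdiag b c - (qvar - 1)) / qvar * hrep (Suc n) x (delta (\<rho> @ [b])) (\<rho>' @ [b']) +
    (if b = b' then hoff c b * hoff b c / qvar * hrep (Suc n) x (delta (\<rho> @ [c])) (\<rho>' @ [c]) else 0)"
proof -
  let ?N = "Suc (Suc n)" and ?g = "hecke_gen (Suc n)" and ?g' = "hecke_gen_inv (Suc n)"
  define D where "D = hrep ?N ?g' (delta (\<rho> @ [b, c]))"
  have mem: "?g \<in> H ?N" "?g' \<in> H ?N" "x \<in> H ?N"
    using x H_mono[of "Suc n" ?N] by (auto intro: H_gen H_gen_inv)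
  have lens: "length \<rho> = n" "length \<rho>' = n"
    using paths_length[OF \<sigma>] paths_length[OF \<tau>] by auto
  have p: "\<rho> @ [b] \<in> paths (Suc n)" "\<rho>' @ [b'] \<in> paths (Suc n)"
    using paths_appendD[of "\<rho> @ [b]" "[c]" ?N] paths_appendD[of "\<rho>' @ [b']" "[c]" ?N] \<sigma> \<tau> lens by simp_all
  have ne: "b \<noteq> c" "b' \<noteq> c"
    using paths_distinct[OF \<sigma>] paths_distinct[OF \<tau>] by auto
  have swap: "swap_entries (Suc n) (\<pi> @ [u, v]) = \<pi> @ [v, u]" if "length \<pi> = n" for \<pi> u v
    using that swap_entries_snoc2[of n \<pi> u v] by simp
  have gen: "act_gen (Suc n) f (\<pi> @ [u, v]) = hdiag u v * f (\<pi> @ [u, v]) + hoff v u * f (\<pi> @ [v, u])"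
    if "length \<pi> = n" for f \<pi> u v
    using that by (simp add: swap nth_append)
  have D: "D (\<pi> @ [u, v]) = (hdiag u v * delta (\<rho> @ [b, c]) (\<pi> @ [u, v]) +
      hoff v u * delta (\<rho> @ [b, c]) (\<pi> @ [v, u]) - (qvar - 1) * delta (\<rho> @ [b, c]) (\<pi> @ [u, v])) / qvar"
    if path: "\<pi> @ [u, v] \<in> paths ?N" for \<pi> u v
  proof -
    have "length \<pi> = n" using paths_length[OF path] by simp
    have "D (\<pi> @ [u, v]) = inverse qvar * (hrep ?N ?g (delta (\<rho> @ [b, c])) (\<pi> @ [u, v]) -
        (qvar - 1) * delta (\<rho> @ [b, c]) (\<pi> @ [u, v]))"
      unfolding D_def hecke_gen_inv_def using path mem(1)
      by (simp add: hrep_scale hrep_diff hrep_1 H_diff H_scale H_1)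
    then show ?thesis
      using path gen[OF \<open>length \<pi> = n\<close>] by (simp add: hrep_gen divide_inverse mult.commute del: act_gen.simps)
  qed
  have F1: "hrep ?N x D (\<rho>' @ [b', c]) =
      (hdiag b c - (qvar - 1)) / qvar * hrep (Suc n) x (delta (\<rho> @ [b])) (\<rho>' @ [b'])"
  proof -
    have "hrep ?N x D ((\<rho>' @ [b']) @ [c]) = hrep (Suc n) x (\<lambda>\<pi>. D (\<pi> @ [c])) (\<rho>' @ [b'])"
      using \<tau> p x by (intro hrep_append) auto
    also have "\<dots> = hrep (Suc n) x (\<lambda>\<pi>. (hdiag b c - (qvar - 1)) / qvar * delta (\<rho> @ [b]) \<pi>) (\<rho>' @ [b'])"
    proof (rule hrep_cong[OF swap_closed_tableaux[of "Suc n" "set (\<rho>' @ [b'])"] x])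
      fix \<pi> assume \<pi>: "\<pi> \<in> {\<sigma> \<in> paths (Suc n). set \<sigma> = set (\<rho>' @ [b'])}"
      then obtain \<pi>' u where eq: "\<pi> = \<pi>' @ [u]" by (auto elim: paths_SucE)
      have "c \<in> addable (set (\<rho>' @ [b']))"
        using \<tau> paths_snoc[of "\<rho>' @ [b']" c "Suc n"] by simp
      then have "\<pi> @ [c] \<in> paths ?N"
        using \<pi> paths_snoc[of \<pi> c "Suc n"] by simp
      then have path: "\<pi>' @ [u, c] \<in> paths ?N" by (simp add: eq)
      show "D (\<pi> @ [c]) = (hdiag b c - (qvar - 1)) / qvar * delta (\<rho> @ [b]) \<pi>"
        using D[OF path] ne by (auto simp: eq delta_def)
    qed (use p in auto)
    also have "\<dots> = (hdiag b c - (qvar - 1)) / qvar * hrep (Suc n) x (delta (\<rho> @ [b])) (\<rho>' @ [b'])"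
      by (rule hrep_linear)
    finally show ?thesis by simp
  qed
  \<comment> \<open>The factor \<open>hoff c b'\<close> is kept because the path ending in
    \<open>c, b'\<close> exists only if it is nonzero.\<close>
  have F2: "hoff c b' * hrep ?N x D (\<rho>' @ [c, b']) =
      (if b = b' then hoff c b * hoff b c / qvar * hrep (Suc n) x (delta (\<rho> @ [c])) (\<rho>' @ [c]) else 0)"
  proof (cases "hoff c b' = 0")
    case False
    then have "\<not> adjacent b' c" by (auto simp: hoff_def adjacent_commute)
    then have path: "\<rho>' @ [c, b'] \<in> paths ?N"
      using swap_entries_in_paths_iff[OF \<tau>, of n] swap[OF lens(2), of b' c] lens by (simp add: nth_append)
    have p': "\<rho>' @ [c] \<in> paths (Suc n)"
      using paths_appendD[of "\<rho>' @ [c]" "[b']" ?N] path lens by simp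
    have "hrep ?N x D ((\<rho>' @ [c]) @ [b']) = hrep (Suc n) x (\<lambda>\<pi>. D (\<pi> @ [b'])) (\<rho>' @ [c])"
      using path p' x by (intro hrep_append) auto
    also have "\<dots> = hrep (Suc n) x (\<lambda>\<pi>. (if b = b' then hoff b c / qvar else 0) * delta (\<rho> @ [c]) \<pi>) (\<rho>' @ [c])"
    proof (rule hrep_cong[OF swap_closed_tableaux[of "Suc n" "set (\<rho>' @ [c])"] x])
      fix \<pi> assume \<pi>: "\<pi> \<in> {\<sigma> \<in> paths (Suc n). set \<sigma> = set (\<rho>' @ [c])}"
      then obtain \<pi>' u where eq: "\<pi> = \<pi>' @ [u]" by (auto elim: paths_SucE)
      have "b' \<in> addable (set (\<rho>' @ [c]))"
        using path paths_snoc[of "\<rho>' @ [c]" b' "Suc n"] by simp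
      then have "\<pi> @ [b'] \<in> paths ?N"
        using \<pi> paths_snoc[of \<pi> b' "Suc n"] by simp
      then have path': "\<pi>' @ [u, b'] \<in> paths ?N" by (simp add: eq)
      show "D (\<pi> @ [b']) = (if b = b' then hoff b c / qvar else 0) * delta (\<rho> @ [c]) \<pi>"
        using D[OF path'] ne by (auto simp: eq delta_def)
    qed (use p' in auto)
    finally have "hrep ?N x D ((\<rho>' @ [c]) @ [b']) =
        (if b = b' then hoff b c / qvar else 0) * hrep (Suc n) x (delta (\<rho> @ [c])) (\<rho>' @ [c])"
      by (simp only: hrep_linear)
    then show ?thesis by simp
  qed auto
  have "hrep ?N (?g * x * ?g') (delta (\<rho> @ [b, c])) (\<rho>' @ [b', c]) = hrep ?N ?g (hrep ?N x D) (\<rho>' @ [b', c])"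
  proof -
    have "hrep ?N (?g * (x * ?g')) (delta (\<rho> @ [b, c])) (\<rho>' @ [b', c]) =
        hrep ?N ?g (hrep ?N (x * ?g') (delta (\<rho> @ [b, c]))) (\<rho>' @ [b', c])"
      using mem \<tau> by (intro hrep_mult H_mult) auto
    also have "\<dots> = hrep ?N ?g (hrep ?N x D) (\<rho>' @ [b', c])"
      using mem \<tau> by (intro hrep_cong_paths) (auto simp: D_def hrep_mult)
    finally show ?thesis by (simp add: mult.assoc)
  qed
  also have "\<dots> = hdiag b' c * hrep ?N x D (\<rho>' @ [b', c]) + hoff c b' * hrep ?N x D (\<rho>' @ [c, b'])"
    using \<tau> gen[OF lens(2)] by (simp add: hrep_gen del: act_gen.simps)
  finally show ?thesis unfolding F1 F2 by simp
qed

section \<open>The expectation of \<open>t\<close> at the empty diagram\<close>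

lemma prod_quantum_telescope:
  assumes "0 < r"
  shows "(\<Prod>l\<in>{..<r} - {0}. (qvar ^ Suc l - 1) / (qvar ^ l - 1)) = quantum_int r"
  using assms
proof (induction r rule: nat_induct_non_zero)
  case 1
  then show ?case using qvar_neq_1 by simp
next
  case (Suc r)
  have "{..<Suc r} - {0} = insert r ({..<r} - {0})" using Suc.hyps by auto
  then have "(\<Prod>l\<in>{..<Suc r} - {0}. (qvar ^ Suc l - 1) / (qvar ^ l - 1)) =
      (qvar ^ Suc r - 1) / (qvar ^ r - 1) * quantum_int r"
    using Suc by simp
  also have "\<dots> = quantum_int (Suc r)"
    using Suc.hyps qvar_power_eq_1_iff[of r] qvar_neq_1 by (simp add: divide_simps) (simp add: algebra_simps)
  finally show ?case .
qed

lemma prod_Qvar_telescope: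
  "(\<Prod>l<r. (qvar ^ Suc l * Qvar + 1) / (qvar ^ l * Qvar + 1)) = (qvar ^ r * Qvar + 1) / (Qvar + 1)"
proof (induction r)
  case 0
  have "Qvar + 1 \<noteq> 0" using Qvar_qvar_power_add_nonzero[of 0 0] by simp
  then show ?case by simp
next
  case (Suc r)
  have "qvar ^ r * Qvar + 1 \<noteq> 0" using Qvar_qvar_power_add_nonzero[of r 0] by (simp add: mult.commute)
  then show ?case using Suc by simp
qed

lemma diagram_empty: "diagram {}"
  by (simp add: diagram_def)

text \<open>The nodes of the empty diagram are \<open>Q q^-l\<close> and \<open>- q^-l\<close>, so
  both products telescope. Up to the normalisation this is the probability that the first box goes
  to the first diagram.\<close>

lemma transition_empty_First:
  assumes "0 < r1"
  shows "transition qvar (row_content {}) (diagram_rows r1 r2) (First, 0) =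
    quantum_int r1 * ((qvar ^ r2 * Qvar + 1) / (Qvar + 1))"
proof -
  have 1: "(qvar * row_content {} (First, 0) - row_content {} (First, l)) /
      (row_content {} (First, 0) - row_content {} (First, l)) = (qvar ^ Suc l - 1) / (qvar ^ l - 1)" for l
  proof -
    have "qvar * Qvar - Qvar * inverse (qvar ^ l) = Qvar * inverse (qvar ^ l) * (qvar ^ Suc l - 1)"
      "Qvar - Qvar * inverse (qvar ^ l) = Qvar * inverse (qvar ^ l) * (qvar ^ l - 1)"
      using qvar_nonzero by (simp_all add: algebra_simps)
    then show ?thesis
      using qvar_nonzero Qvar_nonzero by (simp add: row_content_First row_length_def power_int_minus)
  qed
  have 2: "(qvar * row_content {} (First, 0) - row_content {} (Second, l)) /
      (row_content {} (First, 0) - row_content {} (Second, l)) = (qvar ^ Suc l * Qvar + 1) / (qvar ^ l * Qvar + 1)" for l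
  proof -
    have "qvar * Qvar + inverse (qvar ^ l) = inverse (qvar ^ l) * (qvar ^ Suc l * Qvar + 1)"
      "Qvar + inverse (qvar ^ l) = inverse (qvar ^ l) * (qvar ^ l * Qvar + 1)"
      using qvar_nonzero by (simp_all add: algebra_simps)
    then show ?thesis
      using qvar_nonzero by (simp add: row_content_First row_content_Second row_length_def power_int_minus)
  qed
  show ?thesis
    unfolding transition_diagram_rows_First[OF assms] 1 2 prod_quantum_telescope[OF assms] prod_Qvar_telescope ..
qed

definition tprime_expectation :: "nat \<Rightarrow> nat \<Rightarrow> ratfun" where
  "tprime_expectation r1 r2 = (qvar ^ r2 * Qvar + 1) * (1 - qvar ^ r1) / (1 - qvar ^ (r1 + r2)) - 1"

text \<open>Only the two rows with index 0 are addable, \<open>t\<close> has eigenvalues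
  \<open>Q\<close> and \<open>-1\<close> there, and the normalised transitions add up to 1. The
  result is \<open>P (Q + 1) - 1\<close> with \<open>P\<close> the probability of the first diagram,
  which explains the shape of \<open>y\<close>.\<close>

lemma expectation_t:
  assumes "0 < r1" "0 < r2"
  shows "(\<Sum>k\<in>diagram_rows r1 r2. transition qvar (row_content {}) (diagram_rows r1 r2) k *
      hrep (Suc 0) (hecke_gen 0) (delta [corner {} k]) [corner {} k]) =
    tprime_expectation r1 r2 * quantum_int (r1 + r2)"
proof -
  let ?K = "diagram_rows r1 r2" and ?T = "transition qvar (row_content {}) (diagram_rows r1 r2)"
  let ?A = "{(First, 0), (Second, 0)}"
  have A: "k \<in> ?A" if "addable_row {} k" for k
    using that by (cases k; cases "fst k") (auto simp: addable_row_def row_length_def)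
  have zero: "?T k = 0" if "k \<in> ?K - ?A" for k
    using transition_not_addable[OF diagram_empty, of k r1 r2] A that by blast
  have sub: "?A \<subseteq> ?K" using assms by (auto simp: mem_diagram_rows_iff)
  have act: "hrep (Suc 0) (hecke_gen 0) (delta [corner {} (c, 0)]) [corner {} (c, 0)] = (if c = First then Qvar else - 1)" for c
  proof -
    have "corner {} (c, 0) \<in> addable {}"
      by (simp add: addable_eq_corners[OF diagram_empty] addable_row_def)
    then have "[corner {} (c, 0)] \<in> paths (Suc 0)"
      using paths_snoc[of "[]" "corner {} (c, 0)" 0] by simp
    then show ?thesis by (simp add: hrep_gen delta_def t_eigenvalue_def corner_def)
  qed
  have "(\<Sum>k\<in>?K. ?T k * F k) = ?T (First, 0) * F (First, 0) + ?T (Second, 0) * F (Second, 0)" for F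
  proof -
    have "(\<Sum>k\<in>?K. ?T k * F k) = (\<Sum>k\<in>?A. ?T k * F k)"
      using sub zero by (intro sum.mono_neutral_right) auto
    then show ?thesis by simp
  qed
  note sum = this
  have total: "?T (First, 0) + ?T (Second, 0) = quantum_int (r1 + r2)"
    using sum[of "\<lambda>k. 1"] sum_transition_rows[OF diagram_empty, of r1 r2] by simp
  have "(\<Sum>k\<in>?K. ?T k * hrep (Suc 0) (hecke_gen 0) (delta [corner {} k]) [corner {} k]) =
      ?T (First, 0) * Qvar - ?T (Second, 0)"
    unfolding sum by (simp add: act)
  also have "\<dots> = ?T (First, 0) * (Qvar + 1) - quantum_int (r1 + r2)"
    unfolding total[symmetric] by (simp add: algebra_simps)
  also have "?T (First, 0) * (Qvar + 1) = quantum_int r1 * (qvar ^ r2 * Qvar + 1)"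
    unfolding transition_empty_First[OF assms(1)]
    using Qvar_qvar_power_add_nonzero[of 0 0] by simp
  also have "\<dots> - quantum_int (r1 + r2) = tprime_expectation r1 r2 * quantum_int (r1 + r2)"
  proof -
    have "a / e * B - D / e = (B * a / D - 1) * (D / e)" if "D \<noteq> 0" for a e B D :: ratfun
      using that by (simp add: left_diff_distrib diff_divide_distrib mult.commute[of a B])
    moreover have "1 - qvar ^ (r1 + r2) \<noteq> 0"
      using qvar_power_eq_1_iff[of "r1 + r2"] assms by auto
    ultimately show ?thesis
      unfolding tprime_expectation_def by blast
  qed
  finally show ?thesis .
qed

text \<open>Induction through \<open>t'_(n+1) = g t'_n g^-1\<close>. For different last boxes the
  sum of the diagonal terms vanishes and there are no others. For equal last boxes every transition
  of the diagram turns into one of the diagram with that box removed, so the induction hypothesis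
  applies.\<close>

lemma expectation_tprime_rows:
  assumes "0 < r1" "0 < r2" "\<sigma> \<in> paths n" "\<tau> \<in> paths n" "set \<tau> = set \<sigma>" "fits r1 r2 (set \<sigma>)"
  shows "(\<Sum>k\<in>diagram_rows r1 r2. transition qvar (row_content (set \<sigma>)) (diagram_rows r1 r2) k *
      hrep (Suc n) (tprime n) (delta (\<sigma> @ [corner (set \<sigma>) k])) (\<tau> @ [corner (set \<sigma>) k])) =
    tprime_expectation r1 r2 * quantum_int (r1 + r2) * delta \<sigma> \<tau>"
  using assms(3-6)
proof (induction n arbitrary: \<sigma> \<tau>)
  case 0
  then have "\<sigma> = []" "\<tau> = []" by simp_all
  then show ?case using expectation_t[OF assms(1,2)] by simp
next
  case (Suc n)
  let ?K = "diagram_rows r1 r2" and ?S = "set \<sigma>"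
  let ?T = "transition qvar (row_content ?S) ?K"
  obtain \<rho> b where \<sigma>: "\<sigma> = \<rho> @ [b]" "\<rho> \<in> paths n" "b \<in> addable (set \<rho>)"
    using Suc.prems(1) by (rule paths_SucE)
  obtain \<rho>' b' where \<tau>: "\<tau> = \<rho>' @ [b']" "\<rho>' \<in> paths n" "b' \<in> addable (set \<rho>')"
    using Suc.prems(2) by (rule paths_SucE)
  note d = diagram_paths[OF \<sigma>(2)] diagram_paths[OF \<tau>(2)] diagram_paths[OF Suc.prems(1)]
  obtain m where m: "m \<in> {m. addable_row (set \<rho>) m}" "b = corner (set \<rho>) m"
    using \<sigma>(3) d by (auto simp: addable_eq_corners)
  obtain m' where m': "m' \<in> {m. addable_row (set \<rho>') m}" "b' = corner (set \<rho>') m'"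
    using \<tau>(3) d by (auto simp: addable_eq_corners)
  have S: "?S = insert (corner (set \<rho>) m) (set \<rho>)" and S': "?S = insert (corner (set \<rho>') m') (set \<rho>')"
    using Suc.prems(3) by (simp_all add: \<sigma> \<tau> m m')
  note last = row_content_neq_last[OF d(1) m(1), folded S, folded m(2)]
  note last' = row_content_neq_last[OF d(2) m'(1), folded S', folded m'(2)]
  have mK: "m \<in> ?K" "fits r1 r2 (set \<rho>)" and mK': "m' \<in> ?K"
    using fits_insert_corner[OF d(1) m(1), of r1 r2] fits_insert_corner[OF d(2) m'(1), of r1 r2] Suc.prems(4) S S'
    by auto
  let ?X = "hrep (Suc n) (tprime n) (delta \<sigma>) \<tau>"
  let ?Y = "\<lambda>c. hrep (Suc n) (tprime n) (delta (\<rho> @ [c])) (\<rho>' @ [c])"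
  let ?a = "\<lambda>e k. (qvar - 1) * row_content ?S k / (row_content ?S k - wcontent e)"
  have hd: "hdiag e (corner ?S k) = ?a e k" if "row_content ?S k \<noteq> wcontent e" for e k
    using hdiag_eq[of e "corner ?S k"] that by (simp add: row_content_def)
  have entry: "?T k * hrep (Suc (Suc n)) (tprime (Suc n)) (delta (\<sigma> @ [corner ?S k])) (\<tau> @ [corner ?S k]) =
      ?T k * ?a b' k * (?a b k - (qvar - 1)) * (?X / qvar) +
      (if b = b' then ?T k * (hoff (corner ?S k) b * hoff b (corner ?S k)) / qvar * ?Y (corner ?S k) else 0)"
    if k: "k \<in> ?K" for k
  proof (cases "addable_row ?S k")
    case False
    \<comment> \<open>In this row \<open>hrep\<close> is evaluated outside the paths, where its
      value is unknown, but the transition in front of it is 0.\<close>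
    then show ?thesis using transition_not_addable[OF d(3) False k] by simp
  next
    case True
    then have c: "corner ?S k \<in> addable ?S"
      using d(3) by (auto simp: addable_eq_corners)
    define c where "c = corner ?S k"
    have e: "\<rho> @ [b, c] = \<sigma> @ [c]" "\<rho>' @ [b', c] = \<tau> @ [c]"
      by (simp_all add: \<sigma>(1) \<tau>(1))
    have "\<sigma> @ [c] \<in> paths (Suc (Suc n))" "\<tau> @ [c] \<in> paths (Suc (Suc n))"
      using c Suc.prems by (simp_all add: paths_snoc c_def)
    then have "hrep (Suc (Suc n)) (tprime (Suc n)) (delta (\<sigma> @ [c])) (\<tau> @ [c]) =
        hdiag b' c * (hdiag b c - (qvar - 1)) / qvar * ?X +
        (if b = b' then hoff c b * hoff b c / qvar * ?Y c else 0)"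
      using hrep_conj_delta[OF tprime_in_H, of \<rho> b c n \<rho>' b'] unfolding e \<sigma>(1)[symmetric] \<tau>(1)[symmetric]
      by simp
    moreover have "hdiag b c = ?a b k" "hdiag b' c = ?a b' k"
      unfolding c_def by (rule hd[OF last(2)], rule hd[OF last'(2)])
    moreover have "T * (A * B / qvar * X + (if b = b' then C / qvar * Y else 0)) =
        T * A * B * (X / qvar) + (if b = b' then T * C / qvar * Y else 0)" for T A B X C Y
      by (simp add: distrib_left mult.assoc)
    ultimately show ?thesis unfolding c_def[symmetric] by (simp only:)
  qed
  note inj = inj_on_subset[OF inj_row_content[OF d(3)] subset_UNIV, of ?K]
  have nz: "row_content ?S k \<noteq> 0" if "k \<in> ?K" for k
    by (rule row_content_nonzero)
  note ctx = finite_diagram_rows inj nz qvar_nonzero qvar_neq_1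
  have sum: "(\<Sum>k\<in>?K. ?T k * hrep (Suc (Suc n)) (tprime (Suc n)) (delta (\<sigma> @ [corner ?S k])) (\<tau> @ [corner ?S k])) =
      (\<Sum>k\<in>?K. ?T k * ?a b' k * (?a b k - (qvar - 1))) * (?X / qvar) +
      (\<Sum>k\<in>?K. if b = b' then ?T k * (hoff (corner ?S k) b * hoff b (corner ?S k)) / qvar * ?Y (corner ?S k) else 0)"
    by (simp only: entry sum.distrib sum_distrib_right cong: sum.cong)
  show ?case
  proof (cases "b = b'")
    case False
    \<comment> \<open>A removable box of a given diagram is determined by its row.\<close>
    have "m \<noteq> m'"
    proof
      assume "m = m'"
      then have "Suc (row_length (set \<rho>) (fst m) (snd m)) = Suc (row_length (set \<rho>') (fst m) (snd m))"
        using row_length_insert_corner[OF d(1), of m "fst m" "snd m"] S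
          row_length_insert_corner[OF d(2), of m' "fst m" "snd m"] S' by simp
      then show False
        using False \<open>m = m'\<close> by (simp add: m(2) m'(2) corner_def)
    qed
    then have "(\<Sum>k\<in>?K. ?T k * ?a b' k * (?a b k - (qvar - 1))) = 0"
      using last(2) last'(2)
      by (intro sum_transition_hdiag2_neq[OF ctx mK' mK(1) _ last'(1) last(1)]) blast+
    moreover have "\<sigma> \<noteq> \<tau>" using False by (simp add: \<sigma>(1) \<tau>(1))
    ultimately show ?thesis unfolding sum using False by (simp add: delta_def)
  next
    case True
    have "b \<notin> set \<rho>" "b \<notin> set \<rho>'"
      using \<sigma>(3) \<tau>(3) True by (auto simp: addable_def)
    then have set: "set \<rho>' = set \<rho>"
      using Suc.prems(3) True by (auto simp: \<sigma>(1) \<tau>(1))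
    let ?T' = "transition qvar (row_content (set \<rho>)) ?K"
    \<comment> \<open>The diagonal terms together provide the summand of row \<open>m\<close> in the
      sum for the smaller diagram; the exchanged terms provide those of the other rows by
      \<open>2\<close>, and contribute nothing in row \<open>m\<close> by \<open>3\<close>.\<close>
    have 1: "(\<Sum>k\<in>?K. ?T k * ?a b' k * (?a b k - (qvar - 1))) = qvar * ?T' m"
      using sum_transition_hdiag2_eq[OF ctx, of m "wcontent b"] last mK True by simp
    have 2: "?T k * (hoff (corner ?S k) b * hoff b (corner ?S k)) / qvar * ?Y (corner ?S k) =
        ?T' k * ?Y (corner (set \<rho>) k)" if k: "k \<in> ?K" "k \<noteq> m" for k
    proof -
      have "corner ?S k = corner (set \<rho>) k"
        using k(2) unfolding S by (simp add: corner_insert_corner[OF d(1)])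
      moreover have "hoff (corner ?S k) b * hoff b (corner ?S k) =
          (1 + ?a b k) * (1 + (qvar - 1) * wcontent b / (wcontent b - row_content ?S k))"
        using hoff_mult[of b "corner ?S k"] hdiag_eq[of b "corner ?S k"] hdiag_eq[of "corner ?S k" b] last(2)[of k]
        by (simp add: row_content_def mult.commute)
      moreover have "?T k * ((1 + ?a b k) * (1 + (qvar - 1) * wcontent b / (wcontent b - row_content ?S k))) =
          qvar * ?T' k"
        using transition_hoff[OF ctx mK(1) k(1) k(2) last(1,2)] last(3) by simp
      ultimately show ?thesis using qvar_nonzero by simp
    qed
    have 3: "hoff (corner ?S m) b = 0"
    proof -
      have "adjacent (corner ?S m) b"
        unfolding m(2) S by (cases m) (simp add: corner_insert_corner[OF d(1)], simp add: corner_def)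
      then show ?thesis by (simp add: hoff_def)
    qed
    have "(\<Sum>k\<in>?K. ?T k * (hoff (corner ?S k) b * hoff b (corner ?S k)) / qvar * ?Y (corner ?S k)) =
        (\<Sum>k\<in>?K - {m}. ?T' k * ?Y (corner (set \<rho>) k))"
    proof -
      have "(\<Sum>k\<in>?K. ?T k * (hoff (corner ?S k) b * hoff b (corner ?S k)) / qvar * ?Y (corner ?S k)) =
          (\<Sum>k\<in>?K - {m}. ?T k * (hoff (corner ?S k) b * hoff b (corner ?S k)) / qvar * ?Y (corner ?S k))"
        using 3 by (intro sum.mono_neutral_right) auto
      also have "\<dots> = (\<Sum>k\<in>?K - {m}. ?T' k * ?Y (corner (set \<rho>) k))"
        by (rule sum.cong[OF refl 2]) simp_all
      finally show ?thesis .
    qed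
    moreover have "(\<Sum>k\<in>?K. ?T' k * ?Y (corner (set \<rho>) k)) =
        ?T' m * ?X + (\<Sum>k\<in>?K - {m}. ?T' k * ?Y (corner (set \<rho>) k))"
      using mK(1) True by (subst sum.remove[of _ m]) (auto simp: \<sigma>(1) \<tau>(1) m(2))
    moreover have "(\<Sum>k\<in>?K. ?T' k * ?Y (corner (set \<rho>) k)) =
        tprime_expectation r1 r2 * quantum_int (r1 + r2) * delta \<rho> \<rho>'"
      by (rule Suc.IH[OF \<sigma>(2) \<tau>(2) set mK(2)])
    ultimately show ?thesis
      unfolding sum 1 using True qvar_nonzero by (simp add: delta_def \<sigma>(1) \<tau>(1))
  qed
qed

section \<open>The Markov trace defined by the weights\<close>

lemma expectation_tprime:
  assumes "0 < r1" "0 < r2" "\<sigma> \<in> paths n" "\<tau> \<in> paths n" "set \<tau> = set \<sigma>"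
  shows "(\<Sum>b\<in>addable (set \<sigma>). set_weight r1 r2 (insert b (set \<sigma>)) *
      hrep (Suc n) (tprime n) (delta (\<sigma> @ [b])) (\<tau> @ [b])) =
    tprime_expectation r1 r2 * set_weight r1 r2 (set \<sigma>) * delta \<sigma> \<tau>"
  unfolding sum_addable_weight[OF diagram_paths[OF assms(3)]]
  using expectation_tprime_rows[OF assms] quantum_int_nonzero[of "r1 + r2"] assms(1)
  by (cases "fits r1 r2 (set \<sigma>)") (simp_all add: set_weight_not_fits)

lemma expectation_1:
  assumes "0 < r1" "\<sigma> \<in> paths n" "\<tau> \<in> paths n" "set \<tau> = set \<sigma>"
  shows "(\<Sum>b\<in>addable (set \<sigma>). set_weight r1 r2 (insert b (set \<sigma>)) *
      hrep (Suc n) 1 (delta (\<sigma> @ [b])) (\<tau> @ [b])) = 1 * set_weight r1 r2 (set \<sigma>) * delta \<sigma> \<tau>"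
proof -
  have "(\<Sum>b\<in>addable (set \<sigma>). set_weight r1 r2 (insert b (set \<sigma>)) *
      hrep (Suc n) 1 (delta (\<sigma> @ [b])) (\<tau> @ [b])) =
      (\<Sum>b\<in>addable (set \<sigma>). set_weight r1 r2 (insert b (set \<sigma>)) * delta \<sigma> \<tau>)"
    using assms by (intro sum.cong refl) (simp add: hrep_1 paths_snoc delta_def)
  also have "\<dots> = (\<Sum>b\<in>addable (set \<sigma>). set_weight r1 r2 (insert b (set \<sigma>)) * 1) * delta \<sigma> \<tau>"
    by (simp add: sum_distrib_right)
  also have "\<dots> = set_weight r1 r2 (set \<sigma>) * delta \<sigma> \<tau>"
    unfolding sum_addable_weight[OF diagram_paths[OF assms(2)]]
    using quantum_int_nonzero[of "r1 + r2"] assms(1)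
    by (simp add: sum_transition_rows[OF diagram_paths[OF assms(2)]])
  finally show ?thesis by simp
qed

lemma weighted_char_H_mono:
  assumes "0 < r1" "x \<in> H m" "m \<le> n"
  shows "weighted_char r1 r2 n x = weighted_char r1 r2 m x"
  using assms(3)
proof (induction n rule: dec_induct)
  case (step n)
  have "x \<in> H n" using assms(2) step H_mono by blast
  from weighted_char_Suc[OF this H_1, of r1 r2 1] expectation_1[OF assms(1)] step.IH
  show ?case by simp
qed simp

text \<open>By the branching rule every \<open>n\<close> with \<open>x \<in> H n\<close> gives the same value.\<close>

definition weighted_trace :: "nat \<Rightarrow> nat \<Rightarrow> hecke \<Rightarrow> ratfun" where
  "weighted_trace r1 r2 x = weighted_char r1 r2 (LEAST n. x \<in> H n) x"

lemma weighted_trace_eq: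
  assumes "0 < r1" "x \<in> H n"
  shows "weighted_trace r1 r2 x = weighted_char r1 r2 n x"
  unfolding weighted_trace_def
  using weighted_char_H_mono[OF assms(1) LeastI[of "\<lambda>n. x \<in> H n", OF assms(2)] Least_le[of "\<lambda>n. x \<in> H n", OF assms(2)]]
  by simp

lemma ex_common_H: "\<exists>n. x \<in> H n \<and> y \<in> H n"
proof -
  obtain n m where "x \<in> H n" "y \<in> H m" using ex_H by blast
  then have "x \<in> H (max n m)" "y \<in> H (max n m)"
    using H_mono[of n "max n m"] H_mono[of m "max n m"] by auto
  then show ?thesis by blast
qed

lemma weighted_trace_linear:
  assumes "0 < r1"
  shows "weighted_trace r1 r2 (x + y) = weighted_trace r1 r2 x + weighted_trace r1 r2 y"
    and "weighted_trace r1 r2 (hecke_scale c x) = c * weighted_trace r1 r2 x"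
    and "weighted_trace r1 r2 (x * y) = weighted_trace r1 r2 (y * x)"
proof -
  obtain n where n: "x \<in> H n" "y \<in> H n" using ex_common_H by blast
  note eq = weighted_trace_eq[OF assms, of _ n]
  show "weighted_trace r1 r2 (x + y) = weighted_trace r1 r2 x + weighted_trace r1 r2 y"
    using n by (simp add: eq H_add weighted_char_add)
  show "weighted_trace r1 r2 (hecke_scale c x) = c * weighted_trace r1 r2 x"
    using n by (simp add: eq H_scale weighted_char_scale)
  show "weighted_trace r1 r2 (x * y) = weighted_trace r1 r2 (y * x)"
    using weighted_char_commute[OF n] n by (simp add: eq H_mult)
qed

lemma weighted_trace_1:
  assumes "0 < r1"
  shows "weighted_trace r1 r2 1 = 1"
  by (simp add: weighted_trace_eq[OF assms H_1[of 0]] weighted_char_def hrep_1 set_weight_empty)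

lemma weighted_trace_gen:
  assumes "0 < r1" "1 \<le> n" "h \<in> H n"
  shows "weighted_trace r1 r2 (h * hecke_gen n) =
    qvar ^ (r1 + r2) / quantum_int (r1 + r2) * weighted_trace r1 r2 h"
proof -
  obtain m where m: "n = Suc m" using assms(2) by (cases n) auto
  have "weighted_char r1 r2 (Suc n) (h * hecke_gen n) =
      qvar ^ (r1 + r2) / quantum_int (r1 + r2) * weighted_char r1 r2 n h"
    using assms(3) unfolding m by (intro weighted_char_Suc expectation_gen H_gen) auto
  moreover have "h * hecke_gen n \<in> H (Suc n)"
    using assms(3) H_mono[of n "Suc n"] by (auto intro!: H_mult H_gen)
  ultimately show ?thesis
    using assms by (simp add: weighted_trace_eq)
qed

lemma weighted_trace_tprime:
  assumes "0 < r1" "0 < r2" "h \<in> H n"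
  shows "weighted_trace r1 r2 (h * tprime n) = tprime_expectation r1 r2 * weighted_trace r1 r2 h"
proof -
  have "weighted_char r1 r2 (Suc n) (h * tprime n) = tprime_expectation r1 r2 * weighted_char r1 r2 n h"
    using assms by (intro weighted_char_Suc expectation_tprime tprime_in_H) auto
  moreover have "h * tprime n \<in> H (Suc n)"
    using assms(3) H_mono[of n "Suc n"] tprime_in_H by (auto intro!: H_mult)
  ultimately show ?thesis
    using assms by (simp add: weighted_trace_eq)
qed

lemma weighted_trace_prod_tprime:
  assumes "0 < r1" "0 < r2"
  shows "weighted_trace r1 r2 (prod_list (map tprime [0..<k])) = tprime_expectation r1 r2 ^ k"
proof (induction k)
  case (Suc k)
  have "prod_list (map tprime [0..<k]) \<in> H k"
    by (rule prod_list_tprime_in_H) auto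
  from weighted_trace_tprime[OF assms this] Suc show ?case by simp
qed (simp add: weighted_trace_1 assms)

theorem markov_trace_weighted_trace:
  assumes "0 < r1" "0 < r2"
  shows "markov_trace (qvar ^ (r1 + r2) * (1 - qvar) / (1 - qvar ^ (r1 + r2))) (weighted_trace r1 r2)"
proof -
  have "vector_space ((*) :: ratfun \<Rightarrow> ratfun \<Rightarrow> ratfun)"
    by standard (simp_all add: algebra_simps)
  then have "Vector_Spaces.linear hecke_scale (*) (weighted_trace r1 r2)"
    using weighted_trace_linear[OF assms(1)] hecke.vector_space_axioms
    by (auto simp: Vector_Spaces.linear_iff)
  then show ?thesis
    using weighted_trace_linear[OF assms(1)] weighted_trace_gen[OF assms(1), of _ _ r2]
    by (simp add: markov_trace_def weighted_trace_1 assms)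
qed


section \<open>Irreducible characters\<close>

lemma swap_entries_neq:
  assumes "\<sigma> \<in> paths n" "Suc k < n"
  shows "swap_entries (Suc k) \<sigma> \<noteq> \<sigma>"
proof
  assume "swap_entries (Suc k) \<sigma> = \<sigma>"
  then have "\<sigma> ! k = \<sigma> ! Suc k"
    using nth_swap_entries[of k \<sigma> k] assms by (simp add: paths_length)
  then show False
    using assms paths_distinct[OF assms(1)] paths_length[OF assms(1)] nth_eq_iff_index_eq[of \<sigma> k "Suc k"] by simp
qed

text \<open>In the sum over tableaux a nonstandard exchange drops out of the index set; in
  \<open>act_gen\<close> it is removed by \<open>hoff\<close>.\<close>

lemma sum_rep_gen:
  assumes "\<sigma> \<in> paths n" "i < n"
  defines "A \<equiv> {\<rho> \<in> paths n. set \<rho> = set \<sigma>}"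
  shows "(\<Sum>\<rho>\<in>A. rep_gen i \<sigma> \<rho> * F \<rho>) = act_gen i F \<sigma>"
proof (cases i)
  case 0
  have "(\<Sum>\<rho>\<in>A. rep_gen i \<sigma> \<rho> * F \<rho>) = (\<Sum>\<rho>\<in>{\<sigma>}. rep_gen i \<sigma> \<rho> * F \<rho>)"
    using assms(1) finite_paths by (intro sum.mono_neutral_right) (auto simp: A_def rep_gen_def 0)
  then show ?thesis by (simp add: rep_gen_def 0 t_eigenvalue_def)
next
  case (Suc k)
  have k: "Suc k < n" "Suc k < length \<sigma>" using assms by (simp_all add: Suc paths_length)
  let ?s = "swap_entries (Suc k) \<sigma>"
  have sym: "\<rho> = ?s" if "\<rho> \<in> A" "\<sigma> = swap_entries (Suc k) \<rho>" for \<rho>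
  proof -
    have "Suc k < length \<rho>" using that(1) k(1) by (auto simp: A_def paths_length)
    then show ?thesis using that(2) by (simp add: swap_entries_swap_entries)
  qed
  have ne: "?s \<noteq> \<sigma>" using swap_entries_neq assms k by blast
  have val: "rep_gen (Suc k) \<sigma> ?s = 1 + hdiag (\<sigma> ! Suc k) (\<sigma> ! k)"
    using ne k(2) swap_entries_swap_entries[OF k(2)] by (simp add: rep_gen_def hdiag_def nth_swap_entries)
  have diag: "rep_gen (Suc k) \<sigma> \<sigma> = hdiag (\<sigma> ! k) (\<sigma> ! Suc k)"
    by (simp add: rep_gen_def hdiag_def)
  have sub: "(\<Sum>\<rho>\<in>A. rep_gen i \<sigma> \<rho> * F \<rho>) = (\<Sum>\<rho>\<in>{\<sigma>, ?s} \<inter> A. rep_gen i \<sigma> \<rho> * F \<rho>)"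
    using sym finite_paths by (intro sum.mono_neutral_right) (auto simp: A_def rep_gen_def Suc Let_def)
  show ?thesis
  proof (cases "?s \<in> paths n")
    case True
    then have "{\<sigma>, ?s} \<inter> A = {\<sigma>, ?s}"
      using assms(1) k by (auto simp: A_def set_swap_entries)
    moreover have "hoff (\<sigma> ! Suc k) (\<sigma> ! k) = 1 + hdiag (\<sigma> ! Suc k) (\<sigma> ! k)"
      using True swap_entries_in_paths_iff[OF assms(1) k(1)] by (simp add: hoff_def adjacent_commute)
    ultimately show ?thesis
      unfolding sub using ne by (simp add: Suc val diag)
  next
    case False
    then have "{\<sigma>, ?s} \<inter> A = {\<sigma>}"
      using assms(1) by (auto simp: A_def)
    then show ?thesis
      unfolding sub using hoff_zero_if_not_path[OF assms(1) k(1) False] by (simp add: Suc diag)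
  qed
qed

lemma rep_word_eq:
  assumes "\<mu> \<in> double_partitions n" "set w \<subseteq> {..<n}" "\<sigma> \<in> standard_tableaux \<mu>"
  shows "rep_word \<mu> w \<sigma> \<tau> = act_word w (delta \<tau>) \<sigma>"
  using assms(2,3)
proof (induction w arbitrary: \<sigma>)
  case (Cons i w)
  have \<sigma>: "\<sigma> \<in> paths n" "set \<sigma> = boxes \<mu>"
    using Cons.prems standard_tableaux_eq[OF assms(1)] by auto
  have "rep_word \<mu> (i # w) \<sigma> \<tau> = (\<Sum>\<rho>\<in>standard_tableaux \<mu>. rep_gen i \<sigma> \<rho> * act_word w (delta \<tau>) \<rho>)"
    using Cons by simp
  also have "\<dots> = act_gen i (act_word w (delta \<tau>)) \<sigma>"
    using sum_rep_gen[OF \<sigma>(1), of i] Cons.prems \<sigma>(2) by (simp add: standard_tableaux_eq[OF assms(1)])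
  finally show ?case by simp
qed (simp add: delta_def)

lemma rep_eq:
  assumes "\<mu> \<in> double_partitions n" "x \<in> H n" "\<sigma> \<in> standard_tableaux \<mu>"
  shows "rep \<mu> x \<sigma> \<tau> = hrep n x (delta \<tau>) \<sigma>"
proof -
  define a where "a = (SOME a. a \<in> free_alg_upto n \<and> abs_hecke a = x)"
  have "\<exists>a. a \<in> free_alg_upto n \<and> abs_hecke a = x"
    using assms(2) by (auto simp: H_def)
  then have "a \<in> free_alg_upto n"
    unfolding a_def by (rule someI2_ex) simp
  then have "rep_free \<mu> a \<sigma> \<tau> = act_free a (delta \<tau>) \<sigma>"
    unfolding rep_free_def act_free_def using rep_word_eq[OF assms(1) _ assms(3)]
    by (intro sum.cong refl) (auto simp: free_alg_upto_def in_lists_conv_set subset_iff)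
  moreover obtain \<alpha> \<beta> where "\<mu> = (\<alpha>, \<beta>)" "sum_list \<alpha> + sum_list \<beta> = n"
    using assms(1) by (auto simp: double_partitions_def)
  ultimately show ?thesis
    by (simp add: rep_def hrep_def a_def)
qed

lemma standard_tableaux_eq_shape:
  assumes "\<mu> \<in> double_partitions n"
  shows "standard_tableaux \<mu> = {\<sigma> \<in> paths n. shape (set \<sigma>) = \<mu>}"
  unfolding standard_tableaux_eq[OF assms]
  using shape_boxes[OF assms] boxes_shape[OF diagram_paths] by auto

lemma sum_weight_irr_char:
  assumes "x \<in> H n"
  shows "(\<Sum>\<mu>\<in>double_partitions n. weight r1 r2 \<mu> * irr_char \<mu> x) = weighted_char r1 r2 n x"
proof -
  have "(\<Sum>\<mu>\<in>double_partitions n. weight r1 r2 \<mu> * irr_char \<mu> x) =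
      (\<Sum>\<mu>\<in>double_partitions n. \<Sum>\<sigma>\<in>{\<sigma> \<in> paths n. shape (set \<sigma>) = \<mu>}.
        set_weight r1 r2 (set \<sigma>) * hrep n x (delta \<sigma>) \<sigma>)"
  proof (intro sum.cong refl)
    fix \<mu> assume \<mu>: "\<mu> \<in> double_partitions n"
    show "weight r1 r2 \<mu> * irr_char \<mu> x =
        (\<Sum>\<sigma>\<in>{\<sigma> \<in> paths n. shape (set \<sigma>) = \<mu>}. set_weight r1 r2 (set \<sigma>) * hrep n x (delta \<sigma>) \<sigma>)"
      unfolding irr_char_def sum_distrib_left standard_tableaux_eq_shape[OF \<mu>, symmetric]
      using rep_eq[OF \<mu> assms] by (intro sum.cong refl) (auto simp: standard_tableaux_eq_shape[OF \<mu>] set_weight_def)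
  qed
  also have "\<dots> = weighted_char r1 r2 n x"
    unfolding weighted_char_def
  proof (rule sum.group[OF finite_paths finite_double_partitions])
    show "(\<lambda>\<sigma>. shape (set \<sigma>)) ` paths n \<subseteq> double_partitions n"
      using shape_in_double_partitions[OF diagram_paths] by (auto simp: paths_card)
  qed
  finally show ?thesis .
qed



section \<open>Matrix units\<close>

text \<open>The elements \<open>g_n ... g_1 t g_1 ... g_n\<close>. Unlike the \<open>t'_n\<close>,
  which carry inverses on the right, they act diagonally on tableaux.\<close>

fun jucys_murphy :: "nat \<Rightarrow> hecke" where
  "jucys_murphy 0 = hecke_gen 0"
| "jucys_murphy (Suc n) = hecke_gen (Suc n) * (jucys_murphy n * hecke_gen (Suc n))"

lemma jucys_murphy_in_H: "n < N \<Longrightarrow> jucys_murphy n \<in> H N"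
  by (induction n) (auto intro!: H_mult H_gen)

text \<open>In the induction step \<open>1\<close> says that the coefficient of the exchanged path
  cancels, and \<open>2\<close> computes the remaining diagonal one.\<close>

lemma hrep_jucys_murphy:
  assumes "n < N" "\<sigma> \<in> paths N"
  shows "hrep N (jucys_murphy n) f \<sigma> = qvar ^ n * wcontent (\<sigma> ! n) * f \<sigma>"
  using assms
proof (induction n arbitrary: f \<sigma>)
  case 0
  obtain c where "\<sigma> ! 0 = (c, 0, 0)" using paths_first_box[OF 0(2,1)] by blast
  then have "t_eigenvalue (\<sigma> ! 0) = wcontent (\<sigma> ! 0)"
    by (cases c) (simp_all add: t_eigenvalue_def)
  then show ?case using 0 by (simp add: hrep_gen)
next
  case (Suc n)
  let ?g = "hecke_gen (Suc n)" and ?s = "swap_entries (Suc n) \<sigma>"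
  let ?x = "\<sigma> ! n" and ?y = "\<sigma> ! Suc n"
  have len: "Suc n < length \<sigma>" using Suc.prems by (simp add: paths_length)
  have J: "jucys_murphy n \<in> H N" "?g \<in> H N" using Suc.prems by (auto intro: jucys_murphy_in_H H_gen)
  define F where "F = hrep N (jucys_murphy n * ?g) f"
  have F: "F \<rho> = qvar ^ n * wcontent (\<rho> ! n) * act_gen (Suc n) f \<rho>" if "\<rho> \<in> paths N" for \<rho>
    using that J Suc by (simp add: F_def hrep_mult hrep_gen del: act_gen.simps)
  have Fs: "hoff ?y ?x * F ?s = hoff ?y ?x * (qvar ^ n * wcontent ?y * (hdiag ?y ?x * f ?s + hoff ?x ?y * f \<sigma>))"
  proof (cases "?s \<in> paths N")
    case True
    then show ?thesis
      using F[OF True] len by (simp add: nth_swap_entries swap_entries_swap_entries)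
  next
    case False
    then show ?thesis using hoff_zero_if_not_path[OF Suc.prems(2,1)] by simp
  qed
  have ne: "wcontent ?x \<noteq> wcontent ?y" using wcontent_nth_neq[OF Suc.prems(2,1)] by simp
  have d: "wcontent ?y - wcontent ?x \<noteq> 0" using ne by simp
  have xy: "wcontent ?x - wcontent ?y = - (wcontent ?y - wcontent ?x)" by simp
  have 1: "hdiag ?x ?y * wcontent ?x + hdiag ?y ?x * wcontent ?y = 0"
    unfolding hdiag_eq[OF ne] hdiag_eq[OF ne[symmetric]] xy using d
    by (simp only: divide_minus_right) (simp add: mult_ac)
  have 2: "hdiag ?x ?y ^ 2 * wcontent ?x + hoff ?x ?y * hoff ?y ?x * wcontent ?y = qvar * wcontent ?y"
    unfolding hoff_mult[OF ne] unfolding hdiag_eq[OF ne] hdiag_eq[OF ne[symmetric]] xy using d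
    by (simp add: divide_simps power2_eq_square) (simp add: algebra_simps)
  have "hrep N (jucys_murphy (Suc n)) f \<sigma> = hrep N ?g F \<sigma>"
    using J Suc.prems by (simp add: hrep_mult H_mult F_def)
  also have "\<dots> = hdiag ?x ?y * F \<sigma> + hoff ?y ?x * F ?s"
    using Suc.prems by (simp add: hrep_gen)
  also have "\<dots> = qvar ^ n * ((hdiag ?x ?y ^ 2 * wcontent ?x + hoff ?x ?y * hoff ?y ?x * wcontent ?y) * f \<sigma> +
      hoff ?y ?x * (hdiag ?x ?y * wcontent ?x + hdiag ?y ?x * wcontent ?y) * f ?s)"
    unfolding Fs F[OF Suc.prems(2)] by (simp add: algebra_simps power2_eq_square)
  also have "\<dots> = qvar ^ Suc n * wcontent ?y * f \<sigma>"
    unfolding 1 2 by simp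
  finally show ?case .
qed

text \<open>The product of the factors \<open>(J - d) / (c - d)\<close> over \<open>d\<close> in
  \<open>C\<close>, where \<open>J\<close> is the Jucys-Murphy element rescaled so that its
  eigenvalues are the contents.\<close>

lemma ex_content_projection:
  assumes "finite C" "c \<notin> C" "n < N"
  shows "\<exists>x\<in>H N. \<exists>e. e c = 1 \<and> (\<forall>d\<in>C. e d = 0) \<and>
    (\<forall>\<sigma>\<in>paths N. \<forall>f. hrep N x f \<sigma> = e (wcontent (\<sigma> ! n)) * f \<sigma>)"
  using assms(1,2)
proof (induction C)
  case empty
  show ?case by (intro bexI[OF _ H_1] exI[of _ "\<lambda>d. 1"]) (simp add: hrep_1)
next
  case (insert d C)
  then obtain x e where x: "x \<in> H N" "e c = 1" "\<forall>d\<in>C. e d = 0"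
    "\<And>\<sigma> f. \<sigma> \<in> paths N \<Longrightarrow> hrep N x f \<sigma> = e (wcontent (\<sigma> ! n)) * f \<sigma>" by blast
  let ?J = "hecke_scale (inverse (qvar ^ n)) (jucys_murphy n)"
  let ?y = "hecke_scale (inverse (c - d)) (?J - hecke_scale d 1)"
  have y: "?y \<in> H N" using assms(3) by (intro H_scale H_diff jucys_murphy_in_H H_1)
  have "hrep N ?y f \<sigma> = (wcontent (\<sigma> ! n) - d) / (c - d) * f \<sigma>" if \<sigma>: "\<sigma> \<in> paths N" for \<sigma> f
  proof -
    have "hrep N ?J f \<sigma> = inverse (qvar ^ n) * (qvar ^ n * wcontent (\<sigma> ! n) * f \<sigma>)"
      using \<sigma> assms(3) by (simp only: hrep_scale jucys_murphy_in_H hrep_jucys_murphy)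
    then have J: "hrep N ?J f \<sigma> = wcontent (\<sigma> ! n) * f \<sigma>"
      using qvar_nonzero by simp
    have "hrep N ?y f \<sigma> = inverse (c - d) * (hrep N ?J f \<sigma> - d * f \<sigma>)"
      using \<sigma> assms(3) by (simp only: hrep_scale hrep_diff hrep_1 H_scale H_diff H_1 jucys_murphy_in_H)
    then show ?thesis
      unfolding J by (simp add: divide_inverse algebra_simps)
  qed
  then have "hrep N (?y * x) f \<sigma> =
      (wcontent (\<sigma> ! n) - d) / (c - d) * e (wcontent (\<sigma> ! n)) * f \<sigma>" if "\<sigma> \<in> paths N" for \<sigma> f
    using that x y by (simp add: hrep_mult)
  then show ?case
    using insert.hyps insert.prems x y
    by (intro bexI[of _ "?y * x"] exI[of _ "\<lambda>u. (u - d) / (c - d) * e u"]) (auto intro: H_mult)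
qed

text \<open>The condition ranges over paths of all shapes of size \<open>n\<close>, so
  \<open>x\<close> also acts as zero on the other blocks.\<close>

definition matrix_unit :: "nat \<Rightarrow> box list \<Rightarrow> box list \<Rightarrow> hecke \<Rightarrow> bool" where
  "matrix_unit n \<sigma> \<tau> x \<longleftrightarrow> x \<in> H n \<and> (\<forall>\<rho>\<in>paths n. \<forall>f. hrep n x f \<rho> = delta \<sigma> \<rho> * f \<tau>)"

text \<open>A box with the largest sum of row and column index has no box below it or to its right,
  so it can be removed and placed last.\<close>

lemma ex_path:
  assumes "diagram S"
  shows "\<exists>\<sigma>\<in>paths (card S). set \<sigma> = S"
  using assms
proof (induction "card S" arbitrary: S)
  case 0
  then show ?case by (simp add: diagram_def)
next
  case (Suc n)
  have fin: "finite S" using Suc.prems by (simp add: diagram_def)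
  let ?h = "\<lambda>(c :: component, i :: nat, j :: nat). i + j"
  have "S \<noteq> {}" using Suc.hyps(2) by auto
  then have "Max (?h ` S) \<in> ?h ` S" using fin by (intro Max_in) auto
  then obtain b where b: "b \<in> S" "?h b = Max (?h ` S)" by (metis (no_types, lifting) imageE)
  have b_max: "?h x \<le> ?h b" if "x \<in> S" for x
    unfolding b(2) using fin that by (intro Max_ge) auto
  have "down_closed (S - {b})"
    unfolding down_closed_def
  proof (intro allI impI, elim conjE)
    fix c i j i' j' assume *: "(c, i', j') \<in> S - {b}" "i \<le> i'" "j \<le> j'"
    then have "(c, i, j) \<in> S"
      using Suc.prems down_closedD[of S c i' j' i j] by (auto simp: diagram_def)
    moreover have "(c, i, j) \<noteq> b"
      using * b_max[of "(c, i', j')"] by auto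
    ultimately show "(c, i, j) \<in> S - {b}" by simp
  qed
  then have d: "diagram (S - {b})" using fin by (simp add: diagram_def)
  have "n = card (S - {b})" using Suc.hyps(2) b(1) fin by simp
  then obtain \<sigma> where \<sigma>: "\<sigma> \<in> paths n" "set \<sigma> = S - {b}" using Suc.hyps(1) d by blast
  have "b \<in> addable (S - {b})"
    using Suc.prems b(1) by (simp add: addable_def insert_absorb diagram_def)
  then have "\<sigma> @ [b] \<in> paths (Suc n)" using \<sigma> by (simp add: paths_snoc)
  then show ?case using Suc.hyps(2) \<sigma>(2) b(1) by (intro bexI[of _ "\<sigma> @ [b]"]) auto
qed

text \<open>In \<open>H (Suc n)\<close> the given matrix unit acts alike on all extensions by a box.
  A projection to the content of the last box selects \<open>b\<close>, because addable boxes have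
  distinct contents.\<close>

lemma matrix_unit_same_last:
  assumes "matrix_unit n \<sigma> \<tau> x" "\<sigma> @ [b] \<in> paths (Suc n)" "\<tau> @ [b] \<in> paths (Suc n)"
  shows "\<exists>y. matrix_unit (Suc n) (\<sigma> @ [b]) (\<tau> @ [b]) y"
proof -
  have x: "x \<in> H n" "x \<in> H (Suc n)"
    using assms(1) H_mono[of n "Suc n"] by (auto simp: matrix_unit_def)
  let ?C = "(\<lambda>\<rho>. wcontent (\<rho> ! n)) ` paths (Suc n) - {wcontent b}"
  have "finite ?C" using finite_paths by simp
  then obtain p e where p: "p \<in> H (Suc n)" "e (wcontent b) = 1" "\<forall>d\<in>?C. e d = 0"
    and pe: "\<And>\<sigma> f. \<sigma> \<in> paths (Suc n) \<Longrightarrow> hrep (Suc n) p f \<sigma> = e (wcontent (\<sigma> ! n)) * f \<sigma>"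
    using ex_content_projection[of ?C "wcontent b" n "Suc n"] by auto
  have "hrep (Suc n) (p * x) f \<rho> = delta (\<sigma> @ [b]) \<rho> * f (\<tau> @ [b])" if \<rho>: "\<rho> \<in> paths (Suc n)" for \<rho> f
  proof -
    obtain \<pi> u where \<pi>: "\<rho> = \<pi> @ [u]" "\<pi> \<in> paths n" "u \<in> addable (set \<pi>)"
      using \<rho> by (rule paths_SucE)
    have "hrep (Suc n) x f (\<pi> @ [u]) = hrep n x (\<lambda>\<rho>. f (\<rho> @ [u])) \<pi>"
      using \<rho> \<pi> x(1) by (intro hrep_append) auto
    then have "hrep (Suc n) x f \<rho> = delta \<sigma> \<pi> * f (\<tau> @ [u])"
      using assms(1) \<pi> by (simp add: matrix_unit_def)
    then have 1: "hrep (Suc n) (p * x) f \<rho> = e (wcontent u) * (delta \<sigma> \<pi> * f (\<tau> @ [u]))"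
      using pe[OF \<rho>] p x \<rho> paths_length[OF \<pi>(2)] by (simp add: hrep_mult \<pi>(1) nth_append)
    show ?thesis
    proof (cases "\<pi> = \<sigma> \<and> u \<noteq> b")
      case True
      then have "wcontent u \<noteq> wcontent b"
        using addable_wcontent_inj[of u "set \<sigma>" b] \<pi>(3) assms(2) by (auto simp: paths_snoc)
      moreover have "wcontent u = wcontent (\<rho> ! n)"
        using paths_length[OF \<pi>(2)] by (simp add: \<pi>(1) nth_append)
      ultimately have "e (wcontent u) = 0" using p(3) \<rho> by auto
      then show ?thesis unfolding 1 using True by (simp add: \<pi>(1) delta_def)
    next
      case False
      then show ?thesis unfolding 1 using p(2) by (auto simp: \<pi>(1) delta_def)
    qed
  qed
  then have "matrix_unit (Suc n) (\<sigma> @ [b]) (\<tau> @ [b]) (p * x)"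
    using p(1) x(2) by (simp add: matrix_unit_def H_mult)
  then show ?thesis ..
qed

text \<open>The coefficient could vanish only for adjacent boxes or for contents with ratio
  \<open>q\<close>. In either case one box would lie weakly above and to the left of the other,
  which two distinct addable boxes never do.\<close>

lemma hoff_addable_nonzero:
  assumes "b \<in> addable S" "b' \<in> addable S" "b \<noteq> b'"
  shows "hoff b b' \<noteq> 0"
proof -
  obtain c i j c' i' j' where bb: "b = (c, i, j)" "b' = (c', i', j')"
    by (cases b; cases b')
  have b: "(c, i, j) \<notin> S" "down_closed (insert (c, i, j) S)"
    and b': "(c', i', j') \<notin> S" "down_closed (insert (c', i', j') S)"
    using assms(1,2) by (auto simp: addable_def bb)
  have nle: "\<not> (c = c' \<and> i \<le> i' \<and> j \<le> j')" "\<not> (c = c' \<and> i' \<le> i \<and> j' \<le> j)"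
    using down_closedD[OF b'(2), of c i' j' i j] down_closedD[OF b(2), of c i j i' j'] b(1) b'(1) assms(3)
    by (auto simp: bb)
  then have "\<not> adjacent b b'" by (auto simp: bb)
  moreover have "wcontent b \<noteq> wcontent b'"
    using assms addable_wcontent_inj by blast
  moreover have "wcontent b \<noteq> qvar * wcontent b'"
    unfolding bb wcontent_eq_mult_qvar_iff using nle by auto
  moreover have "1 + hdiag b b' = (qvar * wcontent b' - wcontent b) / (wcontent b' - wcontent b)"
    using \<open>wcontent b \<noteq> wcontent b'\<close> by (simp add: hdiag_eq field_simps)
  ultimately show ?thesis by (simp add: hoff_def)
qed

lemma matrix_unit_mult:
  assumes "matrix_unit n \<sigma> \<rho> x" "matrix_unit n \<pi> \<tau> y" "g \<in> H n"
    and "\<And>f. hrep n g (\<lambda>\<xi>. delta \<pi> \<xi> * f \<tau>) \<rho> = c * f \<tau>" "c \<noteq> 0" "\<sigma> \<in> paths n"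
    and "\<rho> \<in> paths n"
  shows "\<exists>z. matrix_unit n \<sigma> \<tau> z"
proof -
  have H: "x \<in> H n" "y \<in> H n" using assms by (auto simp: matrix_unit_def)
  have "hrep n (x * (g * y)) f \<xi> = c * (delta \<sigma> \<xi> * f \<tau>)" if \<xi>: "\<xi> \<in> paths n" for \<xi> f
  proof -
    have "hrep n (x * (g * y)) f \<xi> = delta \<sigma> \<xi> * hrep n (g * y) f \<rho>"
      using assms(1,3) H \<xi> by (simp add: hrep_mult H_mult matrix_unit_def)
    also have "hrep n (g * y) f \<rho> = hrep n g (hrep n y f) \<rho>"
      using assms(3,7) H by (simp add: hrep_mult)
    also have "\<dots> = hrep n g (\<lambda>\<xi>. delta \<pi> \<xi> * f \<tau>) \<rho>"
      using assms(2,3,7) by (intro hrep_cong_paths) (auto simp: matrix_unit_def)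
    finally show ?thesis by (simp add: assms(4))
  qed
  then have "matrix_unit n \<sigma> \<tau> (hecke_scale (inverse c) (x * (g * y)))"
    using H assms(3,5) by (simp add: matrix_unit_def H_scale H_mult hrep_scale)
  then show ?thesis ..
qed

text \<open>For equal last boxes the matrix unit is lifted from \<open>H n\<close>. For different
  ones, two such lifts are joined by \<open>g_n\<close> through a pair of paths that differ only in
  the order of the last two boxes.\<close>

lemma ex_matrix_unit:
  assumes "\<sigma> \<in> paths n" "\<tau> \<in> paths n" "set \<sigma> = set \<tau>"
  shows "\<exists>x. matrix_unit n \<sigma> \<tau> x"
  using assms
proof (induction n arbitrary: \<sigma> \<tau>)
  case 0
  then show ?case
    by (intro exI[of _ 1]) (simp add: matrix_unit_def H_1 hrep_1)
next
  case (Suc n)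
  have same: "\<exists>x. matrix_unit (Suc n) (\<alpha> @ [b]) (\<beta> @ [b]) x"
    if "\<alpha> @ [b] \<in> paths (Suc n)" "\<beta> @ [b] \<in> paths (Suc n)" "set (\<alpha> @ [b]) = set (\<beta> @ [b])" for \<alpha> \<beta> b
  proof -
    have "b \<notin> set \<alpha>" "b \<notin> set \<beta>" "\<alpha> \<in> paths n" "\<beta> \<in> paths n"
      using that(1,2) by (auto simp: paths_snoc addable_def)
    moreover from this have "set \<alpha> = set \<beta>" using that(3) by auto
    ultimately obtain x where "matrix_unit n \<alpha> \<beta> x" using Suc.IH by blast
    then show ?thesis using that(1,2) by (rule matrix_unit_same_last)
  qed
  obtain \<alpha> b where \<alpha>: "\<sigma> = \<alpha> @ [b]" "\<alpha> \<in> paths n" "b \<in> addable (set \<alpha>)"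
    using Suc.prems(1) by (rule paths_SucE)
  obtain \<beta> b' where \<beta>: "\<tau> = \<beta> @ [b']" "\<beta> \<in> paths n" "b' \<in> addable (set \<beta>)"
    using Suc.prems(2) by (rule paths_SucE)
  show ?case
  proof (cases "b = b'")
    case True
    then show ?thesis using same[of \<alpha> b \<beta>] Suc.prems by (simp add: \<alpha>(1) \<beta>(1))
  next
    case False
    let ?T = "set \<alpha> \<inter> set \<beta>"
    have nb: "b \<notin> set \<alpha>" "b' \<notin> set \<beta>" using \<alpha>(3) \<beta>(3) by (auto simp: addable_def)
    have S: "insert b (set \<alpha>) = insert b' (set \<beta>)" using Suc.prems(3) by (simp add: \<alpha>(1) \<beta>(1))
    have a: "set \<alpha> = insert b' ?T" and b: "set \<beta> = insert b ?T"
      using S nb False by auto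
    have nT: "b \<notin> ?T" "b' \<notin> ?T" using nb by auto
    have T: "diagram ?T"
      using diagram_paths[OF \<alpha>(2)] diagram_paths[OF \<beta>(2)] down_closed_Int by (auto simp: diagram_def)
    have add: "b' \<in> addable ?T" "b \<in> addable ?T"
      using nT paths_down_closed[OF \<alpha>(2)] paths_down_closed[OF \<beta>(2)] a b by (simp_all add: addable_def)
    have card: "n = Suc (card ?T)"
      using paths_card[OF \<alpha>(2)] arg_cong[OF a, of card] nT by simp
    \<comment> \<open>Any filling of the common part \<open>?T\<close> serves: followed by
      \<open>b', b\<close> it has the last box of \<open>\<sigma>\<close>, followed by
      \<open>b, b'\<close> that of \<open>\<tau>\<close>.\<close>
    obtain \<pi> where \<pi>: "\<pi> \<in> paths (card ?T)" "set \<pi> = ?T" using ex_path[OF T] by blast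
    have p1: "\<pi> @ [b', b] \<in> paths (Suc n)" and p2: "\<pi> @ [b, b'] \<in> paths (Suc n)"
      unfolding card paths_snoc2 \<pi>(2) using \<pi>(1) add a b \<alpha>(3) \<beta>(3) by auto
    obtain x where x: "matrix_unit (Suc n) (\<alpha> @ [b]) ((\<pi> @ [b']) @ [b]) x"
      using same[of \<alpha> b "\<pi> @ [b']"] Suc.prems(1) p1 a \<pi>(2) by (auto simp: \<alpha>(1))
    obtain y where y: "matrix_unit (Suc n) ((\<pi> @ [b]) @ [b']) (\<beta> @ [b']) y"
      using same[of "\<pi> @ [b]" b' \<beta>] Suc.prems(2) p2 b \<pi>(2) by (auto simp: \<beta>(1))
    have len: "length \<pi> = card ?T" using \<pi>(1) by (rule paths_length)
    have swap: "swap_entries n (\<pi> @ [b', b]) = \<pi> @ [b, b']"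
      using swap_entries_snoc2[of "card ?T" \<pi> b' b] len card by simp
    have "hrep (Suc n) (hecke_gen n) (\<lambda>\<xi>. delta ((\<pi> @ [b]) @ [b']) \<xi> * f (\<beta> @ [b'])) ((\<pi> @ [b']) @ [b]) =
        hoff b b' * f (\<beta> @ [b'])" for f
    proof -
      have "act_gen n F (\<pi> @ [b', b]) = hdiag b' b * F (\<pi> @ [b', b]) + hoff b b' * F (\<pi> @ [b, b'])" for F
        using swap len unfolding card by (simp add: nth_append)
      then show ?thesis
        using p1 False by (simp add: hrep_gen delta_def)
    qed
    then show ?thesis
      using matrix_unit_mult[OF x y, of "hecke_gen n" "hoff b b'"] hoff_addable_nonzero[OF add(2,1) False]
        Suc.prems(1) p1 H_gen[of n "Suc n"] by (simp add: \<alpha>(1) \<beta>(1))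
  qed
qed

text \<open>Sandwiching a matrix unit \<open>x\<close> in \<open>p * x * p = c p\<close> shows that
  \<open>p\<close> acts with rank one on the block of \<open>\<mu>\<close> and as zero on all
  others. An idempotent of rank one has trace 1, so only the weight of \<open>\<mu>\<close>
  remains.\<close>

lemma weighted_char_minimal_idempotent:
  assumes \<mu>: "\<mu> \<in> double_partitions n" and p: "p \<in> minimal_idempotents_at n \<mu>"
  shows "weighted_char r1 r2 n p = weight r1 r2 \<mu>"
proof -
  have pH: "p \<in> H n" "p * p = p" and pxp: "\<And>x. x \<in> H n \<Longrightarrow> \<exists>c. p * x * p = hecke_scale c p"
    using p by (auto simp: minimal_idempotents_at_def minimal_idempotent_def)
  let ?P = "\<lambda>\<rho> \<xi>. hrep n p (delta \<xi>) \<rho>"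
  obtain \<alpha> \<beta> where \<alpha>: "\<alpha> \<in> standard_tableaux \<mu>" and \<beta>: "\<beta> \<in> standard_tableaux \<mu>" and "rep \<mu> p \<alpha> \<beta> \<noteq> 0"
    using p by (auto simp: minimal_idempotents_at_def)
  then have nz: "?P \<alpha> \<beta> \<noteq> 0" using rep_eq[OF \<mu> pH(1)] by simp
  have paths: "\<alpha> \<in> paths n" "\<beta> \<in> paths n" "set \<alpha> = boxes \<mu>" "set \<beta> = boxes \<mu>"
    using \<alpha> \<beta> by (auto simp: standard_tableaux_eq[OF \<mu>])
  obtain x where x: "matrix_unit n \<beta> \<alpha> x" using ex_matrix_unit[of \<beta> n \<alpha>] paths by auto
  then have xH: "x \<in> H n" by (simp add: matrix_unit_def)
  obtain c where c: "p * x * p = hecke_scale c p" using pxp[OF xH] by blast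
  \<comment> \<open>Since \<open>x\<close> sends a function to its value at \<open>\<alpha>\<close>,
    placed at \<open>\<beta>\<close>, the entries of \<open>p * x * p\<close> are products of a
    column entry and a row entry of \<open>p\<close>.\<close>
  have rank1: "?P \<rho> \<beta> * ?P \<alpha> \<xi> = c * ?P \<rho> \<xi>" if \<rho>: "\<rho> \<in> paths n" for \<rho> \<xi>
  proof -
    have "c * ?P \<rho> \<xi> = hrep n (p * (x * p)) (delta \<xi>) \<rho>"
      using hrep_scale[OF pH(1) \<rho>, of c "delta \<xi>"] c by (simp add: mult.assoc)
    also have "\<dots> = hrep n p (hrep n (x * p) (delta \<xi>)) \<rho>"
      using pH xH \<rho> by (intro hrep_mult H_mult)
    also have "\<dots> = hrep n p (\<lambda>\<zeta>. ?P \<alpha> \<xi> * delta \<beta> \<zeta>) \<rho>"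
      using pH xH x \<rho> by (intro hrep_cong_paths) (auto simp: hrep_mult matrix_unit_def mult.commute)
    also have "\<dots> = ?P \<alpha> \<xi> * ?P \<rho> \<beta>"
      by (rule hrep_linear)
    finally show ?thesis by (simp add: mult.commute)
  qed
  have c: "c = ?P \<alpha> \<beta>"
    using rank1[OF paths(1), of \<beta>] nz by simp
  have block: "set_weight r1 r2 (set \<rho>) * ?P \<rho> \<rho> = weight r1 r2 \<mu> * (?P \<alpha> \<rho> * ?P \<rho> \<beta>) / c"
    if \<rho>: "\<rho> \<in> paths n" for \<rho>
  proof (cases "set \<rho> = boxes \<mu>")
    case True
    then have "set_weight r1 r2 (set \<rho>) = weight r1 r2 \<mu>"
      by (simp add: set_weight_def shape_boxes[OF \<mu>])
    moreover have "?P \<rho> \<rho> = ?P \<alpha> \<rho> * ?P \<rho> \<beta> / c"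
      using rank1[OF \<rho>, of \<rho>] nz by (simp add: c mult.commute)
    ultimately show ?thesis by simp
  next
    case False
    then have "?P \<rho> \<beta> = 0"
      using hrep_delta_block[OF pH(1) \<rho>, of \<beta>] paths by simp
    then show ?thesis using rank1[OF \<rho>, of \<rho>] nz by (simp add: c)
  qed
  have "weighted_char r1 r2 n p = (\<Sum>\<rho>\<in>paths n. weight r1 r2 \<mu> * (?P \<alpha> \<rho> * ?P \<rho> \<beta>) / c)"
    unfolding weighted_char_def by (rule sum.cong[OF refl block])
  also have "\<dots> = weight r1 r2 \<mu> * (\<Sum>\<rho>\<in>paths n. ?P \<alpha> \<rho> * ?P \<rho> \<beta>) / c"
    by (simp only: sum_distrib_left sum_divide_distrib)
  \<comment> \<open>The entry at \<open>\<alpha>\<close> and \<open>\<beta>\<close> of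
    \<open>p * p = p\<close>.\<close>
  also have "(\<Sum>\<rho>\<in>paths n. ?P \<alpha> \<rho> * ?P \<rho> \<beta>) = c"
    using hrep_expand[OF pH(1) paths(1), of "hrep n p (delta \<beta>)"] hrep_mult[OF pH(1) pH(1) paths(1), of "delta \<beta>"]
    by (simp add: pH(2) c)
  finally show ?thesis using nz c by simp
qed

theorem theorem5p5:
  fixes r1 r2 r :: nat and z y :: ratfun and tr :: "hecke \<Rightarrow> ratfun"
  assumes "r1 > 0" and "r2 > 0" and "r = r1 + r2"
    and "z = qvar ^ r * (1 - qvar) / (1 - qvar ^ r)"
    and "y = (qvar ^ r2 * Qvar + 1) * (1 - qvar ^ r1) / (1 - qvar ^ r) - 1"
    and "markov_trace z tr"
    and "\<forall>k\<ge>1. tr (prod_list (map tprime [0..<k])) = y ^ k"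
  shows "\<forall>n\<ge>1.
    (\<forall>x\<in>H n. tr x = (\<Sum>\<mu>\<in>double_partitions n. weight r1 r2 \<mu> * irr_char \<mu> x)) \<and>
    (\<forall>\<mu>\<in>double_partitions n. \<forall>p\<in>minimal_idempotents_at n \<mu>. tr p = weight r1 r2 \<mu>)"
proof -
  have "y = tprime_expectation r1 r2"
    unfolding assms(3,5) tprime_expectation_def ..
  then have "tr = weighted_trace r1 r2"
    using assms markov_trace_weighted_trace[OF assms(1,2)]
    by (intro markov_trace_unique[of z]) (simp_all add: weighted_trace_prod_tprime)
  then have tr: "tr x = weighted_char r1 r2 n x" if "x \<in> H n" for n x
    using weighted_trace_eq[OF assms(1) that] by simp
  moreover have "tr p = weight r1 r2 \<mu>"
    if "\<mu> \<in> double_partitions n" "p \<in> minimal_idempotents_at n \<mu>" for n \<mu> p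
    using that tr[of p n] weighted_char_minimal_idempotent[OF that]
    by (simp add: minimal_idempotents_at_def minimal_idempotent_def)
  ultimately show ?thesis
    by (simp add: sum_weight_irr_char)
qed

end
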